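(* Let $\gamma\in(\frac23,2)$ and let $(\overline M,\overline g)$ be a warped product spacetime of type $-1$ associated with $\gamma$. There exists a (suitably large) constant $\tilde G>0$, independent of $t_0$ and of the wave, such that for all sufficiently small $t_0>0$ the following holds. Let $\psi$ be a smooth wave on $(\overline M,\overline g)$ with leading coefficient $A$ such that $\partial_t\psi(t_0,\cdot)$ is not identically zero, and suppose there exists $\epsilon\in(0,1)$ such that $$\epsilon\left[1-\tilde Gt_0^{2-\frac{4}{3\gamma}}\right]\int_M|\partial_t\psi(t_0,\cdot)|^2\,\mathrm{vol}_M>\tilde Gt_0^{2-\frac{4}{3\gamma}}\int_M|\partial_t\Delta\psi(t_0,\cdot)|^2\,\mathrm{vol}_M$$ and $$(1-\epsilon)\left[1-\tilde Gt_0^{2-\frac{4}{3\gamma}}\right]a(t_0)^2\int_M|\partial_t\psi(t_0,\cdot)|^2\,\mathrm{vol}_M>\left(1+\tilde Gt_0^{2-\frac{4}{3\gamma}}\right)\int_M|\nabla\psi(t_0,\cdot)|_g^2\,\mathrm{vol}_M+\tilde Gt_0^{2-\frac{4}{3\gamma}}\int_M|\nabla\Delta\psi(t_0,\cdot)|_g^2\,\mathrm{vol}_M .$$ Then $\|A\|_{L^2(M)}>0$.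
   Context: $(M,g)$ is a closed three-dimensional smooth Riemannian manifold with Levi-Civita connection $\nabla$, Laplace-Beltrami operator $\Delta=g^{ij}\nabla_i\nabla_j$ and volume measure $\mathrm{vol}_M$. A warped product spacetime of type $-1$ associated with $\gamma$ is $\overline M=(0,\infty)\times M$ with $\overline g=-dt^2+a(t)^2g$ where, for some constant $B>0$, $a$ is the unique function continuous on $[0,\infty)$, positive and smooth on $(0,\infty)$, with $a(0)=0$ and $\dot a=\sqrt{\frac{8\pi B}{3}a^{2-3\gamma}+1}$ on $(0,\infty)$. A smooth wave is $\psi\in C^\infty(\overline M)$ with $-\partial_t^2\psi+a^{-2}\Delta\psi-3\frac{\dot a}{a}\partial_t\psi=0$. Leading coefficient: for a smooth wave $\psi$, $A\in C^\infty(M)$ denotes the unique smooth function with $\psi(t,x)/\int_t^\infty a(s)^{-3}ds\to A(x)$ as $t\downarrow0$ uniformly in $x\in M$ (such $A$ always exists). *)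

theory Defs
  imports "HOL-Analysis.Analysis"
begin

section \<open>Smooth maps between normed spaces\<close>

text \<open>Both notions are only used on open sets \<open>S\<close>.\<close>

fun Ck_on :: "nat \<Rightarrow> 'a::real_normed_vector set \<Rightarrow> ('a \<Rightarrow> 'b::real_normed_vector) \<Rightarrow> bool" where
  "Ck_on 0 S f \<longleftrightarrow> continuous_on S f"
| "Ck_on (Suc k) S f \<longleftrightarrow>
     (\<forall>x\<in>S. f differentiable (at x)) \<and> (\<forall>v. Ck_on k S (\<lambda>x. frechet_derivative f (at x) v))"

definition smooth_on :: "'a::real_normed_vector set \<Rightarrow> ('a \<Rightarrow> 'b::real_normed_vector) \<Rightarrow> bool" where
  "smooth_on S f \<longleftrightarrow> (\<forall>k. Ck_on k S f)"

section \<open>Closed smooth manifolds\<close>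

text \<open>The manifold is the whole of a Hausdorff type \<open>'a\<close>; its smooth structure is given by an
  atlas (not necessarily maximal).  A chart is a pair of its domain and its coordinate map, whose
  values outside the domain are irrelevant.  Second countability need not be demanded, since it
  follows from compactness.  Connectedness is not required.\<close>

type_synonym ('a, 'n) chart = "'a set \<times> ('a \<Rightarrow> real ^ 'n)"

definition chart_inv :: "('a, 'n) chart \<Rightarrow> real ^ 'n \<Rightarrow> 'a" where
  "chart_inv c = inv_into (fst c) (snd c)"

definition chart_image :: "('a, 'n) chart \<Rightarrow> (real ^ 'n) set" where
  "chart_image c = snd c ` fst c"

definition is_chart :: "('a::topological_space, 'n::finite) chart \<Rightarrow> bool" where
  "is_chart c \<longleftrightarrow> open (fst c) \<and> open (chart_image c) \<and>
     homeomorphism (fst c) (chart_image c) (snd c) (chart_inv c)"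

definition transition ::
    "('a, 'n) chart \<Rightarrow> ('a, 'n) chart \<Rightarrow> real ^ 'n \<Rightarrow> real ^ 'n" where
  "transition c d = (\<lambda>y. snd d (chart_inv c y))"

definition smooth_atlas :: "('a::topological_space, 'n::finite) chart set \<Rightarrow> bool" where
  "smooth_atlas \<A> \<longleftrightarrow>
     (\<forall>c\<in>\<A>. is_chart c) \<and> (\<Union>c\<in>\<A>. fst c) = UNIV \<and>
     (\<forall>c\<in>\<A>. \<forall>d\<in>\<A>. smooth_on (snd c ` (fst c \<inter> fst d)) (transition c d))"

definition closed_smooth_manifold :: "('a::t2_space, 'n::finite) chart set \<Rightarrow> bool" where
  "closed_smooth_manifold \<A> \<longleftrightarrow> compact (UNIV :: 'a set) \<and> smooth_atlas \<A>"

text \<open>The coordinate expression of a function on the manifold.\<close>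

definition in_chart :: "('a, 'n) chart \<Rightarrow> ('a \<Rightarrow> real) \<Rightarrow> real ^ 'n \<Rightarrow> real" where
  "in_chart c f = (\<lambda>y. f (chart_inv c y))"

definition smooth_function :: "('a, 'n::finite) chart set \<Rightarrow> ('a \<Rightarrow> real) \<Rightarrow> bool" where
  "smooth_function \<A> f \<longleftrightarrow> (\<forall>c\<in>\<A>. smooth_on (chart_image c) (in_chart c f))"

section \<open>Riemannian metrics\<close>

text \<open>A metric is given by its coefficient matrices \<open>g c y\<close> \<open>= (g\<^sub>i\<^sub>j)\<close> in each chart \<open>c\<close> at the
  coordinate point \<open>y\<close>.  The last condition is the transformation law of a covariant 2-tensor.\<close>

type_synonym ('a, 'n) metric = "('a, 'n) chart \<Rightarrow> real ^ 'n \<Rightarrow> real ^ 'n ^ 'n"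

definition riemannian_metric :: "('a, 'n::finite) chart set \<Rightarrow> ('a, 'n) metric \<Rightarrow> bool" where
  "riemannian_metric \<A> g \<longleftrightarrow>
     (\<forall>c\<in>\<A>. smooth_on (chart_image c) (g c) \<and>
        (\<forall>y\<in>chart_image c. transpose (g c y) = g c y \<and> (\<forall>v. v \<noteq> 0 \<longrightarrow> v \<bullet> (g c y *v v) > 0))) \<and>
     (\<forall>c\<in>\<A>. \<forall>d\<in>\<A>. \<forall>y\<in>snd c ` (fst c \<inter> fst d). \<forall>v w.
        v \<bullet> (g c y *v w) =
          frechet_derivative (transition c d) (at y) v \<bullet>
            (g d (transition c d y) *v frechet_derivative (transition c d) (at y) w))"

definition closed_riemannian_manifold ::
    "('a::t2_space, 'n::finite) chart set \<Rightarrow> ('a, 'n) metric \<Rightarrow> bool" where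
  "closed_riemannian_manifold \<A> g \<longleftrightarrow> closed_smooth_manifold \<A> \<and> riemannian_metric \<A> g"

text \<open>The Riemannian volume measure is the unique Borel measure which in each chart has density
  \<open>sqrt (det g\<^sub>i\<^sub>j)\<close> with respect to Lebesgue measure.\<close>

definition is_riemannian_volume ::
    "('a::topological_space, 'n::finite) chart set \<Rightarrow> ('a, 'n) metric \<Rightarrow> 'a measure \<Rightarrow> bool" where
  "is_riemannian_volume \<A> g vol \<longleftrightarrow>
     sets vol = sets borel \<and>
     (\<forall>c\<in>\<A>. \<forall>S\<in>sets borel. S \<subseteq> fst c \<longrightarrow>
        emeasure vol S =
          (\<integral>\<^sup>+ y. ennreal (sqrt (det (g c y))) * indicator (snd c ` S) y \<partial>lborel))"

subsection \<open>Gradient norm and Laplace-Beltrami operator in coordinates\<close>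

text \<open>Below \<open>G\<close> and \<open>F\<close> are the coordinate expressions of a metric and of a function on an open
  subset of \<open>\<real>\<^sup>n\<close>.\<close>

definition partial :: "'n \<Rightarrow> (real ^ 'n::finite \<Rightarrow> real) \<Rightarrow> real ^ 'n \<Rightarrow> real" where
  "partial i F y = frechet_derivative F (at y) (axis i 1)"

text \<open>\<open>christoffel G k i j\<close> is \<open>\<Gamma>\<^sup>k\<^sub>i\<^sub>j\<close> of the Levi-Civita connection.\<close>

definition christoffel ::
    "(real ^ 'n::finite \<Rightarrow> real ^ 'n ^ 'n) \<Rightarrow> 'n \<Rightarrow> 'n \<Rightarrow> 'n \<Rightarrow> real ^ 'n \<Rightarrow> real" where
  "christoffel G k i j y =
     (1/2) * (\<Sum>l\<in>UNIV. matrix_inv (G y) $ k $ l *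
        (partial i (\<lambda>z. G z $ j $ l) y + partial j (\<lambda>z. G z $ i $ l) y
          - partial l (\<lambda>z. G z $ i $ j) y))"

text \<open>The second covariant derivative \<open>\<nabla>\<^sub>i\<nabla>\<^sub>j F\<close>.\<close>

definition covariant_hessian ::
    "(real ^ 'n::finite \<Rightarrow> real ^ 'n ^ 'n) \<Rightarrow> (real ^ 'n \<Rightarrow> real) \<Rightarrow> 'n \<Rightarrow> 'n \<Rightarrow> real ^ 'n \<Rightarrow> real" where
  "covariant_hessian G F i j y =
     partial i (partial j F) y - (\<Sum>k\<in>UNIV. christoffel G k i j y * partial k F y)"

definition coord_laplacian ::
    "(real ^ 'n::finite \<Rightarrow> real ^ 'n ^ 'n) \<Rightarrow> (real ^ 'n \<Rightarrow> real) \<Rightarrow> real ^ 'n \<Rightarrow> real" where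
  "coord_laplacian G F y =
     (\<Sum>i\<in>UNIV. \<Sum>j\<in>UNIV. matrix_inv (G y) $ i $ j * covariant_hessian G F i j y)"

definition coord_grad_norm_sq ::
    "(real ^ 'n::finite \<Rightarrow> real ^ 'n ^ 'n) \<Rightarrow> (real ^ 'n \<Rightarrow> real) \<Rightarrow> real ^ 'n \<Rightarrow> real" where
  "coord_grad_norm_sq G F y =
     (\<Sum>i\<in>UNIV. \<Sum>j\<in>UNIV. matrix_inv (G y) $ i $ j * partial i F y * partial j F y)"

subsection \<open>Gradient norm and Laplace-Beltrami operator on the manifold\<close>

text \<open>The coordinate expressions transform as scalars, so the chart in which they are evaluated
  can be chosen arbitrarily.\<close>

definition chart_at :: "('a, 'n) chart set \<Rightarrow> 'a \<Rightarrow> ('a, 'n) chart" where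
  "chart_at \<A> x = (SOME c. c \<in> \<A> \<and> x \<in> fst c)"

definition laplacian ::
    "('a, 'n::finite) chart set \<Rightarrow> ('a, 'n) metric \<Rightarrow> ('a \<Rightarrow> real) \<Rightarrow> 'a \<Rightarrow> real" where
  "laplacian \<A> g f x =
     (let c = chart_at \<A> x in coord_laplacian (g c) (in_chart c f) (snd c x))"

definition grad_norm_sq ::
    "('a, 'n::finite) chart set \<Rightarrow> ('a, 'n) metric \<Rightarrow> ('a \<Rightarrow> real) \<Rightarrow> 'a \<Rightarrow> real" where
  "grad_norm_sq \<A> g f x =
     (let c = chart_at \<A> x in coord_grad_norm_sq (g c) (in_chart c f) (snd c x))"

definition L2_norm :: "'a measure \<Rightarrow> ('a \<Rightarrow> real) \<Rightarrow> real" where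
  "L2_norm vol f = sqrt (\<integral>x. \<bar>f x\<bar>\<^sup>2 \<partial>vol)"

section \<open>Waves on warped product spacetimes of type \<open>-1\<close>\<close>

text \<open>The scale factor \<open>a\<close> determines the spacetime metric \<open>- dt\<^sup>2 + a(t)\<^sup>2 g\<close> on
  \<open>(0,\<infinity>) \<times> M\<close>; its values at negative times are irrelevant.\<close>

definition scale_factor_type_m1 :: "real \<Rightarrow> real \<Rightarrow> (real \<Rightarrow> real) \<Rightarrow> bool" where
  "scale_factor_type_m1 \<gamma> B a \<longleftrightarrow>
     continuous_on {0..} a \<and> smooth_on {0<..} a \<and> (\<forall>t>0. a t > 0) \<and> a 0 = 0 \<and>
     (\<forall>t>0. (a has_real_derivative sqrt (8 * pi * B / 3 * a t powr (2 - 3 * \<gamma>) + 1)) (at t))"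

text \<open>A function on spacetime is a map \<open>\<psi> t x\<close>; its values at times \<open>t \<le> 0\<close> are irrelevant.\<close>

definition smooth_on_spacetime ::
    "('a, 'n::finite) chart set \<Rightarrow> (real \<Rightarrow> 'a \<Rightarrow> real) \<Rightarrow> bool" where
  "smooth_on_spacetime \<A> \<psi> \<longleftrightarrow>
     (\<forall>c\<in>\<A>. smooth_on ({0<..} \<times> chart_image c) (\<lambda>(t, y). \<psi> t (chart_inv c y)))"

definition time_deriv :: "(real \<Rightarrow> 'a \<Rightarrow> real) \<Rightarrow> real \<Rightarrow> 'a \<Rightarrow> real" where
  "time_deriv \<psi> t x = deriv (\<lambda>s. \<psi> s x) t"

definition smooth_wave ::
    "('a, 3) chart set \<Rightarrow> ('a, 3) metric \<Rightarrow> (real \<Rightarrow> real) \<Rightarrow> (real \<Rightarrow> 'a \<Rightarrow> real) \<Rightarrow> bool" where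
  "smooth_wave \<A> g a \<psi> \<longleftrightarrow>
     smooth_on_spacetime \<A> \<psi> \<and>
     (\<forall>t>0. \<forall>x. - time_deriv (time_deriv \<psi>) t x + (1 / (a t)\<^sup>2) * laplacian \<A> g (\<psi> t) x
        - 3 * (deriv a t / a t) * time_deriv \<psi> t x = 0)"

definition leading_coefficient ::
    "('a, 3) chart set \<Rightarrow> (real \<Rightarrow> real) \<Rightarrow> (real \<Rightarrow> 'a \<Rightarrow> real) \<Rightarrow> ('a \<Rightarrow> real) \<Rightarrow> bool" where
  "leading_coefficient \<A> a \<psi> A \<longleftrightarrow>
     smooth_function \<A> A \<and>
     uniform_limit UNIV (\<lambda>t x. \<psi> t x / integral {t..} (\<lambda>s. 1 / a s ^ 3)) A (at_right 0)"

end

theory Submission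
  imports Defs
begin

text \<open>Write \<open>\<parallel>\<cdot>\<parallel>\<close> for the norm of \<open>L\<^sup>2(M)\<close>. By Green's identity
  \<open>E = a\<^sup>6 \<parallel>\<partial>\<^sub>t\<psi>\<parallel>\<^sup>2 + a\<^sup>4 \<parallel>\<nabla>\<psi>\<parallel>\<^sup>2\<close> has derivative \<open>4 a\<^sup>3 a' \<parallel>\<nabla>\<psi>\<parallel>\<^sup>2 \<ge> 0\<close>, so
  \<open>a\<^sup>2 \<parallel>\<nabla>\<psi>\<parallel> \<le> E(t\<^sub>0)\<^sup>1\<^sup>/\<^sup>2\<close> for \<open>t \<le> t\<^sub>0\<close>. Test the wave equation with \<open>h = \<partial>\<^sub>t\<psi>(t\<^sub>0)\<close>: the function
  \<open>f = a\<^sup>3 \<langle>\<partial>\<^sub>t\<psi>, h\<rangle>\<close> satisfies \<open>f' = - a \<langle>\<nabla>\<psi>, \<nabla>h\<rangle>\<close>, hence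
  \<open>\<bar>f'\<bar> \<le> a\<^sup>-\<^sup>1 E(t\<^sub>0)\<^sup>1\<^sup>/\<^sup>2 \<parallel>\<nabla>h\<parallel>\<close>, and \<open>a\<^sup>-\<^sup>1\<close> is integrable at \<open>0\<close> with
  \<open>\<integral>\<^sub>0\<^sup>t a\<^sup>-\<^sup>1 \<le> C t\<^sup>\<kappa>\<close> for \<open>\<kappa> = 1 - 2/(3\<gamma>)\<close>. If \<open>A = 0\<close> then \<open>f\<close> vanishes at \<open>0\<close>, so
  \<open>f(t\<^sub>0) = a\<^sup>3 \<parallel>h\<parallel>\<^sup>2 \<le> C t\<^sub>0\<^sup>\<kappa> E(t\<^sub>0)\<^sup>1\<^sup>/\<^sup>2 \<parallel>\<nabla>h\<parallel>\<close>. The second hypothesis gives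
  \<open>E(t\<^sub>0) \<le> 2 a\<^sup>6 \<parallel>h\<parallel>\<^sup>2\<close>, and \<open>\<parallel>\<nabla>h\<parallel>\<^sup>2 \<le> \<parallel>h\<parallel> \<parallel>\<Delta>h\<parallel>\<close>; together
  \<open>\<parallel>h\<parallel>\<^sup>2 \<le> 4 C\<^sup>4 t\<^sub>0\<^sup>2\<^sup>\<kappa> \<parallel>\<Delta>h\<parallel>\<^sup>2\<close>, which contradicts the first hypothesis.\<close>

section \<open>Calculus in coordinates\<close>

text \<open>Why \<open>A = 0\<close> forces \<open>f\<close> to vanish at \<open>0\<close>: the
  pairing of \<open>\<psi>\<close> with \<open>h\<close> has derivative \<open>f / a ^ 3\<close>,
  and its quotient by \<open>J t\<close>, the integral of \<open>a ^ (-3)\<close> over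
  \<open>{t..}\<close>, tends to \<open>0\<close> when \<open>A = 0\<close>. Since \<open>J\<close>
  is unbounded near \<open>0\<close>, an \<open>f\<close> above a positive constant there would push
  this quotient below a negative one. The divergence of \<open>J\<close> comes from
  \<open>\<gamma> < 2\<close>, which makes \<open>a ^ 3\<close> at most a multiple of
  \<open>t\<close>; the integrability of \<open>1 / a\<close> comes from
  \<open>\<gamma> > 2/3\<close>. Testing with the fixed function \<open>h\<close>, the time
  derivative at \<open>t0\<close>, makes \<open>f t0\<close> a multiple of the kinetic energy and
  puts all higher derivatives on \<open>h\<close>, so that before \<open>t0\<close> only the
  first-order energy has to be controlled. The main obstacle is Green's identity on M:
  \<open>laplacian\<close> and \<open>grad_norm_sq\<close> are evaluated in an arbitrarily chosen
  chart, so that identity has to be assembled from integration by parts in coordinates before either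
  energy or pairing can be differentiated.\<close>

lemma partial_eqI:
  assumes "(F has_derivative F') (at y)"
  shows "partial i F y = F' (axis i 1)"
  using frechet_derivative_at[OF assms] by (simp add: partial_def)

lemma partial_cong_open:
  assumes "open U" "y \<in> U" "\<And>z. z \<in> U \<Longrightarrow> F z = H z" "F differentiable (at y)"
  shows "partial i F y = partial i H y"
  using frechet_derivative_transform_within_open[OF assms(4,1,2,3)] by (simp add: partial_def)

lemma differentiable_cong_open:
  assumes "open U" "y \<in> U" "\<And>z. z \<in> U \<Longrightarrow> F z = H z" "F differentiable (at y)"
  shows "H differentiable (at y)"
  using assms unfolding differentiable_def by (metis has_derivative_transform_within_open)

lemma partial_const [simp]: "partial i (\<lambda>_. c) y = 0"
  by (simp add: partial_def)

lemma partial_add: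
  assumes "F differentiable (at y)" "H differentiable (at y)"
  shows "partial i (\<lambda>z. F z + H z) y = partial i F y + partial i H y"
  by (subst partial_eqI[OF has_derivative_add[OF assms[unfolded frechet_derivative_works]]])
     (simp add: partial_def)

lemma partial_mult:
  assumes "F differentiable (at y)" "H differentiable (at y)"
  shows "partial i (\<lambda>z. F z * H z) y = partial i F y * H y + F y * partial i H y"
  by (subst partial_eqI[OF has_derivative_mult[OF assms[unfolded frechet_derivative_works]]])
     (simp add: partial_def)

lemma partial_sum:
  assumes "\<And>k. k \<in> I \<Longrightarrow> F k differentiable (at y)"
  shows "partial i (\<lambda>z. \<Sum>k\<in>I. F k z) y = (\<Sum>k\<in>I. partial i (F k) y)"
  by (subst partial_eqI[OF has_derivative_sum[OF assms[unfolded frechet_derivative_works]]])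
     (simp_all add: partial_def)

lemma partial_prod:
  fixes F :: "'k \<Rightarrow> real ^ 'n::finite \<Rightarrow> real"
  assumes "\<And>k. k \<in> I \<Longrightarrow> F k differentiable (at y)"
  shows "partial i (\<lambda>z. \<Prod>k\<in>I. F k z) y = (\<Sum>k\<in>I. partial i (F k) y * (\<Prod>j\<in>I - {k}. F j y))"
  by (subst partial_eqI[OF has_derivative_prod[OF assms[unfolded frechet_derivative_works]]])
     (simp_all add: partial_def)

lemma has_derivative_real_compose:
  assumes "F differentiable (at y)" "(h has_real_derivative D) (at (F y))"
  shows "((\<lambda>z. h (F z)) has_derivative (\<lambda>v. D * frechet_derivative F (at y) v)) (at y)"
  using diff_chain_at[OF assms(1)[unfolded frechet_derivative_works]
      assms(2)[unfolded has_field_derivative_def]] by (simp add: o_def)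

lemma partial_real_compose:
  assumes "F differentiable (at y)" "(h has_real_derivative D) (at (F y))"
  shows "partial i (\<lambda>z. h (F z)) y = D * partial i F y"
  by (subst partial_eqI[OF has_derivative_real_compose[OF assms]]) (simp add: partial_def)

lemma frechet_derivative_partials:
  fixes F :: "real ^ 'n::finite \<Rightarrow> real"
  assumes "F differentiable (at y)"
  shows "frechet_derivative F (at y) v = (\<Sum>i\<in>UNIV. v $ i * partial i F y)"
proof -
  interpret linear "frechet_derivative F (at y)" using linear_frechet_derivative[OF assms] .
  have "frechet_derivative F (at y) v = frechet_derivative F (at y) (\<Sum>i\<in>UNIV. v $ i *\<^sub>R axis i 1)"
    using basis_expansion[of v] by (simp add: scalar_mult_eq_scaleR)
  then show ?thesis by (simp add: sum scale partial_def)
qed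

text \<open>One continuous derivative is all that integration by parts asks of the vector field, and
  so bump functions that are merely C^1 will do.\<close>

definition C1_on :: "(real ^ 'n::finite) set \<Rightarrow> (real ^ 'n \<Rightarrow> real) \<Rightarrow> bool" where
  "C1_on S F \<longleftrightarrow> (\<forall>y\<in>S. F differentiable (at y)) \<and> (\<forall>i. continuous_on S (partial i F))"

lemma C1_on_differentiable: "C1_on S F \<Longrightarrow> y \<in> S \<Longrightarrow> F differentiable (at y)"
  by (simp add: C1_on_def)

lemma C1_on_partial: "C1_on S F \<Longrightarrow> continuous_on S (partial i F)"
  by (simp add: C1_on_def)

lemma C1_on_continuous: "C1_on S F \<Longrightarrow> continuous_on S F"
  by (simp add: C1_on_differentiable continuous_at_imp_continuous_on differentiable_imp_continuous_within)

lemma C1_on_cong: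
  assumes "C1_on S F" "open S" "\<And>z. z \<in> S \<Longrightarrow> F z = H z"
  shows "C1_on S H"
  unfolding C1_on_def
proof (intro conjI ballI allI)
  show "H differentiable (at y)" if "y \<in> S" for y
    by (rule differentiable_cong_open[OF assms(2) that assms(3) C1_on_differentiable[OF assms(1) that]])
  show "continuous_on S (partial i H)" for i
    using C1_on_partial[OF assms(1), of i]
    by (rule continuous_on_eq)
       (metis partial_cong_open assms C1_on_differentiable)
qed

text \<open>Gluing over two open pieces is how functions vanishing off a compact set are extended by
  zero.\<close>

lemma C1_on_Un:
  assumes "C1_on S F" "C1_on T F" "open S" "open T"
  shows "C1_on (S \<union> T) F"
  using assms unfolding C1_on_def by (auto intro: continuous_on_open_Un)

lemma C1_on_const: "C1_on S (\<lambda>_. c)"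
  by (simp add: C1_on_def partial_def)

lemma C1_on_add:
  assumes "C1_on S F" "C1_on S H"
  shows "C1_on S (\<lambda>z. F z + H z)"
  using assms unfolding C1_on_def
  by (auto simp: partial_add intro!: differentiable_add cong: continuous_on_cong intro: continuous_on_add)

lemma C1_on_mult:
  assumes "C1_on S F" "C1_on S H"
  shows "C1_on S (\<lambda>z. F z * H z)"
  using assms C1_on_continuous[OF assms(1)] C1_on_continuous[OF assms(2)] unfolding C1_on_def
  by (auto simp: partial_mult intro!: differentiable_mult cong: continuous_on_cong
      intro!: continuous_on_add continuous_on_mult)

lemma C1_on_sum:
  assumes "finite I" "\<And>k. k \<in> I \<Longrightarrow> C1_on S (F k)"
  shows "C1_on S (\<lambda>z. \<Sum>k\<in>I. F k z)"
  using assms by (induction I rule: finite_induct) (auto intro: C1_on_add C1_on_const)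

lemma C1_on_prod:
  assumes "finite I" "\<And>k. k \<in> I \<Longrightarrow> C1_on S (F k)"
  shows "C1_on S (\<lambda>z. \<Prod>k\<in>I. F k z)"
  using assms by (induction I rule: finite_induct) (auto intro: C1_on_mult C1_on_const)

lemma C1_on_real_compose:
  assumes "C1_on S F" "\<And>y. y \<in> S \<Longrightarrow> (h has_real_derivative h' (F y)) (at (F y))"
    and "continuous_on (F ` S) h'"
  shows "C1_on S (\<lambda>z. h (F z))"
  unfolding C1_on_def
proof (intro conjI ballI allI)
  show "(\<lambda>z. h (F z)) differentiable (at y)" if "y \<in> S" for y
    using has_derivative_real_compose[OF C1_on_differentiable[OF assms(1) that] assms(2)[OF that]]
    unfolding differentiable_def by blast
  have "continuous_on S (\<lambda>y. h' (F y) * partial i F y)" for i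
    using C1_on_partial[OF assms(1)] continuous_on_compose[OF C1_on_continuous[OF assms(1)] assms(3)]
    by (auto intro!: continuous_on_mult simp: o_def)
  then show "continuous_on S (partial i (\<lambda>z. h (F z)))" for i
    by (rule continuous_on_eq)
       (use partial_real_compose[OF C1_on_differentiable[OF assms(1)] assms(2)] in auto)
qed

lemma C1_on_inverse:
  assumes "C1_on S F" "\<And>y. y \<in> S \<Longrightarrow> F y \<noteq> 0"
  shows "C1_on S (\<lambda>z. inverse (F z))"
proof (rule C1_on_real_compose[OF assms(1), where h' = "\<lambda>x. - (inverse x ^ 2)"])
  show "(inverse has_real_derivative - (inverse (F y))\<^sup>2) (at (F y))" if "y \<in> S" for y
    using DERIV_inverse[of "F y"] assms(2)[OF that] by (simp add: numeral_2_eq_2)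
  show "continuous_on (F ` S) (\<lambda>x. - (inverse x)\<^sup>2)"
    using assms(2) by (auto intro!: continuous_intros)
qed

lemma C1_on_sqrt:
  assumes "C1_on S F" "\<And>y. y \<in> S \<Longrightarrow> F y > 0"
  shows "C1_on S (\<lambda>z. sqrt (F z))"
proof (rule C1_on_real_compose[OF assms(1), where h' = "\<lambda>x. inverse (sqrt x) / 2"])
  show "(sqrt has_real_derivative inverse (sqrt (F y)) / 2) (at (F y))" if "y \<in> S" for y
    using DERIV_real_sqrt[OF assms(2)[OF that]] .
  show "continuous_on (F ` S) (\<lambda>x. inverse (sqrt x) / 2)"
    using assms(2) by (force intro!: continuous_intros)
qed

section \<open>Determinants and inverses of matrix-valued functions\<close>

lemma C1_on_det:
  fixes G :: "real ^ 'm::finite \<Rightarrow> real ^ 'n ^ 'n::finite"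
  assumes "\<And>i j. C1_on S (\<lambda>z. G z $ i $ j)"
  shows "C1_on S (\<lambda>z. det (G z))"
  unfolding det_def
  by (intro C1_on_sum C1_on_mult C1_on_const C1_on_prod assms) (auto simp: finite_permutations)

lemma matrix_mult_entry:
  fixes A :: "real ^ 'n ^ 'm" and B :: "real ^ 'k ^ 'n::finite"
  shows "(A ** B) $ i $ j = (\<Sum>k\<in>UNIV. A $ i $ k * B $ k $ j)"
  by (simp add: matrix_matrix_mult_def)

lemma matrix_inv_inverse:
  fixes A :: "real ^ 'n ^ 'n::finite"
  assumes "det A \<noteq> 0"
  shows "A ** matrix_inv A = mat 1" "matrix_inv A ** A = mat 1"
proof -
  have "\<exists>B. A ** B = mat 1 \<and> B ** A = mat 1"
    using assms unfolding invertible_det_nz[symmetric] invertible_def .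
  then have "A ** matrix_inv A = mat 1 \<and> matrix_inv A ** A = mat 1"
    unfolding matrix_inv_def by (rule someI_ex)
  then show "A ** matrix_inv A = mat 1" "matrix_inv A ** A = mat 1" by auto
qed

text \<open>Cramer's rule with the \<open>l\<close>-th unit vector as right-hand side. Regularity of
  the inverse matrix thereby reduces to that of determinants.\<close>

lemma matrix_inv_entry:
  fixes A :: "real ^ 'n ^ 'n::finite"
  assumes "det A \<noteq> 0"
  shows "matrix_inv A $ k $ l = det (\<chi> i j. if j = k then axis l 1 $ i else A $ i $ j) * inverse (det A)"
proof -
  let ?x = "matrix_inv A *v axis l 1"
  have "A *v ?x = axis l 1"
    by (simp add: matrix_vector_mul_assoc matrix_inv_inverse[OF assms])
  then have "?x = (\<chi> k. det (\<chi> i j. if j = k then axis l 1 $ i else A $ i $ j) / det A)"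
    using cramer[OF assms, of ?x "axis l 1"] by blast
  from arg_cong[OF this, of "\<lambda>v. v $ k"]
  have "?x $ k = det (\<chi> i j. if j = k then axis l 1 $ i else A $ i $ j) / det A"
    by (simp only: vec_lambda_beta)
  moreover have "?x $ k = matrix_inv A $ k $ l"
    by (simp add: matrix_vector_mult_basis column_def)
  ultimately show ?thesis by (simp add: divide_inverse)
qed

lemma C1_on_matrix_inv:
  fixes G :: "real ^ 'm::finite \<Rightarrow> real ^ 'n ^ 'n::finite"
  assumes "\<And>i j. C1_on S (\<lambda>z. G z $ i $ j)" "open S" "\<And>y. y \<in> S \<Longrightarrow> det (G y) \<noteq> 0"
  shows "C1_on S (\<lambda>z. matrix_inv (G z) $ k $ l)"
proof -
  have "C1_on S (\<lambda>z. (\<chi> i j. if j = k then axis l 1 $ i else G z $ i $ j) $ i $ j)" for i j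
    using assms(1)[of i j] by (cases "j = k") (auto intro: C1_on_const)
  then have "C1_on S (\<lambda>z. det (\<chi> i j. if j = k then axis l 1 $ i else G z $ i $ j) * inverse (det (G z)))"
    using assms by (intro C1_on_mult C1_on_inverse C1_on_det) auto
  then show ?thesis
    by (rule C1_on_cong) (use assms in \<open>auto simp: matrix_inv_entry\<close>)
qed

text \<open>Jacobi's formula. The product rule in the Leibniz expansion gives a sum of determinants
  \<open>det (R i)\<close>, where row \<open>i\<close> is replaced by its derivative. Expanding that
  row in the rows of \<open>G y\<close> leaves only the coefficient of row \<open>i\<close> itself,
  a diagonal entry of \<open>H ** ?B\<close>.\<close>

lemma partial_det:
  fixes G :: "real ^ 'm::finite \<Rightarrow> real ^ 'n ^ 'n::finite"
  assumes diff: "\<And>i j. (\<lambda>z. G z $ i $ j) differentiable (at y)" and nz: "det (G y) \<noteq> 0"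
  shows "partial k (\<lambda>z. det (G z)) y =
    det (G y) * (\<Sum>i\<in>UNIV. \<Sum>j\<in>UNIV. partial k (\<lambda>z. G z $ i $ j) y * matrix_inv (G y) $ j $ i)"
proof -
  let ?A = "G y" and ?B = "matrix_inv (G y)"
  define H where "H = (\<chi> i j. partial k (\<lambda>z. G z $ i $ j) y)"
  define R where "R i = (\<chi> r. if r = i then H $ i else row r ?A)" for i
  have dp: "(\<lambda>z. \<Prod>i\<in>UNIV. G z $ i $ p i) differentiable (at y)" for p
    by (rule differentiableI, rule has_derivative_prod, rule diff[unfolded frechet_derivative_works])
  have "partial k (\<lambda>z. det (G z)) y =
      (\<Sum>p | p permutes UNIV. of_int (sign p) * (\<Sum>i\<in>UNIV. H $ i $ p i * (\<Prod>j\<in>UNIV - {i}. ?A $ j $ p j)))"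
    unfolding det_def
    by (subst partial_sum)
       (auto simp: partial_mult dp partial_prod diff H_def intro!: differentiable_mult)
  also have "\<dots> = (\<Sum>p | p permutes UNIV. \<Sum>i\<in>UNIV. of_int (sign p) * (\<Prod>j\<in>UNIV. R i $ j $ p j))"
  proof -
    have "H $ i $ p i * (\<Prod>j\<in>UNIV - {i}. ?A $ j $ p j) = (\<Prod>j\<in>UNIV. R i $ j $ p j)" for i p
      by (subst (2) prod.remove[of _ i]) (auto simp: R_def row_def intro!: prod.cong)
    then show ?thesis by (simp add: sum_distrib_left)
  qed
  also have "\<dots> = (\<Sum>i\<in>UNIV. det (R i))"
    unfolding det_def by (rule sum.swap)
  also have "\<dots> = (\<Sum>i\<in>UNIV. (H ** ?B) $ i $ i * det ?A)"
  proof (rule sum.cong)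
    fix i
    have "H = (H ** ?B) ** ?A"
      by (simp add: matrix_mul_assoc[symmetric] matrix_inv_inverse[OF nz])
    then have "H $ i = (\<Sum>j\<in>UNIV. (H ** ?B) $ i $ j *s row j ?A)"
      unfolding vec_eq_iff by (simp add: matrix_matrix_mult_def[of "H ** ?B" ?A] row_def sum_component)
    then have "R i = (\<chi> r. if r = i then \<Sum>j\<in>UNIV. (H ** ?B) $ i $ j *s row j ?A else row r ?A)"
      by (simp only: R_def)
    then show "det (R i) = (H ** ?B) $ i $ i * det ?A"
      by (simp only: cramer_lemma_transpose)
  qed auto
  also have "\<dots> = det ?A * (\<Sum>i\<in>UNIV. \<Sum>j\<in>UNIV. H $ i $ j * ?B $ j $ i)"
    unfolding sum_distrib_right[symmetric] by (simp add: matrix_matrix_mult_def mult.commute)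
  finally show ?thesis by (simp add: H_def)
qed

text \<open>Differentiate the identity inverse times \<open>G\<close> equals \<open>mat 1\<close>
  entrywise, then multiply by the inverse from the right.\<close>

lemma partial_matrix_inv:
  fixes G :: "real ^ 'm::finite \<Rightarrow> real ^ 'n ^ 'n::finite"
  assumes G: "\<And>i j. C1_on S (\<lambda>z. G z $ i $ j)" and S: "open S" "y \<in> S"
    and nz: "\<And>y. y \<in> S \<Longrightarrow> det (G y) \<noteq> 0"
  shows "partial k (\<lambda>z. matrix_inv (G z) $ i $ m) y =
    - (\<Sum>j\<in>UNIV. \<Sum>l\<in>UNIV. matrix_inv (G y) $ i $ l * partial k (\<lambda>z. G z $ l $ j) y * matrix_inv (G y) $ j $ m)"
proof -
  let ?B = "\<lambda>z. matrix_inv (G z)"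
  define D where "D l = partial k (\<lambda>z. ?B z $ i $ l) y" for l
  note dG = C1_on_differentiable[OF G S(2)]
  note dB = C1_on_differentiable[OF C1_on_matrix_inv[OF G S(1) nz] S(2)]
  have eq: "(\<Sum>l\<in>UNIV. D l * G y $ l $ j) = - (\<Sum>l\<in>UNIV. ?B y $ i $ l * partial k (\<lambda>z. G z $ l $ j) y)" for j
  proof -
    have "(\<Sum>l\<in>UNIV. ?B z $ i $ l * G z $ l $ j) = mat 1 $ i $ j" if "z \<in> S" for z
      by (simp only: matrix_mult_entry[symmetric] matrix_inv_inverse(2)[OF nz[OF that]])
    then have "partial k (\<lambda>z. \<Sum>l\<in>UNIV. ?B z $ i $ l * G z $ l $ j) y = partial k (\<lambda>z. mat 1 $ i $ j) y"
      using S by (intro partial_cong_open[of S]) (auto intro!: differentiable_sum differentiable_mult dG dB)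
    then show ?thesis
      by (subst (asm) partial_sum)
         (auto simp: partial_mult dG dB D_def sum.distrib intro!: differentiable_mult)
  qed
  have "D m = (\<Sum>l\<in>UNIV. D l * (mat 1 $ l $ m :: real))"
    by (simp add: mat_def if_distrib cong: if_cong)
  also have "\<dots> = (\<Sum>l\<in>UNIV. D l * (\<Sum>j\<in>UNIV. G y $ l $ j * ?B y $ j $ m))"
    by (simp only: matrix_mult_entry[symmetric] matrix_inv_inverse(1)[OF nz[OF S(2)]])
  also have "\<dots> = (\<Sum>j\<in>UNIV. (\<Sum>l\<in>UNIV. D l * G y $ l $ j) * ?B y $ j $ m)"
    by (simp add: sum_distrib_left sum_distrib_right mult.assoc) (rule sum.swap)
  also have "\<dots> = - (\<Sum>j\<in>UNIV. \<Sum>l\<in>UNIV. ?B y $ i $ l * partial k (\<lambda>z. G z $ l $ j) y * ?B y $ j $ m)"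
    by (simp add: eq sum_distrib_right sum_negf)
  finally show ?thesis by (simp add: D_def)
qed

lemma matrix_inv_symmetric:
  fixes A :: "real ^ 'n ^ 'n::finite"
  assumes "det A \<noteq> 0" "transpose A = A"
  shows "transpose (matrix_inv A) = matrix_inv A"
proof -
  have "transpose (matrix_inv A) = transpose (matrix_inv A) ** (A ** matrix_inv A)"
    by (simp add: matrix_inv_inverse[OF assms(1)])
  also have "\<dots> = transpose (A ** matrix_inv A) ** matrix_inv A"
    by (simp add: matrix_transpose_mul assms(2) matrix_mul_assoc)
  finally show ?thesis by (simp add: matrix_inv_inverse[OF assms(1)] transpose_mat)
qed

section \<open>Positive definite matrices\<close>

definition pos_def :: "real ^ 'n ^ 'n::finite \<Rightarrow> bool" where
  "pos_def A \<longleftrightarrow> transpose A = A \<and> (\<forall>v. v \<noteq> 0 \<longrightarrow> v \<bullet> (A *v v) > 0)"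

text \<open>The segment from the identity to \<open>A\<close> consists of positive definite, hence
  invertible, matrices, so the determinant cannot change sign along it.\<close>

lemma pos_def_det_pos:
  fixes A :: "real ^ 'n ^ 'n::finite"
  assumes "pos_def A"
  shows "det A > 0"
proof (rule ccontr)
  define P where "P s = (1 - s) *\<^sub>R (mat 1 :: real ^ 'n ^ 'n) + s *\<^sub>R A" for s :: real
  have nz: "det (P s) \<noteq> 0" if "0 \<le> s" "s \<le> 1" for s
  proof -
    have "v = 0" if "P s *v v = 0" for v
    proof (rule ccontr)
      assume "v \<noteq> 0"
      then have "v \<bullet> v > 0" "v \<bullet> (A *v v) > 0" using assms by (auto simp: pos_def_def)
      moreover have "v \<bullet> (P s *v v) = (1 - s) * (v \<bullet> v) + s * (v \<bullet> (A *v v))"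
        by (simp add: P_def matrix_vector_mult_add_rdistrib inner_add_right scaleR_matrix_vector_assoc[symmetric])
      ultimately show False using \<open>0 \<le> s\<close> \<open>s \<le> 1\<close> that
        by (cases "s = 0") (auto simp: add_nonneg_eq_0_iff)
    qed
    then show ?thesis
      by (metis invertible_det_nz invertible_left_inverse matrix_left_invertible_ker)
  qed
  assume "\<not> det A > 0"
  then have "det (P 1) \<le> 0" "det (P 0) \<ge> 0" by (auto simp: P_def)
  moreover have "continuous_on {0..1} (\<lambda>s. det (P s))"
    unfolding P_def det_def by (intro continuous_intros)
  ultimately obtain s where "0 \<le> s" "s \<le> 1" "det (P s) = 0"
    using IVT2'[of "\<lambda>s. det (P s)" 1 0 0] by auto
  then show False using nz by blast
qed

lemma pos_def_matrix_inv:
  fixes A :: "real ^ 'n ^ 'n::finite"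
  assumes "pos_def A"
  shows "pos_def (matrix_inv A)"
  unfolding pos_def_def
proof (intro conjI allI impI)
  have nz: "det A \<noteq> 0" using pos_def_det_pos[OF assms] by simp
  show "transpose (matrix_inv A) = matrix_inv A"
    using matrix_inv_symmetric[OF nz] assms by (simp add: pos_def_def)
  fix v :: "real ^ 'n" assume "v \<noteq> 0"
  define w where "w = matrix_inv A *v v"
  have v: "v = A *v w" by (simp add: w_def matrix_vector_mul_assoc matrix_inv_inverse[OF nz])
  with \<open>v \<noteq> 0\<close> have "w \<noteq> 0" by auto
  then have "w \<bullet> (A *v w) > 0" using assms by (simp add: pos_def_def)
  then show "v \<bullet> (matrix_inv A *v v) > 0"
    by (simp add: w_def[symmetric] v[symmetric] inner_commute)
qed

lemma symmetric_matrix_inv_entry: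
  assumes "pos_def A"
  shows "matrix_inv A $ i $ j = matrix_inv A $ j $ i"
proof -
  have "transpose (matrix_inv A) $ i $ j = matrix_inv A $ i $ j"
    using pos_def_matrix_inv[OF assms] by (simp only: pos_def_def)
  then show ?thesis by (simp add: transpose_def)
qed

text \<open>Coordinate form of \<open>div (w \<nabla>F) = w \<Delta>F + \<langle>\<nabla>w, \<nabla>F\<rangle>\<close>.\<close>

lemma divergence_identity:
  fixes G :: "real ^ 'n::finite \<Rightarrow> real ^ 'n ^ 'n"
  assumes G: "\<And>i j. C1_on S (\<lambda>z. G z $ i $ j)" and S: "open S" "y \<in> S"
    and pd: "\<And>y. y \<in> S \<Longrightarrow> pos_def (G y)"
    and F: "\<And>i. C1_on S (partial i F)" and w: "C1_on S w"
  shows "(\<Sum>i\<in>UNIV. partial i (\<lambda>z. w z * (\<Sum>j\<in>UNIV. sqrt (det (G z)) * matrix_inv (G z) $ i $ j * partial j F z)) y)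
    = sqrt (det (G y)) * (w y * coord_laplacian G F y
       + (\<Sum>i\<in>UNIV. \<Sum>j\<in>UNIV. matrix_inv (G y) $ i $ j * partial i w y * partial j F y))"
proof -
  have dpos: "\<And>y. y \<in> S \<Longrightarrow> det (G y) > 0" using pd pos_def_det_pos by blast
  then have nz: "\<And>y. y \<in> S \<Longrightarrow> det (G y) \<noteq> 0" by force
  let ?B = "\<lambda>z. matrix_inv (G z)" and ?s = "\<lambda>z. sqrt (det (G z))"
  let ?D = "\<lambda>i k l. partial i (\<lambda>z. G z $ k $ l) y"
  have Bsym: "?B y $ i $ j = ?B y $ j $ i" for i j
    by (rule symmetric_matrix_inv_entry[OF pd[OF S(2)]])
  note dG = C1_on_differentiable[OF G S(2)]
  note dB = C1_on_differentiable[OF C1_on_matrix_inv[OF G S(1) nz] S(2)]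
  note dF = C1_on_differentiable[OF F S(2)]
  note dw = C1_on_differentiable[OF w S(2)]
  note dd = C1_on_differentiable[OF C1_on_det[OF G] S(2)]
  note ds = C1_on_differentiable[OF C1_on_sqrt[OF C1_on_det[OF G] dpos] S(2)]
  \<comment> \<open>Jacobi's formula, combined with
    \<open>det / sqrt det = sqrt det\<close>.\<close>
  have ps: "partial i ?s y = ?s y * ((\<Sum>k\<in>UNIV. \<Sum>l\<in>UNIV. ?D i k l * ?B y $ l $ k) / 2)" for i
  proof -
    have "partial i ?s y = inverse (?s y) / 2 * partial i (\<lambda>z. det (G z)) y"
      using partial_real_compose[OF dd DERIV_real_sqrt[OF dpos[OF S(2)]]] .
    moreover have "inverse (?s y) * det (G y) = ?s y"
      using dpos[OF S(2)] by (simp add: real_div_sqrt divide_inverse[symmetric] mult.commute)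
    ultimately show ?thesis
      by (simp add: partial_det[OF dG nz[OF S(2)]])
  qed
  \<comment> \<open>\<open>K i\<close> is the \<open>i\<close>-th derivative of
    \<open>ln (det G)\<close>, and \<open>- M i j\<close> is the \<open>i\<close>-th derivative of
    the entry \<open>i\<close>, \<open>j\<close> of the inverse metric.\<close>
  define K where "K i = (\<Sum>k\<in>UNIV. \<Sum>l\<in>UNIV. ?D i k l * ?B y $ l $ k)" for i
  define M where "M i j = (\<Sum>l\<in>UNIV. \<Sum>k\<in>UNIV. ?B y $ i $ k * ?D i k l * ?B y $ l $ j)" for i j
  have term1: "partial i (\<lambda>z. w z * (\<Sum>j\<in>UNIV. ?s z * ?B z $ i $ j * partial j F z)) y =
     ?s y * (\<Sum>j\<in>UNIV. ?B y $ i $ j * partial i w y * partial j F y) +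
     ?s y * w y * (\<Sum>j\<in>UNIV. ?B y $ i $ j * partial i (partial j F) y) +
     ?s y * w y * (\<Sum>j\<in>UNIV. (K i / 2 * ?B y $ i $ j - M i j) * partial j F y)" for i
    apply (subst partial_mult)
      apply (auto intro!: differentiable_sum differentiable_mult dB dF dw ds)[2]
    apply (subst partial_sum)
     apply (auto intro!: differentiable_mult dB dF dw ds)[1]
    apply (simp add: partial_mult differentiable_mult dB dF ds ps partial_matrix_inv[OF G S nz]
        flip: K_def M_def)
    apply (simp add: sum_distrib_left sum.distrib[symmetric])
    apply (rule sum.cong[OF refl])
    apply (simp add: algebra_simps)
    done
  \<comment> \<open>The contracted Christoffel identity. It turns the derivatives falling on
    \<open>sqrt (det G)\<close> and on the inverse metric into the first-order terms of
    \<open>coord_laplacian\<close>.\<close>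
  have chr: "(\<Sum>i\<in>UNIV. (K i / 2 * ?B y $ i $ j - M i j))
      = - (\<Sum>p\<in>UNIV. \<Sum>q\<in>UNIV. ?B y $ p $ q * christoffel G j p q y)" for j
  proof -
    \<comment> \<open>\<open>?T\<close> is the common value of the first two Christoffel terms,
      equal by symmetry of the inverse metric, and also the sum of the \<open>M i j\<close>.
      \<open>?U\<close> comes from the third term and from \<open>K\<close>.\<close>
    let ?T = "\<Sum>p\<in>UNIV. \<Sum>q\<in>UNIV. \<Sum>l\<in>UNIV. ?B y $ p $ q * ?B y $ j $ l * ?D p q l"
    let ?U = "\<Sum>p\<in>UNIV. \<Sum>q\<in>UNIV. \<Sum>l\<in>UNIV. ?B y $ p $ q * ?B y $ j $ l * ?D l p q"
    have T': "(\<Sum>p\<in>UNIV. \<Sum>q\<in>UNIV. \<Sum>l\<in>UNIV. ?B y $ p $ q * ?B y $ j $ l * ?D q p l) = ?T"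
      by (subst sum.swap) (simp add: Bsym)
    have T'': "(\<Sum>i\<in>UNIV. M i j) = ?T"
      unfolding M_def
      apply (rule sum.cong[OF refl])
      apply (subst sum.swap)
      apply (intro sum.cong refl)
      apply (simp add: Bsym[of _ j])
      done
    let ?t = "\<lambda>i k l. ?D i k l * ?B y $ l $ k * ?B y $ i $ j"
    have U': "(\<Sum>i\<in>UNIV. K i * ?B y $ i $ j) = ?U"
    proof -
      have "(\<Sum>i\<in>UNIV. K i * ?B y $ i $ j) = (\<Sum>i\<in>UNIV. \<Sum>k\<in>UNIV. \<Sum>l\<in>UNIV. ?t i k l)"
        unfolding K_def sum_distrib_right ..
      also have "\<dots> = (\<Sum>k\<in>UNIV. \<Sum>i\<in>UNIV. \<Sum>l\<in>UNIV. ?t i k l)"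
        by (rule sum.swap)
      also have "\<dots> = (\<Sum>k\<in>UNIV. \<Sum>l\<in>UNIV. \<Sum>i\<in>UNIV. ?t i k l)"
        by (intro sum.cong refl sum.swap)
      also have "\<dots> = ?U"
        apply (intro sum.cong refl)
        subgoal for p q l by (simp add: Bsym[of q p] Bsym[of l j])
        done
      finally show ?thesis .
    qed
    have "(\<Sum>p\<in>UNIV. \<Sum>q\<in>UNIV. ?B y $ p $ q * christoffel G j p q y) = (1/2) * (?T + ?T - ?U)"
      unfolding christoffel_def
      apply (subst (1) T'[symmetric])
      apply (simp add: sum_distrib_left sum.distrib[symmetric] sum_subtractf[symmetric] sum_divide_distrib)
      apply (intro sum.cong refl)
      apply (simp add: algebra_simps add_divide_distrib diff_divide_distrib)
      done
    moreover have "(\<Sum>i\<in>UNIV. (K i / 2 * ?B y $ i $ j - M i j)) = ?U / 2 - ?T"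
      unfolding sum_subtractf T'' U'[symmetric] by (simp add: sum_divide_distrib)
    ultimately show ?thesis by (simp add: field_simps)
  qed
  have "(\<Sum>i\<in>UNIV. \<Sum>j\<in>UNIV. (K i / 2 * ?B y $ i $ j - M i j) * partial j F y)
    = (\<Sum>j\<in>UNIV. - (\<Sum>p\<in>UNIV. \<Sum>q\<in>UNIV. ?B y $ p $ q * christoffel G j p q y) * partial j F y)"
    by (subst sum.swap) (simp only: sum_distrib_right[symmetric] chr)
  also have "\<dots> = - (\<Sum>j\<in>UNIV. \<Sum>p\<in>UNIV. \<Sum>q\<in>UNIV. ?B y $ p $ q * (christoffel G j p q y * partial j F y))"
    by (simp add: sum_distrib_right sum_negf mult.assoc)
  also have "\<dots> = - (\<Sum>p\<in>UNIV. \<Sum>j\<in>UNIV. \<Sum>q\<in>UNIV. ?B y $ p $ q * (christoffel G j p q y * partial j F y))"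
    by (intro arg_cong[where f=uminus] sum.swap)
  also have "\<dots> = - (\<Sum>p\<in>UNIV. \<Sum>q\<in>UNIV. \<Sum>j\<in>UNIV. ?B y $ p $ q * (christoffel G j p q y * partial j F y))"
    by (intro arg_cong[where f=uminus] sum.cong refl sum.swap)
  also have "\<dots> = - (\<Sum>p\<in>UNIV. \<Sum>q\<in>UNIV. ?B y $ p $ q * (\<Sum>j\<in>UNIV. christoffel G j p q y * partial j F y))"
    by (simp add: sum_distrib_left)
  finally have X: "(\<Sum>i\<in>UNIV. \<Sum>j\<in>UNIV. (K i / 2 * ?B y $ i $ j - M i j) * partial j F y)
     = - (\<Sum>p\<in>UNIV. \<Sum>q\<in>UNIV. ?B y $ p $ q * (\<Sum>j\<in>UNIV. christoffel G j p q y * partial j F y))" .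
  show ?thesis
    unfolding term1 sum.distrib sum_distrib_left[symmetric] X coord_laplacian_def covariant_hessian_def
    by (simp add: algebra_simps sum_subtractf)
qed

section \<open>Differentiation under the integral and integration by parts\<close>

text \<open>Dominated convergence along sequences, the mean value theorem bounding every difference
  quotient by \<open>b\<close>.\<close>

lemma has_real_derivative_integral:
  fixes f :: "real \<Rightarrow> 'a \<Rightarrow> real"
  assumes e: "e > 0"
    and int: "\<And>t. \<bar>t - t0\<bar> < e \<Longrightarrow> integrable M (f t)"
    and der: "\<And>t x. \<bar>t - t0\<bar> < e \<Longrightarrow> ((\<lambda>s. f s x) has_real_derivative f' t x) (at t)"
    and bound: "\<And>t x. \<bar>t - t0\<bar> < e \<Longrightarrow> \<bar>f' t x\<bar> \<le> b x" and b: "integrable M b"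
    and meas: "f' t0 \<in> borel_measurable M"
  shows "((\<lambda>t. \<integral>x. f t x \<partial>M) has_real_derivative (\<integral>x. f' t0 x \<partial>M)) (at t0)"
  unfolding DERIV_def tendsto_at_iff_sequentially o_def
proof (intro allI impI)
  fix X :: "nat \<Rightarrow> real" assume X: "\<forall>n. X n \<in> UNIV - {0}" "X \<longlonglongrightarrow> 0"
  \<comment> \<open>Increments of size at least \<open>e\<close> leave the range where
    \<open>f\<close> is controlled. Giving them the limit value preserves the bound \<open>b\<close>
    for every \<open>n\<close> and alters only finitely many terms.\<close>
  define s where "s n x = (if \<bar>X n\<bar> < e then (f (t0 + X n) x - f t0 x) / X n else f' t0 x)" for n x
  have ev: "\<forall>\<^sub>F n in sequentially. \<bar>X n\<bar> < e"
    using tendstoD[OF X(2) e] by (simp add: dist_real_def)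
  have "(\<lambda>n. \<integral>x. s n x \<partial>M) \<longlonglongrightarrow> (\<integral>x. f' t0 x \<partial>M)"
  proof (rule integral_dominated_convergence[where w=b])
    show "s n \<in> borel_measurable M" for n
      using int[of "t0 + X n"] int[of t0] e meas unfolding s_def
      by (cases "\<bar>X n\<bar> < e") auto
    show "AE x in M. (\<lambda>n. s n x) \<longlonglongrightarrow> f' t0 x"
    proof (rule AE_I2)
      fix x
      have "(\<lambda>n. (f (t0 + X n) x - f t0 x) / X n) \<longlonglongrightarrow> f' t0 x"
        using der[of t0 x] e X unfolding DERIV_def tendsto_at_iff_sequentially o_def by auto
      then show "(\<lambda>n. s n x) \<longlonglongrightarrow> f' t0 x"
        by (rule Lim_transform_eventually) (use ev in eventually_elim, auto simp: s_def)
    qed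
    show "AE x in M. norm (s n x) \<le> b x" for n
    proof (rule AE_I2)
      fix x
      show "norm (s n x) \<le> b x"
      proof (cases "\<bar>X n\<bar> < e")
        case True
        have "X n \<noteq> 0" using X by auto
        have "\<exists>z. \<bar>z - t0\<bar> < e \<and> f (t0 + X n) x - f t0 x = X n * f' z x"
        proof (cases "X n > 0")
          case True
          have "\<exists>z>t0. z < t0 + X n \<and> f (t0 + X n) x - f t0 x = (t0 + X n - t0) * f' z x"
            using True \<open>\<bar>X n\<bar> < e\<close> by (intro MVT2 der) auto
          then obtain z where "t0 < z" "z < t0 + X n" "f (t0 + X n) x - f t0 x = X n * f' z x"
            by auto
          then show ?thesis using \<open>\<bar>X n\<bar> < e\<close> by (intro exI[of _ z]) auto
        next
          case False
          have "\<exists>z>t0 + X n. z < t0 \<and> f t0 x - f (t0 + X n) x = (t0 - (t0 + X n)) * f' z x"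
            using False \<open>X n \<noteq> 0\<close> \<open>\<bar>X n\<bar> < e\<close> by (intro MVT2 der) auto
          then obtain z where "t0 + X n < z" "z < t0" "f t0 x - f (t0 + X n) x = - X n * f' z x"
            by auto
          then show ?thesis using \<open>\<bar>X n\<bar> < e\<close> by (intro exI[of _ z]) auto
        qed
        then show ?thesis using True \<open>X n \<noteq> 0\<close> bound by (auto simp: s_def abs_mult)
      next
        case False
        then show ?thesis using bound[of t0 x] e by (simp add: s_def)
      qed
    qed
  qed (use b meas in auto)
  then show "(\<lambda>n. ((\<integral>x. f (t0 + X n) x \<partial>M) - (\<integral>x. f t0 x \<partial>M)) / X n) \<longlonglongrightarrow> (\<integral>x. f' t0 x \<partial>M)"
    by (rule Lim_transform_eventually)
       (use ev in eventually_elim, use int[of "t0 + _"] int[of t0] e in \<open>simp add: s_def\<close>)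
qed

lemma has_derivative_along_line:
  assumes "f differentiable (at (x + s *\<^sub>R u))"
  shows "((\<lambda>s. f (x + s *\<^sub>R u) :: real) has_real_derivative frechet_derivative f (at (x + s *\<^sub>R u)) u) (at s)"
proof -
  have "((\<lambda>s. x + s *\<^sub>R u) has_derivative (\<lambda>s. s *\<^sub>R u)) (at s)"
    by (auto intro!: derivative_eq_intros)
  from diff_chain_at[OF this assms[unfolded frechet_derivative_works]]
  have "((\<lambda>s. f (x + s *\<^sub>R u)) has_derivative
      (\<lambda>r. frechet_derivative f (at (x + s *\<^sub>R u)) (r *\<^sub>R u))) (at s)"
    by (simp add: o_def)
  then show ?thesis
    unfolding has_field_derivative_def
    by (rule has_derivative_eq_rhs)
       (simp add: linear_cmul[OF linear_frechet_derivative[OF assms]] mult.commute fun_eq_iff)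
qed

lemma partial_has_real_derivative:
  assumes "F differentiable (at (y + s *\<^sub>R axis i 1))"
  shows "((\<lambda>s. F (y + s *\<^sub>R axis i 1)) has_real_derivative partial i F (y + s *\<^sub>R axis i 1)) (at s)"
  using has_derivative_along_line[OF assms] by (simp add: partial_def)

lemma integral_continuous_compact_support:
  fixes f :: "real ^ 'n::finite \<Rightarrow> real"
  assumes "continuous_on UNIV f" "compact K" "\<And>y. y \<notin> K \<Longrightarrow> f y = 0"
  shows "integrable lborel f"
proof -
  have "f = (\<lambda>y. indicator K y *\<^sub>R f y)" using assms(3) by (force simp: indicator_def)
  then show ?thesis
    using borel_integrable_compact[OF assms(2) continuous_on_subset[OF assms(1)]]
    by (simp add: set_integrable_def)
qed

text \<open>Translation invariance makes \<open>\<integral> f (y + s e\<^sub>i) dy\<close> constant in \<open>s\<close>; differentiate at \<open>s = 0\<close>.\<close>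

lemma integral_partial_eq_0:
  fixes f :: "real ^ 'n::finite \<Rightarrow> real"
  assumes f: "C1_on UNIV f" and K: "compact K" "\<And>y. y \<notin> K \<Longrightarrow> f y = 0"
  shows "(\<integral>y. partial i f y \<partial>lborel) = 0" "integrable lborel (partial i f)"
proof -
  let ?e = "axis i 1 :: real ^ 'n"
  have zero: "partial i f y = 0" if "y \<notin> K" for y
    using partial_cong_open[of "- K" y f "\<lambda>_. 0" i] K that C1_on_differentiable[OF f]
    by (simp add: compact_imp_closed open_Compl)
  have cp: "continuous_on UNIV (partial i f)" using C1_on_partial[OF f] .
  show "integrable lborel (partial i f)"
    using integral_continuous_compact_support[OF cp K(1) zero] .
  obtain C where C: "C \<ge> 0" "\<And>y. \<bar>partial i f y\<bar> \<le> C"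
  proof -
    have "bounded (partial i f ` K)"
      using compact_continuous_image[OF continuous_on_subset[OF cp] K(1)] compact_imp_bounded by blast
    then obtain C where "\<And>y. y \<in> K \<Longrightarrow> \<bar>partial i f y\<bar> \<le> C" by (auto simp: bounded_iff)
    then have "\<bar>partial i f y\<bar> \<le> max C 0" for y using zero[of y] by (cases "y \<in> K") force+
    then show ?thesis using that[of "max C 0"] by simp
  qed
  obtain R where R: "\<And>y. y \<in> K \<Longrightarrow> norm y \<le> R"
    using compact_imp_bounded[OF K(1)] by (auto simp: bounded_iff)
  \<comment> \<open>A shift of length below \<open>1\<close> that lands in \<open>K\<close> must
    start in the ball of radius \<open>R + 1\<close>, so \<open>b\<close> dominates the integrands
    for all \<open>\<bar>t\<bar> < 1\<close>.\<close>
  define b where "b = (\<lambda>y. C * indicat_real (cball 0 (R + 1)) (y :: real ^ 'n))"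
  have "((\<lambda>s. \<integral>y. f (y + s *\<^sub>R ?e) \<partial>lborel) has_real_derivative
      (\<integral>y. partial i f (y + 0 *\<^sub>R ?e) \<partial>lborel)) (at 0)"
  proof (rule has_real_derivative_integral[where e=1 and b=b])
    fix t :: real and y :: "real ^ 'n" assume t: "\<bar>t - 0\<bar> < 1"
    show "((\<lambda>s. f (y + s *\<^sub>R ?e)) has_real_derivative partial i f (y + t *\<^sub>R ?e)) (at t)"
      using C1_on_differentiable[OF f] by (intro partial_has_real_derivative) auto
    show "\<bar>partial i f (y + t *\<^sub>R ?e)\<bar> \<le> b y"
    proof (cases "y + t *\<^sub>R ?e \<in> K")
      case True
      have "norm y = norm ((y + t *\<^sub>R ?e) - t *\<^sub>R ?e)" by simp
      also have "\<dots> \<le> norm (y + t *\<^sub>R ?e) + norm (t *\<^sub>R ?e)" by (rule norm_triangle_ineq4)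
      also have "\<dots> \<le> R + 1" using R[OF True] t by (simp add: norm_axis_1)
      finally show ?thesis using C by (simp add: b_def)
    qed (use C zero in \<open>simp add: b_def\<close>)
  next
    fix t :: real assume "\<bar>t - 0\<bar> < 1"
    show "integrable lborel (\<lambda>y. f (y + t *\<^sub>R ?e))"
    proof (rule integral_continuous_compact_support)
      show "continuous_on UNIV (\<lambda>y. f (y + t *\<^sub>R ?e))"
        by (intro continuous_on_compose2[OF C1_on_continuous[OF f]] continuous_intros) auto
      show "compact ((\<lambda>y. y - t *\<^sub>R ?e) ` K)"
        by (intro compact_continuous_image continuous_intros K)
      show "f (y + t *\<^sub>R ?e) = 0" if "y \<notin> (\<lambda>y. y - t *\<^sub>R ?e) ` K" for y
        using K(2)[of "y + t *\<^sub>R ?e"] that by (force simp: image_iff)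
    qed
  next
    show "integrable lborel b" unfolding b_def
      by (intro integrable_mult_right integrable_real_indicator emeasure_lborel_cball_finite) auto
    show "(\<lambda>y. partial i f (y + 0 *\<^sub>R ?e)) \<in> borel_measurable lborel"
      using borel_measurable_continuous_onI[OF cp] by simp
  qed simp
  moreover have "(\<integral>y. f (y + s *\<^sub>R ?e) \<partial>lborel) = (\<integral>y. f y \<partial>lborel)" for s
  proof -
    have "(\<integral>y. f y \<partial>lborel) = (\<integral>y. f y \<partial>distr lborel borel ((+) (s *\<^sub>R ?e)))"
      by (simp add: lborel_distr_plus)
    also have "\<dots> = (\<integral>y. f (s *\<^sub>R ?e + y) \<partial>lborel)"
      by (rule integral_distr)
         (use borel_measurable_continuous_onI[OF C1_on_continuous[OF f]] in auto)
    finally show ?thesis by (simp add: add.commute)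
  qed
  ultimately have "((\<lambda>s::real. \<integral>y. f y \<partial>lborel) has_real_derivative (\<integral>y. partial i f y \<partial>lborel)) (at 0)"
    by simp
  then show "(\<integral>y. partial i f y \<partial>lborel) = 0"
    using DERIV_unique DERIV_const by blast
qed

text \<open>The field \<open>w\<close> times \<open>sqrt (det G)\<close> times the gradient of
  \<open>F\<close>, extended by zero, is C^1 on the whole space because \<open>S\<close> and the
  complement of \<open>K\<close> are open and cover it. Its divergence then integrates to
  zero.\<close>

lemma coordinate_green:
  fixes G :: "real ^ 'n::finite \<Rightarrow> real ^ 'n ^ 'n"
  assumes G: "\<And>i j. C1_on S (\<lambda>z. G z $ i $ j)" and S: "open S"
    and pd: "\<And>y. y \<in> S \<Longrightarrow> pos_def (G y)"
    and F: "\<And>i. C1_on S (partial i F)" and w: "C1_on S w"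
    and K: "compact K" "K \<subseteq> S" "\<And>y. y \<in> S - K \<Longrightarrow> w y = 0"
  shows "(\<integral>y. indicat_real S y * (sqrt (det (G y)) * (w y * coord_laplacian G F y
       + (\<Sum>i\<in>UNIV. \<Sum>j\<in>UNIV. matrix_inv (G y) $ i $ j * partial i w y * partial j F y))) \<partial>lborel) = 0"
proof -
  have dpos: "\<And>y. y \<in> S \<Longrightarrow> det (G y) > 0" using pd pos_def_det_pos by blast
  then have nz: "\<And>y. y \<in> S \<Longrightarrow> det (G y) \<noteq> 0" by force
  define V where "V i z = w z * (\<Sum>j\<in>UNIV. sqrt (det (G z)) * matrix_inv (G z) $ i $ j * partial j F z)" for i z
  define V0 where "V0 i z = (if z \<in> S then V i z else 0)" for i z
  have oK: "open (- K)" using K by (simp add: compact_imp_closed open_Compl)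
  have V: "C1_on S (V i)" for i
    unfolding V_def
    by (intro C1_on_mult C1_on_sum w F C1_on_sqrt C1_on_det C1_on_matrix_inv G dpos nz S) auto
  have out: "V0 i z = 0" if "z \<notin> K" for i z using that K by (auto simp: V0_def V_def)
  have "C1_on S (V0 i)" for i by (rule C1_on_cong[OF V S]) (simp add: V0_def)
  moreover have "C1_on (- K) (V0 i)" for i
    by (rule C1_on_cong[OF C1_on_const[of _ 0] oK]) (simp add: out)
  moreover have "S \<union> - K = UNIV" using K by auto
  ultimately have V0: "C1_on UNIV (V0 i)" for i using C1_on_Un[OF _ _ S oK] by metis
  have "indicat_real S y * (sqrt (det (G y)) * (w y * coord_laplacian G F y
       + (\<Sum>i\<in>UNIV. \<Sum>j\<in>UNIV. matrix_inv (G y) $ i $ j * partial i w y * partial j F y)))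
     = (\<Sum>i\<in>UNIV. partial i (V0 i) y)" for y
  proof (cases "y \<in> S")
    case True
    have "partial i (V0 i) y = partial i (V i) y" for i
      using True C1_on_differentiable[OF V0] by (intro partial_cong_open[OF S]) (auto simp: V0_def)
    then show ?thesis
      using divergence_identity[OF G S True pd F w] True by (simp add: V_def[abs_def])
  next
    case False
    then have "partial i (V0 i) y = 0" for i
      using partial_cong_open[OF oK, of y "V0 i" "\<lambda>_. 0" i] C1_on_differentiable[OF V0] K out by auto
    then show ?thesis using False by simp
  qed
  then show ?thesis
    using integral_partial_eq_0[OF V0 K(1) out] by (simp add: Bochner_Integration.integral_sum)
qed

section \<open>Smooth maps and mixed derivatives\<close>

lemma Ck_on_cong:
  assumes "open S" "\<And>x. x \<in> S \<Longrightarrow> f x = h x" "Ck_on k S f"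
  shows "Ck_on k S h"
  using assms(2,3)
proof (induction k arbitrary: f h)
  case 0
  then show ?case using continuous_on_eq by auto
next
  case (Suc k)
  have diff: "f differentiable (at x)" if "x \<in> S" for x using Suc.prems that by simp
  have "frechet_derivative f (at x) = frechet_derivative h (at x)" if "x \<in> S" for x
    using frechet_derivative_transform_within_open[OF diff[OF that] assms(1) that Suc.prems(1)] .
  then have "Ck_on k S (\<lambda>x. frechet_derivative h (at x) v)" for v
    using Suc.IH[of "\<lambda>x. frechet_derivative f (at x) v" "\<lambda>x. frechet_derivative h (at x) v"] Suc.prems by simp
  moreover have "h differentiable (at x)" if "x \<in> S" for x
    using diff[OF that] assms(1) that Suc.prems(1) unfolding differentiable_def
    by (metis has_derivative_transform_within_open)
  ultimately show ?case by simp
qed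

lemma smooth_on_cong:
  "open S \<Longrightarrow> (\<And>x. x \<in> S \<Longrightarrow> f x = h x) \<Longrightarrow> smooth_on S f \<Longrightarrow> smooth_on S h"
  unfolding smooth_on_def using Ck_on_cong by blast

lemma smooth_on_differentiable: "smooth_on S f \<Longrightarrow> x \<in> S \<Longrightarrow> f differentiable (at x)"
  unfolding smooth_on_def by (metis Ck_on.simps(2))

lemma smooth_on_frechet: "smooth_on S f \<Longrightarrow> smooth_on S (\<lambda>x. frechet_derivative f (at x) v)"
  unfolding smooth_on_def by (metis Ck_on.simps(2))

lemma smooth_on_continuous: "smooth_on S f \<Longrightarrow> continuous_on S f"
  unfolding smooth_on_def by (metis Ck_on.simps(1))

lemma smooth_on_partial: "smooth_on S F \<Longrightarrow> smooth_on S (partial i F)"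
  using smooth_on_frechet by (auto simp: partial_def[abs_def])

lemma smooth_on_C1_on: "smooth_on S F \<Longrightarrow> C1_on S F"
  unfolding C1_on_def using smooth_on_differentiable smooth_on_continuous smooth_on_partial by blast

text \<open>Derivatives of the slice are derivatives of \<open>P\<close> in directions
  \<open>(0, v)\<close>, again restricted to the slice, so an induction over \<open>k\<close> with
  general \<open>P\<close> closes.\<close>

lemma smooth_on_slice:
  fixes S :: "'a::real_normed_vector set" and T :: "'b::real_normed_vector set"
    and P :: "'b \<times> 'a \<Rightarrow> 'c::real_normed_vector"
  assumes "open S" "open T" "t \<in> T" "smooth_on (T \<times> S) P"
  shows "smooth_on S (\<lambda>y. P (t, y))"
    and "\<And>y v. y \<in> S \<Longrightarrow> frechet_derivative (\<lambda>y. P (t, y)) (at y) v = frechet_derivative P (at (t, y)) (0, v)"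
proof -
  have der: "((\<lambda>y. P (t, y)) has_derivative (\<lambda>v. frechet_derivative P (at (t, y)) (0, v))) (at y)"
    if "P differentiable (at (t, y))" for y and P :: "'b \<times> 'a \<Rightarrow> 'c"
  proof -
    have "((\<lambda>y. (t, y)) has_derivative (\<lambda>v. (0, v))) (at y)"
      by (auto intro!: derivative_eq_intros)
    from diff_chain_at[OF this that[unfolded frechet_derivative_works]]
    show ?thesis by (simp add: o_def)
  qed
  note fr = frechet_derivative_at[OF der, symmetric]
  have "Ck_on k S (\<lambda>y. P (t, y))" if "Ck_on k (T \<times> S) P" for k and P :: "'b \<times> 'a \<Rightarrow> 'c"
    using that
  proof (induction k arbitrary: P)
    case 0
    then show ?case
      by (auto intro!: continuous_on_compose2[of "T \<times> S" P S "\<lambda>y. (t, y)"] continuous_intros \<open>t \<in> T\<close>)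
  next
    case (Suc k)
    have d: "P differentiable (at (t, y))" if "y \<in> S" for y using Suc.prems that \<open>t \<in> T\<close> by auto
    have "Ck_on k S (\<lambda>y. frechet_derivative P (at (t, y)) (0, v))" for v
      using Suc.IH[of "\<lambda>z. frechet_derivative P (at z) (0, v)"] Suc.prems by simp
    then have "Ck_on k S (\<lambda>y. frechet_derivative (\<lambda>y. P (t, y)) (at y) v)" for v
      by (rule Ck_on_cong[OF assms(1), rotated]) (simp add: fr[OF d])
    moreover have "(\<lambda>y. P (t, y)) differentiable (at y)" if "y \<in> S" for y
      using differentiableI[OF der[OF d[OF that]]] .
    ultimately show ?case by simp
  qed
  then show "smooth_on S (\<lambda>y. P (t, y))" using assms(4) by (simp add: smooth_on_def)
  show "frechet_derivative (\<lambda>y. P (t, y)) (at y) v = frechet_derivative P (at (t, y)) (0, v)" if "y \<in> S" for y v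
    using fr[OF smooth_on_differentiable[OF assms(4)]] that \<open>t \<in> T\<close> by simp
qed

text \<open>Two applications of the mean value theorem: along \<open>u\<close> to the difference of
  \<open>f\<close> on two parallel segments, then along \<open>v\<close> to the derivative so
  obtained. The bound on \<open>s\<close> keeps the whole parallelogram inside the ball.\<close>

lemma second_difference_mean_value:
  fixes f :: "'a::real_normed_vector \<Rightarrow> real"
  assumes S: "ball x r \<subseteq> S" and f: "Ck_on 2 S f" and s: "s > 0" "s * (norm u + norm v) < r"
  shows "\<exists>a b. 0 < a \<and> a < s \<and> 0 < b \<and> b < s \<and>
    f (x + s *\<^sub>R u + s *\<^sub>R v) - f (x + s *\<^sub>R u) - f (x + s *\<^sub>R v) + f x =
      s * s * frechet_derivative (\<lambda>z. frechet_derivative f (at z) u) (at (x + a *\<^sub>R u + b *\<^sub>R v)) v"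
proof -
  have in_S: "x + a *\<^sub>R u + b *\<^sub>R v \<in> S" if "0 \<le> a" "a \<le> s" "0 \<le> b" "b \<le> s" for a b
  proof -
    have "norm (a *\<^sub>R u + b *\<^sub>R v) \<le> a * norm u + b * norm v"
      using norm_triangle_ineq[of "a *\<^sub>R u" "b *\<^sub>R v"] that by simp
    also have "\<dots> \<le> s * norm u + s * norm v"
      using that by (intro add_mono mult_right_mono) auto
    also have "\<dots> < r" using s by (simp add: algebra_simps)
    finally have "dist (x + a *\<^sub>R u + b *\<^sub>R v) x < r"
      by (simp add: dist_norm add.assoc)
    then have "x + a *\<^sub>R u + b *\<^sub>R v \<in> ball x r"
      by (simp add: dist_commute)
    then show ?thesis using S by blast
  qed
  let ?f' = "\<lambda>z. frechet_derivative f (at z) u"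
  have d1: "f differentiable (at z)" if "z \<in> S" for z using f that by (simp add: numeral_2_eq_2)
  have d2: "?f' differentiable (at z)" if "z \<in> S" for z using f that by (simp add: numeral_2_eq_2)
  define \<phi> where "\<phi> a = f ((x + s *\<^sub>R v) + a *\<^sub>R u) - f (x + a *\<^sub>R u)" for a
  have "\<exists>a>0. a < s \<and> \<phi> s - \<phi> 0 = (s - 0) * (?f' ((x + s *\<^sub>R v) + a *\<^sub>R u) - ?f' (x + a *\<^sub>R u))"
  proof (intro MVT2 s)
    fix a assume "0 \<le> a" "a \<le> s"
    then have "(x + s *\<^sub>R v) + a *\<^sub>R u \<in> S" "x + a *\<^sub>R u \<in> S"
      using in_S[of a s] in_S[of a 0] s by (auto simp: algebra_simps)
    then show "(\<phi> has_real_derivative ?f' ((x + s *\<^sub>R v) + a *\<^sub>R u) - ?f' (x + a *\<^sub>R u)) (at a)"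
      unfolding \<phi>_def by (intro DERIV_diff has_derivative_along_line d1)
  qed
  then obtain a where a: "0 < a" "a < s"
    "\<phi> s - \<phi> 0 = s * (?f' ((x + s *\<^sub>R v) + a *\<^sub>R u) - ?f' (x + a *\<^sub>R u))" by auto
  have "\<exists>b>0. b < s \<and> ?f' ((x + a *\<^sub>R u) + s *\<^sub>R v) - ?f' ((x + a *\<^sub>R u) + 0 *\<^sub>R v)
      = (s - 0) * frechet_derivative ?f' (at ((x + a *\<^sub>R u) + b *\<^sub>R v)) v"
  proof (intro MVT2 s)
    fix b assume "0 \<le> b" "b \<le> s"
    then show "((\<lambda>b. ?f' ((x + a *\<^sub>R u) + b *\<^sub>R v)) has_real_derivative
        frechet_derivative ?f' (at ((x + a *\<^sub>R u) + b *\<^sub>R v)) v) (at b)"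
      using a by (intro has_derivative_along_line d2 in_S) auto
  qed
  then obtain b where b: "0 < b" "b < s" "?f' ((x + a *\<^sub>R u) + s *\<^sub>R v) - ?f' (x + a *\<^sub>R u)
      = s * frechet_derivative ?f' (at ((x + a *\<^sub>R u) + b *\<^sub>R v)) v" by auto
  have "(x + s *\<^sub>R v) + a *\<^sub>R u = (x + a *\<^sub>R u) + s *\<^sub>R v" by (simp add: algebra_simps)
  with a b have "\<phi> s - \<phi> 0 = s * (s * frechet_derivative ?f' (at ((x + a *\<^sub>R u) + b *\<^sub>R v)) v)"
    by simp
  moreover have "\<phi> s - \<phi> 0 = f (x + s *\<^sub>R u + s *\<^sub>R v) - f (x + s *\<^sub>R u) - f (x + s *\<^sub>R v) + f x"
    by (simp add: \<phi>_def algebra_simps)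
  ultimately show ?thesis
    by (rule_tac exI[of _ a], rule_tac exI[of _ b]) (use a b in auto)
qed

text \<open>Both mixed derivatives are limits of the same symmetric second difference quotient.\<close>

lemma second_difference_limit:
  fixes f :: "'a::real_normed_vector \<Rightarrow> real"
  assumes "open S" "x \<in> S" "Ck_on 2 S f"
  shows "((\<lambda>s. (f (x + s *\<^sub>R u + s *\<^sub>R v) - f (x + s *\<^sub>R u) - f (x + s *\<^sub>R v) + f x) / (s * s))
    \<longlongrightarrow> frechet_derivative (\<lambda>z. frechet_derivative f (at z) u) (at x) v) (at_right 0)"
proof (rule tendstoI)
  fix e :: real assume "e > 0"
  let ?H = "\<lambda>z. frechet_derivative (\<lambda>z. frechet_derivative f (at z) u) (at z) v"
  have "continuous_on S ?H" using assms(3) by (simp add: numeral_2_eq_2)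
  then have "isCont ?H x" using assms continuous_on_eq_continuous_at by blast
  then obtain d where d: "d > 0" "\<And>z. dist z x < d \<Longrightarrow> dist (?H z) (?H x) < e"
    using \<open>e > 0\<close> unfolding continuous_at_eps_delta by blast
  obtain r0 where r0: "r0 > 0" "ball x r0 \<subseteq> S" using assms openE by blast
  define r where "r = min d r0"
  have r: "r > 0" "ball x r \<subseteq> S" using d r0 by (auto simp: r_def)
  have "((\<lambda>s. s * (norm u + norm v)) \<longlongrightarrow> 0 * (norm u + norm v)) (at_right 0)"
    by (intro tendsto_intros)
  then have "\<forall>\<^sub>F s in at_right 0. s * (norm u + norm v) < r"
    using order_tendstoD(2)[of _ 0 _ r] r by simp
  moreover have "\<forall>\<^sub>F s in at_right 0. (0::real) < s" by (simp add: eventually_at_right_less)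
  ultimately show "\<forall>\<^sub>F s in at_right 0.
      dist ((f (x + s *\<^sub>R u + s *\<^sub>R v) - f (x + s *\<^sub>R u) - f (x + s *\<^sub>R v) + f x) / (s * s)) (?H x) < e"
  proof eventually_elim
    case (elim s)
    then obtain a b where ab: "0 < a" "a < s" "0 < b" "b < s"
      "f (x + s *\<^sub>R u + s *\<^sub>R v) - f (x + s *\<^sub>R u) - f (x + s *\<^sub>R v) + f x =
        s * s * ?H (x + a *\<^sub>R u + b *\<^sub>R v)"
      using second_difference_mean_value[OF r(2) assms(3)] by blast
    have "norm (a *\<^sub>R u + b *\<^sub>R v) \<le> a * norm u + b * norm v"
      using norm_triangle_ineq[of "a *\<^sub>R u" "b *\<^sub>R v"] ab by simp
    also have "\<dots> \<le> s * norm u + s * norm v"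
      using ab by (intro add_mono mult_right_mono) auto
    also have "\<dots> < r" using elim by (simp add: algebra_simps)
    finally have "dist (x + a *\<^sub>R u + b *\<^sub>R v) x < d"
      by (simp add: dist_norm add.assoc r_def)
    then show ?case using d(2) ab(5) elim by simp
  qed
qed

lemma mixed_derivatives_commute:
  fixes f :: "'a::real_normed_vector \<Rightarrow> real"
  assumes "open S" "x \<in> S" "Ck_on 2 S f"
  shows "frechet_derivative (\<lambda>z. frechet_derivative f (at z) u) (at x) v =
    frechet_derivative (\<lambda>z. frechet_derivative f (at z) v) (at x) u"
proof (rule tendsto_unique[OF _ second_difference_limit[OF assms]])
  show "((\<lambda>s. (f (x + s *\<^sub>R u + s *\<^sub>R v) - f (x + s *\<^sub>R u) - f (x + s *\<^sub>R v) + f x) / (s * s))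
    \<longlongrightarrow> frechet_derivative (\<lambda>z. frechet_derivative f (at z) v) (at x) u) (at_right 0)"
    using second_difference_limit[OF assms, of v u] by (simp add: algebra_simps)
qed (rule trivial_limit_at_right_real)

section \<open>Riemannian manifolds in charts\<close>

text \<open>With coordinate projections for \<open>L\<close>, this passes from smooth vector- and
  matrix-valued maps to their entries.\<close>

lemma smooth_on_C1_on_linear:
  fixes L :: "'b::real_normed_vector \<Rightarrow> real"
  assumes "bounded_linear L" "smooth_on S f"
  shows "C1_on S (\<lambda>y. L (f y))"
proof -
  have der: "((\<lambda>y. L (f y)) has_derivative (\<lambda>v. L (frechet_derivative f (at y) v))) (at y)" if "y \<in> S" for y
    using bounded_linear.has_derivative[OF assms(1)] smooth_on_differentiable[OF assms(2) that]
    unfolding frechet_derivative_works by blast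
  have "continuous_on S (\<lambda>y. L (frechet_derivative f (at y) v))" for v
    using smooth_on_continuous[OF smooth_on_frechet[OF assms(2)]]
    by (intro continuous_on_compose2[OF linear_continuous_on[OF assms(1)]]) auto
  then have "continuous_on S (partial i (\<lambda>y. L (f y)))" for i
    by (rule continuous_on_eq) (simp add: partial_eqI[OF der])
  then show ?thesis unfolding C1_on_def using der differentiableI by blast
qed

text \<open>The polarisation of \<open>coord_grad_norm_sq\<close>; Green's identity and
  Cauchy-Schwarz need two different arguments.\<close>

definition coord_inner ::
    "(real ^ 'n::finite \<Rightarrow> real ^ 'n ^ 'n) \<Rightarrow> (real ^ 'n \<Rightarrow> real) \<Rightarrow> (real ^ 'n \<Rightarrow> real) \<Rightarrow> real ^ 'n \<Rightarrow> real" where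
  "coord_inner G F H y =
     (\<Sum>i\<in>UNIV. \<Sum>j\<in>UNIV. matrix_inv (G y) $ i $ j * partial i F y * partial j H y)"

definition grad_inner ::
    "('a, 'n::finite) chart set \<Rightarrow> ('a, 'n) metric \<Rightarrow> ('a \<Rightarrow> real) \<Rightarrow> ('a \<Rightarrow> real) \<Rightarrow> 'a \<Rightarrow> real" where
  "grad_inner \<A> g u v x =
     (let c = chart_at \<A> x in coord_inner (g c) (in_chart c u) (in_chart c v) (snd c x))"

lemma grad_norm_sq_eq: "grad_norm_sq \<A> g u x = grad_inner \<A> g u u x"
  by (simp add: grad_norm_sq_def grad_inner_def coord_grad_norm_sq_def coord_inner_def)

lemma coord_inner_vec:
  "coord_inner G F H y = (\<chi> i. partial i F y) \<bullet> (matrix_inv (G y) *v (\<chi> j. partial j H y))"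
  by (simp add: coord_inner_def inner_vec_def matrix_vector_mult_def sum_distrib_left mult_ac)

lemma inner_matrix_transpose:
  fixes J :: "real ^ 'n ^ 'm::finite"
  shows "(J *v v) \<bullet> z = v \<bullet> (transpose J *v z)"
  by (metis dot_lmul_matrix inner_commute transpose_matrix_vector)

locale closed_riemannian =
  fixes \<A> :: "('a::t2_space, 'n::finite) chart set" and g :: "('a, 'n) metric" and vol :: "'a measure"
  assumes manifold: "closed_riemannian_manifold \<A> g" and volume: "is_riemannian_volume \<A> g vol"
begin

lemma compact_M: "compact (UNIV :: 'a set)"
  using manifold by (simp add: closed_riemannian_manifold_def closed_smooth_manifold_def)

lemma atlas: "smooth_atlas \<A>"
  using manifold by (simp add: closed_riemannian_manifold_def closed_smooth_manifold_def)

lemma metric: "riemannian_metric \<A> g"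
  using manifold by (simp add: closed_riemannian_manifold_def)

lemma chart_open: "c \<in> \<A> \<Longrightarrow> open (fst c)" "c \<in> \<A> \<Longrightarrow> open (chart_image c)"
  using atlas by (auto simp: smooth_atlas_def is_chart_def)

lemma chart_homeomorphism: "c \<in> \<A> \<Longrightarrow> homeomorphism (fst c) (chart_image c) (snd c) (chart_inv c)"
  using atlas by (auto simp: smooth_atlas_def is_chart_def)

lemma chart_inv_left [simp]: "c \<in> \<A> \<Longrightarrow> x \<in> fst c \<Longrightarrow> chart_inv c (snd c x) = x"
  using chart_homeomorphism by (auto simp: homeomorphism_def)

lemma chart_inv_right [simp]: "c \<in> \<A> \<Longrightarrow> y \<in> chart_image c \<Longrightarrow> snd c (chart_inv c y) = y"
  using chart_homeomorphism by (auto simp: homeomorphism_def)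

lemma chart_inv_in [simp]: "c \<in> \<A> \<Longrightarrow> y \<in> chart_image c \<Longrightarrow> chart_inv c y \<in> fst c"
  using chart_homeomorphism homeomorphism_image2 by blast

lemma chart_map_in [simp]: "x \<in> fst c \<Longrightarrow> snd c x \<in> chart_image c"
  by (simp add: chart_image_def)

lemma chart_continuous:
  "c \<in> \<A> \<Longrightarrow> continuous_on (fst c) (snd c)" "c \<in> \<A> \<Longrightarrow> continuous_on (chart_image c) (chart_inv c)"
  using chart_homeomorphism by (auto simp: homeomorphism_def)

lemma chart_image_open:
  assumes "c \<in> \<A>" "open V" "V \<subseteq> fst c"
  shows "open (snd c ` V)"
proof -
  have "snd c ` V = chart_image c \<inter> chart_inv c -` V"
    using assms by (force simp: image_iff chart_image_def)
  then show ?thesis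
    using continuous_open_preimage[OF chart_continuous(2) chart_open(2)] assms by metis
qed

lemma chart_at: "chart_at \<A> x \<in> \<A>" "x \<in> fst (chart_at \<A> x)"
proof -
  have "x \<in> (\<Union>c\<in>\<A>. fst c)" using atlas unfolding smooth_atlas_def by (metis UNIV_I)
  then have "\<exists>c. c \<in> \<A> \<and> x \<in> fst c" by blast
  from someI_ex[OF this] show "chart_at \<A> x \<in> \<A>" "x \<in> fst (chart_at \<A> x)"
    by (auto simp: chart_at_def)
qed

lemma metric_pos_def: "c \<in> \<A> \<Longrightarrow> y \<in> chart_image c \<Longrightarrow> pos_def (g c y)"
  using metric by (auto simp: riemannian_metric_def pos_def_def)

lemma metric_C1: "c \<in> \<A> \<Longrightarrow> C1_on (chart_image c) (\<lambda>z. g c z $ i $ j)"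
  using metric by (intro smooth_on_C1_on_linear[where L="\<lambda>A. A $ i $ j"])
    (auto simp: riemannian_metric_def intro: bounded_linear_compose[OF bounded_linear_vec_nth bounded_linear_vec_nth])

lemma det_metric_pos: "c \<in> \<A> \<Longrightarrow> y \<in> chart_image c \<Longrightarrow> det (g c y) > 0"
  using metric_pos_def pos_def_det_pos by blast

lemma sqrt_det_continuous: "c \<in> \<A> \<Longrightarrow> continuous_on (chart_image c) (\<lambda>y. sqrt (det (g c y)))"
  by (intro C1_on_continuous C1_on_sqrt C1_on_det metric_C1 det_metric_pos)

lemma metric_inv_C1:
  assumes "c \<in> \<A>"
  shows "C1_on (chart_image c) (\<lambda>z. matrix_inv (g c z) $ i $ j)"
  by (rule C1_on_matrix_inv[OF metric_C1[OF assms] chart_open(2)[OF assms]])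
     (metis det_metric_pos[OF assms] less_irrefl)

lemma transition_smooth:
  "c \<in> \<A> \<Longrightarrow> d \<in> \<A> \<Longrightarrow> smooth_on (snd c ` (fst c \<inter> fst d)) (transition c d)"
  using atlas by (auto simp: smooth_atlas_def)

lemma overlap_open: "c \<in> \<A> \<Longrightarrow> d \<in> \<A> \<Longrightarrow> open (snd c ` (fst c \<inter> fst d))"
  by (intro chart_image_open) (auto intro: chart_open)

lemma in_chart_transition:
  assumes "c \<in> \<A>" "d \<in> \<A>" "y \<in> snd c ` (fst c \<inter> fst d)"
  shows "in_chart c u y = in_chart d u (transition c d y)"
  using assms by (auto simp: in_chart_def transition_def)

lemma in_chart_has_derivative_transition:
  assumes c: "c \<in> \<A>" "d \<in> \<A>" and x: "x \<in> fst c" "x \<in> fst d"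
    and u: "in_chart d u differentiable (at (snd d x))"
  shows "(in_chart c u has_derivative (\<lambda>v. frechet_derivative (in_chart d u) (at (snd d x))
      (frechet_derivative (transition c d) (at (snd c x)) v))) (at (snd c x))"
proof -
  have y: "snd c x \<in> snd c ` (fst c \<inter> fst d)" using x by auto
  have tr: "transition c d (snd c x) = snd d x" using c x by (simp add: transition_def)
  have "(transition c d has_derivative frechet_derivative (transition c d) (at (snd c x))) (at (snd c x))"
    using smooth_on_differentiable[OF transition_smooth[OF c] y] by (simp add: frechet_derivative_works)
  moreover have "(in_chart d u has_derivative frechet_derivative (in_chart d u) (at (snd d x)))
      (at (transition c d (snd c x)))"
    using u by (simp add: frechet_derivative_works tr)
  ultimately have "(in_chart d u \<circ> transition c d has_derivative
      (frechet_derivative (in_chart d u) (at (snd d x)) \<circ> frechet_derivative (transition c d) (at (snd c x))))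
      (at (snd c x))"
    by (rule diff_chain_at)
  then have "(in_chart d u \<circ> transition c d has_derivative (\<lambda>v. frechet_derivative (in_chart d u) (at (snd d x))
      (frechet_derivative (transition c d) (at (snd c x)) v))) (at (snd c x))"
    by (simp add: o_def)
  then show ?thesis
    by (rule has_derivative_transform_within_open[OF _ overlap_open[OF c] y])
       (simp add: in_chart_transition[OF c])
qed

text \<open>With \<open>J\<close> the Jacobian of the transition map, the metrics are related by
  \<open>transpose J\<close> and \<open>J\<close>, so their inverses are related the opposite way,
  while the vectors of partial derivatives transform by \<open>transpose J\<close>. The Jacobians
  cancel.\<close>

lemma coord_inner_chart_independent:
  assumes c: "c \<in> \<A>" "d \<in> \<A>" and x: "x \<in> fst c" "x \<in> fst d"
    and uv: "in_chart c u differentiable (at (snd c x))" "in_chart c v differentiable (at (snd c x))"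
  shows "coord_inner (g c) (in_chart c u) (in_chart c v) (snd c x) =
    coord_inner (g d) (in_chart d u) (in_chart d v) (snd d x)"
proof -
  let ?y = "snd c x" and ?y' = "snd d x"
  let ?T = "frechet_derivative (transition c d) (at ?y)"
  define J where "J = matrix ?T"
  have y: "?y \<in> snd c ` (fst c \<inter> fst d)" using x by auto
  have tr: "transition c d ?y = ?y'" using c x by (simp add: transition_def)
  have J: "?T v = J *v v" for v
    using linear_frechet_derivative[OF smooth_on_differentiable[OF transition_smooth[OF c] y]]
    by (simp add: J_def matrix_works)
  have "v \<bullet> (g c ?y *v w) = ?T v \<bullet> (g d ?y' *v ?T w)" for v w
    using metric c y unfolding riemannian_metric_def by (metis tr)
  then have "v \<bullet> (g c ?y *v w) = v \<bullet> ((transpose J ** (g d ?y' ** J)) *v w)" for v w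
    unfolding J inner_matrix_transpose by (simp only: matrix_vector_mul_assoc)
  then have Gc: "g c ?y = transpose J ** (g d ?y' ** J)"
    unfolding matrix_eq using vector_eq_ldot by blast
  let ?Bc = "matrix_inv (g c ?y)" and ?Bd = "matrix_inv (g d ?y')"
  have nz: "det (g c ?y) \<noteq> 0" "det (g d ?y') \<noteq> 0"
    using det_metric_pos c x by (metis chart_map_in less_irrefl)+
  \<comment> \<open>A one-sided inverse of a square matrix is two-sided, so
    \<open>transpose J\<close> may be moved to the right end. This yields the law for the inverse
    metrics without inverting \<open>J\<close>.\<close>
  have "transpose J ** (g d ?y' ** (J ** ?Bc)) = mat 1"
    using matrix_inv_inverse(1)[OF nz(1)] unfolding Gc by (simp add: matrix_mul_assoc)
  then have "(g d ?y' ** (J ** ?Bc)) ** transpose J = mat 1"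
    by (simp add: matrix_left_right_inverse)
  then have "?Bd ** ((g d ?y' ** (J ** ?Bc)) ** transpose J) = ?Bd" by simp
  then have Bd: "J ** (?Bc ** transpose J) = ?Bd"
    by (simp add: matrix_mul_assoc matrix_inv_inverse(2)[OF nz(2)])
  have grad: "(\<chi> i. partial i (in_chart c w) ?y) = transpose J *v (\<chi> i. partial i (in_chart d w) ?y')"
    if w: "in_chart c w differentiable (at ?y)" for w
  proof -
    have d: "in_chart d w differentiable (at ?y')"
      using in_chart_has_derivative_transition[OF c(2,1) x(2,1) w] by (rule differentiableI)
    have "(\<chi> i. partial i (in_chart c w) ?y) $ i = (transpose J *v (\<chi> i. partial i (in_chart d w) ?y')) $ i" for i
    proof -
      have "partial i (in_chart c w) ?y = frechet_derivative (in_chart d w) (at ?y') (J *v axis i 1)"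
        using partial_eqI[OF in_chart_has_derivative_transition[OF c x d], of i] by (simp only: J)
      also have "\<dots> = (\<Sum>k\<in>UNIV. J $ k $ i * partial k (in_chart d w) ?y')"
        by (simp add: frechet_derivative_partials[OF d] matrix_vector_mult_basis column_def)
      finally show ?thesis by (simp add: matrix_vector_mult_def transpose_def)
    qed
    then show ?thesis by (simp only: vec_eq_iff) blast
  qed
  let ?pu = "\<chi> i. partial i (in_chart d u) ?y'" and ?pv = "\<chi> i. partial i (in_chart d v) ?y'"
  have "coord_inner (g c) (in_chart c u) (in_chart c v) ?y =
      (transpose J *v ?pu) \<bullet> (?Bc *v (transpose J *v ?pv))"
    unfolding coord_inner_vec grad[OF uv(1)] grad[OF uv(2)] ..
  also have "\<dots> = ?pu \<bullet> ((J ** (?Bc ** transpose J)) *v ?pv)"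
    using inner_matrix_transpose[of J] by (simp add: matrix_vector_mul_assoc[symmetric] inner_commute)
  finally show ?thesis unfolding Bd coord_inner_vec .
qed

section \<open>C^1 and C^2 functions on the manifold\<close>

definition C1M :: "('a \<Rightarrow> real) \<Rightarrow> bool" where
  "C1M u \<longleftrightarrow> (\<forall>c\<in>\<A>. C1_on (chart_image c) (in_chart c u))"

definition C2M :: "('a \<Rightarrow> real) \<Rightarrow> bool" where
  "C2M u \<longleftrightarrow> C1M u \<and> (\<forall>c\<in>\<A>. \<forall>i. C1_on (chart_image c) (partial i (in_chart c u)))"

lemma C1M_D: "C1M u \<Longrightarrow> c \<in> \<A> \<Longrightarrow> C1_on (chart_image c) (in_chart c u)"
  by (simp add: C1M_def)

lemma C2M_D:
  "C2M u \<Longrightarrow> C1M u"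
  "C2M u \<Longrightarrow> c \<in> \<A> \<Longrightarrow> C1_on (chart_image c) (partial i (in_chart c u))"
  by (simp_all add: C2M_def)

lemma C1M_differentiable: "C1M u \<Longrightarrow> c \<in> \<A> \<Longrightarrow> y \<in> chart_image c \<Longrightarrow> in_chart c u differentiable (at y)"
  using C1M_D C1_on_differentiable by blast

lemma smooth_function_C2M: "smooth_function \<A> u \<Longrightarrow> C2M u"
  unfolding C2M_def C1M_def smooth_function_def using smooth_on_C1_on smooth_on_partial by blast

lemma C1M_mult: "C1M u \<Longrightarrow> C1M v \<Longrightarrow> C1M (\<lambda>x. u x * v x)"
  using C1_on_mult unfolding C1M_def in_chart_def by blast

lemma C1M_sum: "finite I \<Longrightarrow> (\<And>i. i \<in> I \<Longrightarrow> C1M (u i)) \<Longrightarrow> C1M (\<lambda>x. \<Sum>i\<in>I. u i x)"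
  unfolding C1M_def in_chart_def by (auto intro: C1_on_sum)

lemma C1M_inverse: "C1M u \<Longrightarrow> (\<And>x. u x \<noteq> 0) \<Longrightarrow> C1M (\<lambda>x. inverse (u x))"
  unfolding C1M_def in_chart_def by (auto intro: C1_on_inverse)

lemma continuous_on_spacetime:
  fixes F :: "'b::topological_space \<Rightarrow> 'a \<Rightarrow> real"
  assumes "open T" "\<And>c. c \<in> \<A> \<Longrightarrow> continuous_on (T \<times> chart_image c) (\<lambda>(t, y). F t (chart_inv c y))"
  shows "continuous_on (T \<times> UNIV) (\<lambda>(t, x). F t x)"
proof -
  have "continuous_on (T \<times> fst c) (\<lambda>(t, x). F t x)" if c: "c \<in> \<A>" for c
  proof -
    have "continuous_on (T \<times> fst c) (\<lambda>z. (\<lambda>(t, y). F t (chart_inv c y)) (fst z, snd c (snd z)))"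
      using c by (intro continuous_on_compose2[OF assms(2)[OF c]]
          continuous_intros continuous_on_compose2[OF chart_continuous(1)[OF c]]) auto
    then show ?thesis by (rule continuous_on_eq) (use c in auto)
  qed
  then have "continuous_on (\<Union>c\<in>\<A>. T \<times> fst c) (\<lambda>(t, x). F t x)"
    using assms(1) chart_open by (intro continuous_on_open_UN open_Times) auto
  moreover have "(\<Union>c\<in>\<A>. T \<times> fst c) = T \<times> UNIV" using chart_at by blast
  ultimately show ?thesis by simp
qed

lemma continuous_on_manifold:
  assumes "\<And>c. c \<in> \<A> \<Longrightarrow> continuous_on (chart_image c) (in_chart c u)"
  shows "continuous_on UNIV u"
proof -
  have "continuous_on (fst c) u" if c: "c \<in> \<A>" for c
  proof -
    have "continuous_on (fst c) (\<lambda>x. in_chart c u (snd c x))"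
      using c by (intro continuous_on_compose2[OF assms[OF c]] chart_continuous) auto
    then show ?thesis by (rule continuous_on_eq) (use c in \<open>auto simp: in_chart_def\<close>)
  qed
  then have "continuous_on (\<Union>c\<in>\<A>. fst c) u"
    using chart_open by (intro continuous_on_open_UN) auto
  moreover have "(\<Union>c\<in>\<A>. fst c) = UNIV" using chart_at by blast
  ultimately show ?thesis by simp
qed

lemma C1M_continuous: "C1M u \<Longrightarrow> continuous_on UNIV u"
  by (intro continuous_on_manifold C1_on_continuous C1M_D)

lemma coord_inner_continuous:
  assumes "c \<in> \<A>" "C1_on (chart_image c) F" "C1_on (chart_image c) H"
  shows "continuous_on (chart_image c) (coord_inner (g c) F H)"
  unfolding coord_inner_def[abs_def]
  by (intro continuous_on_sum continuous_on_mult C1_on_continuous[OF metric_inv_C1[OF assms(1)]]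
      C1_on_partial[OF assms(2)] C1_on_partial[OF assms(3)])

lemma grad_inner_in_chart:
  assumes "C1M u" "C1M v" "c \<in> \<A>" "x \<in> fst c"
  shows "grad_inner \<A> g u v x = coord_inner (g c) (in_chart c u) (in_chart c v) (snd c x)"
  unfolding grad_inner_def Let_def
  using assms chart_at by (intro coord_inner_chart_independent C1M_differentiable) auto

lemma grad_inner_continuous:
  assumes "C1M u" "C1M v"
  shows "continuous_on UNIV (grad_inner \<A> g u v)"
proof (rule continuous_on_manifold)
  fix c assume c: "c \<in> \<A>"
  show "continuous_on (chart_image c) (in_chart c (grad_inner \<A> g u v))"
    by (rule continuous_on_eq[OF coord_inner_continuous[OF c C1M_D[OF assms(1) c] C1M_D[OF assms(2) c]]])
       (simp add: in_chart_def grad_inner_in_chart[OF assms c] c)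
qed

lemma coord_laplacian_continuous:
  assumes "c \<in> \<A>" "C1_on (chart_image c) F" "\<And>i. C1_on (chart_image c) (partial i F)"
  shows "continuous_on (chart_image c) (coord_laplacian (g c) F)"
  unfolding coord_laplacian_def[abs_def] covariant_hessian_def christoffel_def
  by (intro continuous_on_sum continuous_on_mult continuous_on_diff continuous_on_add continuous_on_const
      C1_on_continuous[OF metric_inv_C1[OF assms(1)]] C1_on_partial[OF assms(2)] C1_on_partial[OF assms(3)]
      C1_on_partial[OF metric_C1[OF assms(1)]])

text \<open>The function is built in one chart and must be C^1 in all of them; its compact support
  \<open>K\<close> inside that chart makes the extension by zero harmless.\<close>

lemma bump_function:
  assumes "open V" "x \<in> V"
  shows "\<exists>b K. compact K \<and> K \<subseteq> V \<and> C1M b \<and> (\<forall>z. b z \<ge> 0) \<and> b x > 0 \<and> (\<forall>z. z \<notin> K \<longrightarrow> b z = 0)"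
proof -
  define c where "c = chart_at \<A> x"
  have c: "c \<in> \<A>" "x \<in> fst c" using chart_at by (auto simp: c_def)
  let ?p = "snd c x"
  have "open (snd c ` (V \<inter> fst c))" using c by (intro chart_image_open open_Int assms chart_open) auto
  then obtain r where r: "r > 0" "cball ?p r \<subseteq> snd c ` (V \<inter> fst c)"
    using assms c open_contains_cball by blast
  define K where "K = chart_inv c ` cball ?p r"
  have im: "cball ?p r \<subseteq> chart_image c" using r by (auto simp: chart_image_def)
  have K: "compact K" unfolding K_def
    by (intro compact_continuous_image continuous_on_subset[OF chart_continuous(2)[OF c(1)] im] compact_cball)
  have KV: "K \<subseteq> V \<inter> fst c"
  proof
    fix z assume "z \<in> K"
    then obtain y where y: "y \<in> cball ?p r" "z = chart_inv c y" by (auto simp: K_def)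
    then obtain z' where "z' \<in> V \<inter> fst c" "y = snd c z'" using r by blast
    then show "z \<in> V \<inter> fst c" using y c by simp
  qed
  \<comment> \<open>The squared positive part is C^1 and vanishes on the negative half-line, so
    composing it with \<open>r\<close> squared minus the squared coordinate distance cuts off at
    radius \<open>r\<close>.\<close>
  define q where "q s = (max 0 s)\<^sup>2" for s :: real
  have q': "(q has_real_derivative 2 * max 0 s) (at s)" for s
  proof -
    consider "s > 0" | "s < 0" | "s = 0" by linarith
    then show ?thesis
    proof cases
      case 1
      have "((\<lambda>s. s\<^sup>2) has_real_derivative 2 * s) (at s)" by (auto intro!: derivative_eq_intros)
      then have "(q has_real_derivative 2 * s) (at s)"
        by (rule has_field_derivative_transform_within_open[of _ _ _ "{0<..}"]) (use 1 in \<open>auto simp: q_def\<close>)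
      then show ?thesis using 1 by simp
    next
      case 2
      have "((\<lambda>s. 0) has_real_derivative 0) (at s)" by simp
      then have "(q has_real_derivative 0) (at s)"
        by (rule has_field_derivative_transform_within_open[of _ _ _ "{..<0}"]) (use 2 in \<open>auto simp: q_def\<close>)
      then show ?thesis using 2 by simp
    next
      case 3
      have "((\<lambda>h. (q (0 + h) - q 0) / h) \<longlongrightarrow> 0) (at 0)"
      proof (rule Lim_null_comparison)
        show "\<forall>\<^sub>F h in at 0. norm ((q (0 + h) - q 0) / h) \<le> \<bar>h\<bar>"
          by (rule always_eventually) (auto simp: q_def max_def power2_eq_square)
        show "((\<lambda>h. \<bar>h\<bar>) \<longlongrightarrow> (0::real)) (at 0)" by (auto intro!: tendsto_eq_intros)
      qed
      then show ?thesis using 3 by (simp add: DERIV_def)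
    qed
  qed
  \<comment> \<open>The squared distance is written as a polynomial in the coordinates, so that in
    another chart it becomes a polynomial in the components of the transition map.\<close>
  define b where "b z = (if z \<in> fst c then q (r\<^sup>2 - (\<Sum>k\<in>UNIV. (snd c z $ k - ?p $ k) * (snd c z $ k - ?p $ k))) else 0)" for z
  have b: "b z = (if z \<in> fst c then q (r\<^sup>2 - (dist ?p (snd c z))\<^sup>2) else 0)" for z
    unfolding b_def dist_commute[of ?p] by (simp add: dist_norm power2_norm_eq_inner inner_vec_def)
  have zero: "b z = 0" if "z \<notin> K" for z
  proof (cases "z \<in> fst c")
    case True
    then have "snd c z \<notin> cball ?p r" using that c unfolding K_def by (metis chart_inv_left image_eqI)
    then have "r < dist ?p (snd c z)" by simp
    then have "r\<^sup>2 \<le> (dist ?p (snd c z))\<^sup>2" using r by (intro power_mono) auto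
    then show ?thesis by (simp add: b q_def)
  qed (simp add: b)
  have "C1_on (chart_image d) (in_chart d b)" if d: "d \<in> \<A>" for d
  proof -
    \<comment> \<open>Two open sets cover the image of \<open>d\<close>: on \<open>?S\<close> the
      explicit formula applies, on \<open>?Z\<close> the function is zero.\<close>
    let ?S = "snd d ` (fst d \<inter> fst c)" and ?Z = "snd d ` (fst d - K)"
    have oZ: "open ?Z" using d K compact_imp_closed chart_open by (intro chart_image_open open_Diff) auto
    have "C1_on ?Z (in_chart d b)"
      by (rule C1_on_cong[OF C1_on_const[of _ 0] oZ]) (use zero d in \<open>auto simp: in_chart_def\<close>)
    moreover have "C1_on ?S (in_chart d b)"
    proof (rule C1_on_cong)
      have T: "C1_on ?S (\<lambda>y. transition d c y $ k)" for k
        by (intro smooth_on_C1_on_linear[where L="\<lambda>v. v $ k"] transition_smooth d c bounded_linear_vec_nth)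
      show "C1_on ?S (\<lambda>y. q (r\<^sup>2 + - 1 * (\<Sum>k\<in>UNIV. (transition d c y $ k + - ?p $ k) * (transition d c y $ k + - ?p $ k))))"
      proof (rule C1_on_real_compose[where h = q and h' = "\<lambda>s. 2 * max 0 s", OF _ q'])
        show "C1_on ?S (\<lambda>y. r\<^sup>2 + - 1 * (\<Sum>k\<in>UNIV. (transition d c y $ k + - ?p $ k) * (transition d c y $ k + - ?p $ k)))"
          by (intro C1_on_add C1_on_mult C1_on_sum C1_on_const T finite)
      qed (intro continuous_intros)
      show "q (r\<^sup>2 + - 1 * (\<Sum>k\<in>UNIV. (transition d c y $ k + - ?p $ k) * (transition d c y $ k + - ?p $ k)))
          = in_chart d b y" if "y \<in> ?S" for y
        using that d by (auto simp: in_chart_def transition_def b_def)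
    qed (rule overlap_open[OF d c(1)])
    moreover have "?S \<union> ?Z = chart_image d" using KV by (auto simp: chart_image_def)
    ultimately show ?thesis using C1_on_Un overlap_open[OF d c(1)] oZ by metis
  qed
  then have "C1M b" by (simp add: C1M_def)
  moreover have "b x > 0" using c r by (simp add: b q_def)
  moreover have "b z \<ge> 0" for z by (simp add: b q_def)
  ultimately show ?thesis using K KV zero by blast
qed

end

section \<open>Volume and Green's identity\<close>

context closed_riemannian begin

section \<open>Integration against the Riemannian volume\<close>

lemma sets_vol [measurable_cong]: "sets vol = sets borel"
  using volume by (simp add: is_riemannian_volume_def)

lemma space_vol [simp]: "space vol = UNIV"
  using sets_eq_imp_space_eq[OF sets_vol] by simp

lemma emeasure_vol_chart:
  assumes "c \<in> \<A>" "S \<in> sets borel" "S \<subseteq> fst c"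
  shows "emeasure vol S = (\<integral>\<^sup>+ y. ennreal (sqrt (det (g c y))) * indicator (snd c ` S) y \<partial>lborel)"
  using volume assms by (simp add: is_riemannian_volume_def)

lemma chart_inv_measurable:
  assumes "c \<in> \<A>"
  shows "chart_inv c \<in> measurable (restrict_space lborel (chart_image c)) (restrict_space borel (fst c))"
  by (subst measurable_cong_sets[OF sets_restrict_space_cong[OF sets_lborel] refl],
      intro measurable_restrict_space2 borel_measurable_continuous_on_restrict chart_continuous assms)
     (auto simp: space_restrict_space assms)

lemma sqrt_det_measurable:
  assumes "c \<in> \<A>"
  shows "(\<lambda>y. sqrt (det (g c y))) \<in> borel_measurable (restrict_space lborel (chart_image c))"
  by (subst measurable_cong_sets[OF sets_restrict_space_cong[OF sets_lborel] refl])
     (intro borel_measurable_continuous_on_restrict sqrt_det_continuous assms)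

text \<open>The defining formula for the measure of sets, recast as an equality with a push-forward.
  Change of variables for integrals then follows from the rules for \<open>distr\<close> and
  \<open>density\<close>.\<close>

lemma restrict_vol_chart:
  assumes c: "c \<in> \<A>"
  shows "restrict_space vol (fst c) = distr (density (restrict_space lborel (chart_image c))
    (\<lambda>y. sqrt (det (g c y)))) (restrict_space borel (fst c)) (chart_inv c)"
    (is "_ = distr ?D ?N _")
proof (rule measure_eqI)
  note o = borel_open[OF chart_open(1)[OF c]] borel_open[OF chart_open(2)[OF c]]
  show "sets (restrict_space vol (fst c)) = sets (distr ?D ?N (chart_inv c))"
    by (simp add: sets_restrict_space_cong[OF sets_vol])
  fix S assume "S \<in> sets (restrict_space vol (fst c))"
  then have S: "S \<in> sets borel" "S \<subseteq> fst c"
    using o by (auto simp: sets_restrict_space_iff sets_vol)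
  have m: "chart_inv c \<in> measurable ?D ?N"
    by (subst measurable_cong_sets[OF sets_density refl]) (rule chart_inv_measurable[OF c])
  have ms: "(\<lambda>y. ennreal (sqrt (det (g c y)))) \<in> borel_measurable (restrict_space lborel (chart_image c))"
    by (intro measurable_compose[OF _ measurable_ennreal] sqrt_det_measurable c)
  have SN: "S \<in> sets ?N" using S o by (simp add: sets_restrict_space_iff)
  have im: "chart_inv c -` S \<inter> chart_image c = snd c ` S"
    using S c by (force simp: image_iff)
  have "emeasure (distr ?D ?N (chart_inv c)) S = emeasure ?D (snd c ` S)"
    using emeasure_distr[OF m SN] by (simp add: im space_restrict_space)
  also have "\<dots> = (\<integral>\<^sup>+ y. ennreal (sqrt (det (g c y))) * indicator (snd c ` S) y \<partial>restrict_space lborel (chart_image c))"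
    using measurable_sets[OF m SN] by (intro emeasure_density ms) (simp add: im space_restrict_space)
  also have "\<dots> = (\<integral>\<^sup>+ y. ennreal (sqrt (det (g c y))) * indicator (snd c ` S) y \<partial>lborel)"
  proof -
    have "snd c ` S \<subseteq> chart_image c" using S by (auto simp: chart_image_def)
    then show ?thesis
      using o by (subst nn_integral_restrict_space) (auto intro!: nn_integral_cong simp: indicator_def image_subset_iff)
  qed
  also have "\<dots> = emeasure vol S" using emeasure_vol_chart[OF c S] by simp
  also have "\<dots> = emeasure (restrict_space vol (fst c)) S"
    using o S by (intro emeasure_restrict_space[symmetric]) (simp_all add: sets_vol)
  finally show "emeasure (restrict_space vol (fst c)) S = emeasure (distr ?D ?N (chart_inv c)) S" by simp
qed

lemma integral_vol_chart:
  fixes f :: "'a \<Rightarrow> real"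
  assumes c: "c \<in> \<A>" and f: "f \<in> borel_measurable borel" and out: "\<And>x. x \<notin> fst c \<Longrightarrow> f x = 0"
  shows "(\<integral>x. f x \<partial>vol) =
    (\<integral>y. indicat_real (chart_image c) y * (sqrt (det (g c y)) * f (chart_inv c y)) \<partial>lborel)"
proof -
  note o = borel_open[OF chart_open(1)[OF c]] borel_open[OF chart_open(2)[OF c]]
  let ?R = "restrict_space lborel (chart_image c)"
  note m = chart_inv_measurable[OF c] and ms = sqrt_det_measurable[OF c]
  have fr: "f \<in> borel_measurable (restrict_space borel (fst c))"
    using f by (rule measurable_restrict_space1)
  have fm: "(\<lambda>y. f (chart_inv c y)) \<in> borel_measurable ?R"
    using m fr by (rule measurable_compose)
  have "(\<integral>x. f x \<partial>vol) = (\<integral>x. indicator (fst c) x *\<^sub>R f x \<partial>vol)"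
    by (rule Bochner_Integration.integral_cong) (auto simp: indicator_def out)
  also have "\<dots> = (\<integral>x. f x \<partial>restrict_space vol (fst c))"
    using o by (intro integral_restrict_space[symmetric]) (simp add: sets_vol)
  also have "\<dots> = (\<integral>y. f (chart_inv c y) \<partial>density ?R (\<lambda>y. sqrt (det (g c y))))"
    unfolding restrict_vol_chart[OF c] by (rule integral_distr[OF _ fr]) (use m in simp)
  also have "\<dots> = (\<integral>y. sqrt (det (g c y)) *\<^sub>R f (chart_inv c y) \<partial>?R)"
    using det_metric_pos[OF c] by (intro integral_density fm ms AE_I2) (auto simp: space_restrict_space less_imp_le)
  also have "\<dots> = (\<integral>y. indicat_real (chart_image c) y * (sqrt (det (g c y)) * f (chart_inv c y)) \<partial>lborel)"
    using o by (subst integral_restrict_space) auto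
  finally show ?thesis .
qed

text \<open>Every point has a neighbourhood whose coordinate image lies in a closed ball on which
  the density is bounded; compactness leaves finitely many of them.\<close>

lemma finite_measure_vol: "finite_measure vol"
proof
  have "\<exists>U. open U \<and> x \<in> U \<and> emeasure vol U < \<infinity>" for x
  proof -
    define c where "c = chart_at \<A> x"
    have c: "c \<in> \<A>" "x \<in> fst c" using chart_at by (auto simp: c_def)
    obtain r where r: "r > 0" "cball (snd c x) r \<subseteq> chart_image c"
      using chart_open(2)[OF c(1)] c open_contains_cball by (metis chart_map_in)
    define U where "U = fst c \<inter> snd c -` ball (snd c x) r"
    have U: "open U" unfolding U_def
      by (intro continuous_open_preimage chart_continuous chart_open c open_ball)
    have "bounded ((\<lambda>y. sqrt (det (g c y))) ` cball (snd c x) r)"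
      by (intro compact_imp_bounded compact_continuous_image compact_cball
          continuous_on_subset[OF sqrt_det_continuous[OF c(1)] r(2)])
    then obtain C where C0: "\<forall>z\<in>(\<lambda>y. sqrt (det (g c y))) ` cball (snd c x) r. norm z \<le> C"
      unfolding bounded_iff by blast
    have C: "\<bar>sqrt (det (g c y))\<bar> \<le> C" if "y \<in> cball (snd c x) r" for y
      using bspec[OF C0 imageI[OF that]] by simp
    have "emeasure vol U = (\<integral>\<^sup>+ y. ennreal (sqrt (det (g c y))) * indicator (snd c ` U) y \<partial>lborel)"
      using c U by (intro emeasure_vol_chart) (auto simp: U_def)
    also have "\<dots> \<le> (\<integral>\<^sup>+ y. ennreal C * indicator (cball (snd c x) r) y \<partial>lborel)"
    proof (rule nn_integral_mono)
      fix y
      show "ennreal (sqrt (det (g c y))) * indicator (snd c ` U) y \<le> ennreal C * indicator (cball (snd c x) r) y"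
      proof (cases "y \<in> snd c ` U")
        case True
        then have "y \<in> cball (snd c x) r" by (auto simp: U_def)
        then show ?thesis using C[of y] True by (auto intro!: ennreal_leI)
      qed simp
    qed
    also have "\<dots> = ennreal C * emeasure lborel (cball (snd c x) r)"
      by (rule nn_integral_cmult_indicator) simp
    also have "\<dots> < \<infinity>"
      using emeasure_lborel_cball_finite[of "snd c x" r] by (simp add: ennreal_mult_less_top)
    finally show ?thesis using U c r by (intro exI[of _ U]) (auto simp: U_def)
  qed
  then obtain U where U: "\<And>x. open (U x)" "\<And>x. x \<in> U x" "\<And>x. emeasure vol (U x) < \<infinity>"
    by metis
  obtain I where I: "finite I" "UNIV \<subseteq> (\<Union>x\<in>I. U x)"
  proof (rule compactE_image[OF compact_M, of UNIV U])
    show "UNIV \<subseteq> (\<Union>x\<in>UNIV. U x)" using U(2) by blast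
  qed (use U(1) in auto)
  have "emeasure vol (space vol) = emeasure vol (\<Union>x\<in>I. U x)" using I by (simp add: top.extremum_unique)
  also have "\<dots> \<le> (\<Sum>x\<in>I. emeasure vol (U x))"
    using I U by (intro emeasure_subadditive_finite) (auto simp: sets_vol)
  also have "\<dots> < \<infinity>" using I U by (simp add: ennreal_sum_less_top)
  finally show "emeasure vol (space vol) \<noteq> \<infinity>" by simp
qed

lemma integrable_continuous:
  fixes f :: "'a \<Rightarrow> real"
  assumes "continuous_on UNIV f"
  shows "integrable vol f"
proof -
  interpret finite_measure vol by (rule finite_measure_vol)
  have "bounded (range f)"
    using compact_continuous_image[OF assms compact_M] compact_imp_bounded by blast
  then obtain C where "\<And>x. \<bar>f x\<bar> \<le> C" by (auto simp: bounded_iff)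
  then show ?thesis
    using borel_measurable_continuous_onI[OF assms]
    by (intro integrable_const_bound[of _ C]) (auto simp: sets_vol cong: measurable_cong_sets)
qed

text \<open>On a small closed coordinate ball inside \<open>V\<close> the continuous density attains
  a positive minimum.\<close>

lemma emeasure_vol_open_pos:
  assumes "open V" "x \<in> V"
  shows "emeasure vol V > 0"
proof -
  define c where "c = chart_at \<A> x"
  have c: "c \<in> \<A>" "x \<in> fst c" using chart_at by (auto simp: c_def)
  define W where "W = V \<inter> fst c"
  have W: "open W" "x \<in> W" "W \<subseteq> fst c" using assms c chart_open(1)[OF c(1)] by (auto simp: W_def)
  obtain r where r: "r > 0" "cball (snd c x) r \<subseteq> snd c ` W"
    using chart_image_open[OF c(1) W(1,3)] W(2) open_contains_cball by (metis imageI)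
  have im: "cball (snd c x) r \<subseteq> chart_image c" using r W by (auto simp: chart_image_def)
  have "\<exists>z\<in>cball (snd c x) r. \<forall>y\<in>cball (snd c x) r. sqrt (det (g c z)) \<le> sqrt (det (g c y))"
    using r by (intro continuous_attains_inf continuous_on_subset[OF sqrt_det_continuous[OF c(1)] im]) auto
  then obtain m where m: "m > 0" "\<And>y. y \<in> cball (snd c x) r \<Longrightarrow> m \<le> sqrt (det (g c y))"
    using det_metric_pos[OF c(1)] im by (metis real_sqrt_gt_zero subsetD)
  have "measure lborel (ball (snd c x) r) > 0" using r by simp
  then have "emeasure lborel (ball (snd c x) r) > 0" 
    unfolding zero_less_iff_neq_zero by (auto simp: measure_def)
  then have "0 < ennreal m * emeasure lborel (ball (snd c x) r)"
    using m by (simp add: ennreal_zero_less_mult_iff)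
  also have "\<dots> = (\<integral>\<^sup>+ y. ennreal m * indicator (ball (snd c x) r) y \<partial>lborel)"
    by (rule nn_integral_cmult_indicator[symmetric]) simp
  also have "\<dots> \<le> (\<integral>\<^sup>+ y. ennreal (sqrt (det (g c y))) * indicator (snd c ` W) y \<partial>lborel)"
  proof (rule nn_integral_mono)
    fix y
    show "ennreal m * indicator (ball (snd c x) r) y \<le> ennreal (sqrt (det (g c y))) * indicator (snd c ` W) y"
    proof (cases "y \<in> ball (snd c x) r")
      case True
      then have "y \<in> cball (snd c x) r" by auto
      then have "y \<in> snd c ` W" using r(2) by blast
      then show ?thesis using m(2)[OF \<open>y \<in> cball (snd c x) r\<close>] by (auto simp: indicator_def intro!: ennreal_leI)
    qed simp
  qed
  also have "\<dots> = emeasure vol W" using c W by (intro emeasure_vol_chart[symmetric]) auto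
  also have "\<dots> \<le> emeasure vol V"
    using assms by (intro emeasure_mono) (auto simp: W_def sets_vol)
  finally show ?thesis .
qed

text \<open>Serves both to show that the Laplacian does not depend on the chart and to pass from a
  vanishing norm of \<open>A\<close> to \<open>A = 0\<close> at every point.\<close>

lemma continuous_integral_0_eq_0:
  fixes f :: "'a \<Rightarrow> real"
  assumes f: "continuous_on UNIV f" and nonneg: "\<And>x. f x \<ge> 0" and int: "(\<integral>x. f x \<partial>vol) = 0"
  shows "f x = 0"
proof (rule ccontr)
  assume "f x \<noteq> 0"
  then have x: "x \<in> {x. f x > 0}" using nonneg[of x] by simp
  have o: "open {x. f x > 0}"
    using f by (auto intro: open_Collect_less continuous_intros)
  have "AE x in vol. f x = 0"
    using integral_nonneg_eq_0_iff_AE[OF integrable_continuous[OF f]] nonneg int by simp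
  then have "AE x in vol. \<not> f x > 0" by eventually_elim simp
  from emeasure_eq_0_AE[OF this] have "emeasure vol {x. f x > 0} = 0" by simp
  then show False using emeasure_vol_open_pos[OF o x] by simp
qed

lemma chart_supported_continuous:
  fixes f :: "'a \<Rightarrow> real"
  assumes c: "c \<in> \<A>" and K: "compact K" "K \<subseteq> fst c" "\<And>x. x \<notin> K \<Longrightarrow> f x = 0"
    and f: "continuous_on (chart_image c) (in_chart c f)"
  shows "continuous_on UNIV f"
proof -
  have "continuous_on (fst c) (\<lambda>x. in_chart c f (snd c x))"
    using c by (intro continuous_on_compose2[OF f] chart_continuous) auto
  then have "continuous_on (fst c) f"
    by (rule continuous_on_eq) (use c in \<open>auto simp: in_chart_def\<close>)
  moreover have "continuous_on (- K) f"
    by (rule continuous_on_eq[OF continuous_on_const[of _ 0]]) (use K in auto)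
  ultimately have "continuous_on (fst c \<union> - K) f"
    using c K by (intro continuous_on_open_Un chart_open) (auto simp: compact_imp_closed open_Compl)
  moreover have "fst c \<union> - K = UNIV" using K by auto
  ultimately show ?thesis by simp
qed

text \<open>On \<open>fst c\<close> this is the divergence of \<open>w \<nabla>v\<close>.\<close>

definition chart_div :: "('a, 'n) chart \<Rightarrow> ('a \<Rightarrow> real) \<Rightarrow> ('a \<Rightarrow> real) \<Rightarrow> 'a \<Rightarrow> real" where
  "chart_div c w v x = (if x \<in> fst c then w x * coord_laplacian (g c) (in_chart c v) (snd c x)
     + coord_inner (g c) (in_chart c w) (in_chart c v) (snd c x) else 0)"

text \<open>The complement of \<open>K\<close> is open, so \<open>w\<close> vanishes near
  \<open>x\<close>. The chart \<open>c\<close> may be any chart around \<open>x\<close>, not only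
  one containing \<open>K\<close>; \<open>green\<close> relies on this when \<open>chart_at\<close>
  selects another chart.\<close>

lemma partial_in_chart_off_support:
  assumes "c \<in> \<A>" "compact K" "\<And>x. x \<notin> K \<Longrightarrow> w x = 0" "C1M w" "x \<in> fst c" "x \<notin> K"
  shows "partial i (in_chart c w) (snd c x) = 0"
proof -
  have "open (snd c ` (fst c - K))"
    using assms compact_imp_closed chart_open by (intro chart_image_open open_Diff) auto
  then have "partial i (in_chart c w) (snd c x) = partial i (\<lambda>_. 0) (snd c x)"
  proof (rule partial_cong_open)
    show "snd c x \<in> snd c ` (fst c - K)" using assms by blast
    show "in_chart c w z = 0" if "z \<in> snd c ` (fst c - K)" for z
      using that assms(1,3) by (auto simp: in_chart_def)
    show "in_chart c w differentiable (at (snd c x))"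
      using assms(1,4,5) by (intro C1M_differentiable) auto
  qed
  then show ?thesis by simp
qed

lemma chart_div_off_support:
  assumes "c \<in> \<A>" "compact K" "\<And>x. x \<notin> K \<Longrightarrow> w x = 0" "C1M w" "x \<notin> K"
  shows "chart_div c w v x = 0"
  using assms partial_in_chart_off_support[OF assms(1-4) _ assms(5)]
  by (simp add: chart_div_def coord_inner_def)

text \<open>Green's identity for \<open>w\<close> supported in a single chart, before the coordinate
  Laplacian is known to be independent of the chart.\<close>

lemma chart_div:
  assumes c: "c \<in> \<A>" and K: "compact K" "K \<subseteq> fst c" "\<And>x. x \<notin> K \<Longrightarrow> w x = 0"
    and w: "C1M w" and v: "C2M v"
  shows "continuous_on UNIV (chart_div c w v)" "(\<integral>x. chart_div c w v x \<partial>vol) = 0"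
proof -
  note C = C1M_D[OF w c] C1M_D[OF C2M_D(1)[OF v] c] C2M_D(2)[OF v c]
  show cont: "continuous_on UNIV (chart_div c w v)"
  proof (rule chart_supported_continuous[OF c K(1,2)])
    show "chart_div c w v x = 0" if "x \<notin> K" for x
      using chart_div_off_support[OF c K(1) _ w that] K by blast
    have "continuous_on (chart_image c) (\<lambda>y. in_chart c w y * coord_laplacian (g c) (in_chart c v) y
        + coord_inner (g c) (in_chart c w) (in_chart c v) y)"
      by (intro continuous_intros C1_on_continuous C coord_laplacian_continuous coord_inner_continuous c)
    then show "continuous_on (chart_image c) (in_chart c (chart_div c w v))"
      by (rule continuous_on_eq) (auto simp: in_chart_def chart_div_def c)
  qed
  have "(\<integral>x. chart_div c w v x \<partial>vol) =
    (\<integral>y. indicat_real (chart_image c) y * (sqrt (det (g c y)) * chart_div c w v (chart_inv c y)) \<partial>lborel)"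
    by (intro integral_vol_chart c borel_measurable_continuous_onI cont) (auto simp: chart_div_def)
  also have "\<dots> = (\<integral>y. indicat_real (chart_image c) y * (sqrt (det (g c y)) *
      (in_chart c w y * coord_laplacian (g c) (in_chart c v) y
        + (\<Sum>i\<in>UNIV. \<Sum>j\<in>UNIV. matrix_inv (g c y) $ i $ j * partial i (in_chart c w) y * partial j (in_chart c v) y))) \<partial>lborel)"
    by (rule Bochner_Integration.integral_cong)
       (auto simp: indicator_def chart_div_def c in_chart_def coord_inner_def)
  also have "\<dots> = 0"
  proof (rule coordinate_green[OF metric_C1[OF c] chart_open(2)[OF c] metric_pos_def[OF c] C(3,1)])
    show "compact (snd c ` K)"
      by (intro compact_continuous_image K continuous_on_subset[OF chart_continuous(1)[OF c]])
    show "snd c ` K \<subseteq> chart_image c" using K by auto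
    show "in_chart c w y = 0" if "y \<in> chart_image c - snd c ` K" for y
    proof -
      have "chart_inv c y \<notin> K" using that chart_inv_right[OF c, of y] by (metis DiffE imageI)
      then show ?thesis using K(3) by (simp add: in_chart_def)
    qed
  qed
  finally show "(\<integral>x. chart_div c w v x \<partial>vol) = 0" .
qed

text \<open>Green's identity determines the Laplacian weakly, so the coordinate expressions in two
  charts, being continuous, agree; this avoids transforming Christoffel symbols.\<close>

lemma coord_laplacian_le:
  assumes c: "c \<in> \<A>" "d \<in> \<A>" and x: "x \<in> fst c" "x \<in> fst d" and v: "C2M v"
  shows "coord_laplacian (g c) (in_chart c v) (snd c x) \<le> coord_laplacian (g d) (in_chart d v) (snd d x)"
proof (rule ccontr)
  define h where "h z = coord_laplacian (g c) (in_chart c v) (snd c z) - coord_laplacian (g d) (in_chart d v) (snd d z)" for z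
  assume "\<not> ?thesis"
  then have "h x > 0" by (simp add: h_def)
  have cont: "continuous_on (fst e) (\<lambda>z. coord_laplacian (g e) (in_chart e v) (snd e z))" if e: "e \<in> \<A>" for e
    by (rule continuous_on_compose2[OF coord_laplacian_continuous[OF e C1M_D[OF C2M_D(1)[OF v] e] C2M_D(2)[OF v e]]
          chart_continuous(1)[OF e]]) auto
  define U where "U = fst c \<inter> fst d"
  have U: "open U" "x \<in> U" using c x by (auto simp: U_def intro!: open_Int chart_open(1))
  have "continuous_on U h" unfolding h_def U_def
    by (intro continuous_on_diff continuous_on_subset[OF cont[OF c(1)]] continuous_on_subset[OF cont[OF c(2)]]) auto
  then have "open (U \<inter> h -` {0<..})" using U by (intro continuous_open_preimage) auto
  moreover have "x \<in> U \<inter> h -` {0<..}" using U \<open>h x > 0\<close> by simp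
  ultimately obtain b K where b: "compact K" "K \<subseteq> U \<inter> h -` {0<..}" "C1M b" "\<And>z. b z \<ge> 0" "b x > 0" "\<And>z. z \<notin> K \<Longrightarrow> b z = 0"
    using bump_function by metis
  have Kc: "K \<subseteq> fst c" "K \<subseteq> fst d" using b(2) by (auto simp: U_def)
  note dc = chart_div[OF c(1) b(1) Kc(1) b(6,3) v] and dd = chart_div[OF c(2) b(1) Kc(2) b(6,3) v]
  \<comment> \<open>The gradient terms of the two divergences agree, so their difference is
    \<open>b * h\<close>. It is nonnegative with integral zero, yet positive at
    \<open>x\<close>.\<close>
  define f where "f z = chart_div c b v z - chart_div d b v z" for z
  have f: "f z = (if z \<in> K then b z * h z else 0)" for z
  proof (cases "z \<in> K")
    case True
    then have z: "z \<in> fst c" "z \<in> fst d" using Kc by auto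
    have "coord_inner (g c) (in_chart c b) (in_chart c v) (snd c z) = coord_inner (g d) (in_chart d b) (in_chart d v) (snd d z)"
      using b(3) C2M_D(1)[OF v] c z by (intro coord_inner_chart_independent C1M_differentiable) auto
    then show ?thesis using True z by (simp add: f_def chart_div_def h_def algebra_simps)
  next
    case False
    then show ?thesis
      using chart_div_off_support[OF c(1) b(1,6,3) False, where v = v] chart_div_off_support[OF c(2) b(1,6,3) False, where v = v]
      by (simp add: f_def)
  qed
  have "f x = 0"
  proof (rule continuous_integral_0_eq_0)
    show "continuous_on UNIV f" unfolding f_def by (intro continuous_on_diff dc dd)
    show "f z \<ge> 0" for z using b(2,4) by (auto simp: f)
    show "(\<integral>z. f z \<partial>vol) = 0"
      unfolding f_def using dc dd by (simp add: integrable_continuous)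
  qed
  moreover have "x \<in> K" using b(5) b(6)[of x] by force
  ultimately show False using b(5) \<open>h x > 0\<close> by (simp add: f)
qed

text \<open>The inequality between two charts is an equality because their roles can be
  exchanged.\<close>

lemma laplacian_in_chart:
  assumes v: "C2M v" and c: "c \<in> \<A>" "x \<in> fst c"
  shows "laplacian \<A> g v x = coord_laplacian (g c) (in_chart c v) (snd c x)"
  unfolding laplacian_def Let_def
  using coord_laplacian_le[OF c(1) chart_at(1) c(2) chart_at(2) v]
    coord_laplacian_le[OF chart_at(1) c(1) chart_at(2) c(2) v] by (rule order_antisym[rotated])

lemma laplacian_continuous:
  assumes v: "C2M v"
  shows "continuous_on UNIV (laplacian \<A> g v)"
proof (rule continuous_on_manifold)
  fix c assume c: "c \<in> \<A>"
  show "continuous_on (chart_image c) (in_chart c (laplacian \<A> g v))"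
    by (rule continuous_on_eq[OF coord_laplacian_continuous[OF c C1M_D[OF C2M_D(1)[OF v] c] C2M_D(2)[OF v c]]])
       (simp add: in_chart_def[of c "laplacian \<A> g v"] laplacian_in_chart[OF v c chart_inv_in[OF c]] c)
qed

lemma grad_inner_sum_left:
  assumes "finite I" "\<And>i. i \<in> I \<Longrightarrow> C1M (u i)"
  shows "grad_inner \<A> g (\<lambda>x. \<Sum>i\<in>I. u i x) v x = (\<Sum>i\<in>I. grad_inner \<A> g (u i) v x)"
proof -
  let ?c = "chart_at \<A> x"
  have "partial k (in_chart ?c (\<lambda>x. \<Sum>i\<in>I. u i x)) (snd ?c x) = (\<Sum>i\<in>I. partial k (in_chart ?c (u i)) (snd ?c x))" for k
  proof -
    have "in_chart ?c (\<lambda>x. \<Sum>i\<in>I. u i x) = (\<lambda>y. \<Sum>i\<in>I. in_chart ?c (u i) y)"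
      by (simp add: in_chart_def)
    then show ?thesis
      using assms(2) chart_at by (simp only:) (intro partial_sum C1M_differentiable; auto)
  qed
  moreover have "(\<Sum>k\<in>UNIV. \<Sum>l\<in>UNIV. \<Sum>i\<in>I. t k l i) = (\<Sum>i\<in>I. \<Sum>k\<in>UNIV. \<Sum>l\<in>UNIV. t k l i)" for t :: "'n \<Rightarrow> 'n \<Rightarrow> 'b \<Rightarrow> real"
    by (simp add: sum.swap[of _ _ I])
  ultimately show ?thesis
    by (simp add: grad_inner_def Let_def coord_inner_def sum_distrib_left sum_distrib_right)
qed

text \<open>A partition of unity cuts \<open>u\<close> into pieces \<open>w x\<close>, each
  supported in one chart, where the integral of the divergence is zero.\<close>

theorem green:
  assumes u: "C1M u" and v: "C2M v"
  shows "(\<integral>x. u x * laplacian \<A> g v x \<partial>vol) = - (\<integral>x. grad_inner \<A> g u v x \<partial>vol)"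
proof -
  have "\<exists>b K c. c \<in> \<A> \<and> compact K \<and> K \<subseteq> fst c \<and> C1M b \<and> (\<forall>z. b z \<ge> 0) \<and> b x > 0 \<and> (\<forall>z. z \<notin> K \<longrightarrow> b z = 0)" for x
    using bump_function[OF chart_open(1)[OF chart_at(1)] chart_at(2)] chart_at(1) by metis
  then obtain b K c where b: "\<And>x. c x \<in> \<A>" "\<And>x. compact (K x)" "\<And>x. K x \<subseteq> fst (c x)"
    "\<And>x. C1M (b x)" "\<And>x z. b x z \<ge> 0" "\<And>x. b x x > 0" "\<And>x z. z \<notin> K x \<Longrightarrow> b x z = 0"
    by metis
  have "open {z. b x z > 0}" for x
    using C1M_continuous[OF b(4)] by (intro open_Collect_less continuous_intros)
  then obtain I where I: "finite I" "UNIV \<subseteq> (\<Union>x\<in>I. {z. b x z > 0})"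
  proof (rule compactE_image[OF compact_M, of UNIV "\<lambda>x. {z. b x z > 0}"])
    show "UNIV \<subseteq> (\<Union>x\<in>UNIV. {z. b x z > 0})" using b(6) by blast
  qed auto
  define B where "B z = (\<Sum>x\<in>I. b x z)" for z
  have Bpos: "B z > 0" for z
  proof -
    obtain x where "x \<in> I" "b x z > 0" using I by blast
    then show ?thesis unfolding B_def using I b(5) by (intro sum_pos2) auto
  qed
  \<comment> \<open>Dividing by the positive sum \<open>B\<close> turns the finitely many bump
    functions into a partition of unity.\<close>
  define w where "w x z = b x z * (u z * inverse (B z))" for x z
  have wC1: "C1M (w x)" for x
    unfolding w_def B_def
    using b(4) I Bpos[unfolded B_def] by (intro C1M_mult C1M_inverse C1M_sum u) (auto simp: less_le)
  have w0: "w x z = 0" if "z \<notin> K x" for x z using b(7)[OF that] by (simp add: w_def)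
  have usum: "u = (\<lambda>z. \<Sum>x\<in>I. w x z)"
  proof
    fix z
    have "(\<Sum>x\<in>I. w x z) = B z * (u z * inverse (B z))" by (simp add: w_def B_def sum_distrib_right)
    then show "u z = (\<Sum>x\<in>I. w x z)" using Bpos[of z] by simp
  qed
  \<comment> \<open>The identity holds at every point of M: outside the chart \<open>c x\<close> the
    function \<open>w x\<close> vanishes nearby, and \<open>chart_div\<close> has default value
    \<open>0\<close> there.\<close>
  have div: "w x z * laplacian \<A> g v z + grad_inner \<A> g (w x) v z = chart_div (c x) (w x) v z" for x z
  proof (cases "z \<in> fst (c x)")
    case True
    then show ?thesis
      by (simp add: chart_div_def laplacian_in_chart[OF v b(1) True]
          grad_inner_in_chart[OF wC1 C2M_D(1)[OF v] b(1) True])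
  next
    case False
    then have "z \<notin> K x" using b(3) by blast
    then have "grad_inner \<A> g (w x) v z = 0"
      unfolding grad_inner_def Let_def coord_inner_def
      using partial_in_chart_off_support[OF chart_at(1) b(2) w0 wC1 chart_at(2)] by simp
    then show ?thesis using False w0[OF \<open>z \<notin> K x\<close>] by (simp add: chart_div_def)
  qed
  have cu: "continuous_on UNIV (\<lambda>x. u x * laplacian \<A> g v x)"
    by (intro continuous_on_mult C1M_continuous u laplacian_continuous v)
  have "(\<integral>z. u z * laplacian \<A> g v z \<partial>vol) + (\<integral>z. grad_inner \<A> g u v z \<partial>vol)
      = (\<integral>z. u z * laplacian \<A> g v z + grad_inner \<A> g u v z \<partial>vol)"
    by (rule Bochner_Integration.integral_add[symmetric])
       (intro integrable_continuous cu grad_inner_continuous u C2M_D(1)[OF v])+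
  also have "\<dots> = (\<integral>z. (\<Sum>x\<in>I. chart_div (c x) (w x) v z) \<partial>vol)"
    unfolding div[symmetric] sum.distrib
    by (subst (1 2) usum) (simp add: grad_inner_sum_left I wC1 sum_distrib_right)
  also have "\<dots> = 0"
    using chart_div[OF b(1-3) w0 wC1 v] by (simp add: integrable_continuous)
  finally show ?thesis by simp
qed

end

section \<open>Functions on spacetime\<close>

context
  fixes S :: "(real ^ 'n::finite) set" and P :: "real \<times> (real ^ 'n) \<Rightarrow> real"
  assumes S: "open S" and P: "smooth_on ({0<..} \<times> S) P"
begin

lemma spacetime_open: "open ({0::real<..} \<times> S)"
  using S by (simp add: open_Times)

lemma spacetime_has_time_derivative:
  assumes "t > 0" "y \<in> S"
  shows "((\<lambda>s. P (s, y)) has_real_derivative frechet_derivative P (at (t, y)) (1, 0)) (at t)"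
  using has_derivative_along_line[of P "(0, y)" t "(1, 0)"] smooth_on_differentiable[OF P, of "(t, y)"] assms
  by simp

lemma spacetime_partial:
  assumes "t > 0" "y \<in> S"
  shows "partial i (\<lambda>y. P (t, y)) y = frechet_derivative P (at (t, y)) (0, axis i 1)"
  unfolding partial_def using smooth_on_slice(2)[OF S open_greaterThan _ P] assms by simp

lemma spacetime_time_partial_commute:
  assumes "t > 0" "y \<in> S"
  shows "frechet_derivative (\<lambda>z. frechet_derivative P (at z) u) (at (t, y)) v =
    frechet_derivative (\<lambda>z. frechet_derivative P (at z) v) (at (t, y)) u"
proof (rule mixed_derivatives_commute[OF spacetime_open])
  show "Ck_on 2 ({0<..} \<times> S) P" using P by (simp add: smooth_on_def)
qed (use assms in simp)

end

text \<open>Both sides are second derivatives of \<open>P\<close> on spacetime in the directions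
  \<open>(1, 0)\<close> and \<open>(0, axis i 1)\<close>, which commute.\<close>

lemma spacetime_partial_has_time_derivative:
  fixes S :: "(real ^ 'n::finite) set"
  assumes S: "open S" and P: "smooth_on ({0<..} \<times> S) P" and t: "t > 0" "y \<in> S"
  shows "((\<lambda>s. partial i (\<lambda>y. P (s, y)) y) has_real_derivative
    partial i (\<lambda>y. frechet_derivative P (at (t, y)) (1, 0)) y) (at t)"
proof -
  have "((\<lambda>s. frechet_derivative P (at (s, y)) (0, axis i 1)) has_real_derivative
      frechet_derivative (\<lambda>z. frechet_derivative P (at z) (0, axis i 1)) (at (t, y)) (1, 0)) (at t)"
    using spacetime_has_time_derivative[OF S smooth_on_frechet[OF P] t] .
  moreover have "frechet_derivative (\<lambda>z. frechet_derivative P (at z) (0, axis i 1)) (at (t, y)) (1, 0)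
      = partial i (\<lambda>y. frechet_derivative P (at (t, y)) (1, 0)) y"
    using spacetime_time_partial_commute[OF S P t] spacetime_partial[OF S smooth_on_frechet[OF P] t] by simp
  ultimately show ?thesis
    using has_field_derivative_transform_within_open[of "\<lambda>s. frechet_derivative P (at (s, y)) (0, axis i 1)"
        _ t "{0<..}" "\<lambda>s. partial i (\<lambda>y. P (s, y)) y"]
      spacetime_partial[OF S P _ t(2)] t by simp
qed

text \<open>Apply the first-order version to the spatial derivative \<open>?Q\<close> of
  \<open>P\<close>, then commute time with the remaining spatial derivative.\<close>

lemma spacetime_partial2_has_time_derivative:
  fixes S :: "(real ^ 'n::finite) set"
  assumes S: "open S" and P: "smooth_on ({0<..} \<times> S) P" and t: "t > 0" "y \<in> S"
  shows "((\<lambda>s. partial i (partial j (\<lambda>y. P (s, y))) y) has_real_derivative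
    partial i (partial j (\<lambda>y. frechet_derivative P (at (t, y)) (1, 0))) y) (at t)"
proof -
  let ?Q = "\<lambda>z. frechet_derivative P (at z) (0, axis j 1)"
  \<comment> \<open>Stated for a general \<open>R\<close> because it is needed for \<open>P\<close>
    and for its time derivative.\<close>
  have *: "partial i (partial j (\<lambda>y. R (s, y))) y = partial i (\<lambda>y. frechet_derivative R (at (s, y)) (0, axis j 1)) y"
    if R: "smooth_on ({0<..} \<times> S) R" and "s > 0"
    for R :: "real \<times> (real ^ 'n) \<Rightarrow> real" and s
  proof (rule partial_cong_open[OF S t(2)])
    show "partial j (\<lambda>y. R (s, y)) z = frechet_derivative R (at (s, z)) (0, axis j 1)" if "z \<in> S" for z
      using spacetime_partial[OF S R \<open>s > 0\<close> that] .
    show "partial j (\<lambda>y. R (s, y)) differentiable (at y)"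
      using smooth_on_slice(1)[OF S open_greaterThan _ R] that t
      by (intro smooth_on_differentiable[OF smooth_on_partial]) auto
  qed
  have "((\<lambda>s. partial i (\<lambda>y. ?Q (s, y)) y) has_real_derivative
      partial i (\<lambda>y. frechet_derivative ?Q (at (t, y)) (1, 0)) y) (at t)"
    using spacetime_partial_has_time_derivative[OF S smooth_on_frechet[OF P] t] .
  moreover have "partial i (\<lambda>y. frechet_derivative ?Q (at (t, y)) (1, 0)) y
      = partial i (partial j (\<lambda>y. frechet_derivative P (at (t, y)) (1, 0))) y"
    unfolding *[OF smooth_on_frechet[OF P] t(1)]
  proof (rule partial_cong_open[OF S t(2)])
    show "frechet_derivative ?Q (at (t, z)) (1, 0) =
        frechet_derivative (\<lambda>z. frechet_derivative P (at z) (1, 0)) (at (t, z)) (0, axis j 1)" if "z \<in> S" for z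
      using spacetime_time_partial_commute[OF S P t(1) that] .
    show "(\<lambda>y. frechet_derivative ?Q (at (t, y)) (1, 0)) differentiable (at y)"
      using smooth_on_slice(1)[OF S open_greaterThan _ smooth_on_frechet[OF smooth_on_frechet[OF P]]] t
      by (intro smooth_on_differentiable) auto
  qed
  ultimately show ?thesis
    using has_field_derivative_transform_within_open[of "\<lambda>s. partial i (\<lambda>y. ?Q (s, y)) y"
        _ t "{0<..}" "\<lambda>s. partial i (partial j (\<lambda>y. P (s, y))) y"] *[OF P] t by simp
qed

text \<open>The common source of the Cauchy-Schwarz inequalities for functions and for
  gradients.\<close>

lemma quadratic_nonneg_discriminant:
  fixes a b c :: real
  assumes "\<And>s. a + 2 * s * b + s\<^sup>2 * c \<ge> 0"
  shows "b\<^sup>2 \<le> a * c"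
proof (cases "c = 0")
  case True
  have "b = 0"
  proof (rule ccontr)
    assume "b \<noteq> 0"
    \<comment> \<open>At this \<open>s\<close> the polynomial, now affine, takes the value
      \<open>-1\<close>.\<close>
    then show False using assms[of "- (a + 1) / (2 * b)"] True by (simp add: field_simps)
  qed
  then show ?thesis using True by simp
next
  case False
  have "c > 0"
  proof (rule ccontr)
    assume "\<not> c > 0"
    then have c: "c < 0" using False by simp
    \<comment> \<open>Chosen with \<open>s \<ge> 1\<close> and \<open>- c * s\<close> at least
      \<open>\<bar>a\<bar> + 2 * \<bar>b\<bar> + 1\<close>, so that the quadratic term dominates and
      the polynomial is at most \<open>- s\<close>.\<close>
    define s where "s = (\<bar>a\<bar> + 2 * \<bar>b\<bar> + 1) / (- c) + 1"
    have s: "s \<ge> 1" using c divide_nonneg_pos[of "\<bar>a\<bar> + 2 * \<bar>b\<bar> + 1" "- c"] unfolding s_def by simp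
    have "- c * s \<ge> \<bar>a\<bar> + 2 * \<bar>b\<bar> + 1" using c unfolding s_def by (simp add: field_simps)
    then have "s * (\<bar>a\<bar> + 2 * \<bar>b\<bar> + 1) \<le> s * (- c * s)" using s by (intro mult_left_mono) auto
    then have "s\<^sup>2 * c \<le> - s * (\<bar>a\<bar> + 2 * \<bar>b\<bar> + 1)" by (simp add: power2_eq_square algebra_simps)
    moreover have "a \<le> s * \<bar>a\<bar>" using s mult_right_mono[of 1 s "\<bar>a\<bar>"] by simp
    moreover have "2 * s * b \<le> s * (2 * \<bar>b\<bar>)" using s by simp
    ultimately have "a + 2 * s * b + s\<^sup>2 * c \<le> - s" by (simp add: algebra_simps)
    then show False using assms[of s] s by simp
  qed
  \<comment> \<open>The vertex of the parabola.\<close>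
  then show ?thesis using assms[of "- b / c"]
    by (simp add: field_simps power2_eq_square)
qed

context closed_riemannian begin

lemma smooth_spacetimeD:
  "smooth_on_spacetime \<A> \<psi> \<Longrightarrow> c \<in> \<A> \<Longrightarrow> smooth_on ({0<..} \<times> chart_image c) (\<lambda>(t, y). \<psi> t (chart_inv c y))"
  by (simp add: smooth_on_spacetime_def)

lemma time_deriv_chart:
  assumes \<psi>: "smooth_on_spacetime \<A> \<psi>" and c: "c \<in> \<A>" and t: "t > 0" "y \<in> chart_image c"
  shows "((\<lambda>s. \<psi> s (chart_inv c y)) has_real_derivative
      frechet_derivative (\<lambda>(t, y). \<psi> t (chart_inv c y)) (at (t, y)) (1, 0)) (at t)"
    and "time_deriv \<psi> t (chart_inv c y) = frechet_derivative (\<lambda>(t, y). \<psi> t (chart_inv c y)) (at (t, y)) (1, 0)"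
proof -
  show *: "((\<lambda>s. \<psi> s (chart_inv c y)) has_real_derivative
      frechet_derivative (\<lambda>(t, y). \<psi> t (chart_inv c y)) (at (t, y)) (1, 0)) (at t)"
    using spacetime_has_time_derivative[OF chart_open(2)[OF c] smooth_spacetimeD[OF \<psi> c] t] by simp
  show "time_deriv \<psi> t (chart_inv c y) = frechet_derivative (\<lambda>(t, y). \<psi> t (chart_inv c y)) (at (t, y)) (1, 0)"
    unfolding time_deriv_def by (rule DERIV_imp_deriv[OF *])
qed

lemma has_time_deriv:
  assumes \<psi>: "smooth_on_spacetime \<A> \<psi>" and t: "t > 0"
  shows "((\<lambda>s. \<psi> s x) has_real_derivative time_deriv \<psi> t x) (at t)"
  using time_deriv_chart[OF \<psi> chart_at(1) t, of "snd (chart_at \<A> x) x" x] chart_at by simp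

lemma smooth_time_deriv:
  assumes \<psi>: "smooth_on_spacetime \<A> \<psi>"
  shows "smooth_on_spacetime \<A> (time_deriv \<psi>)"
  unfolding smooth_on_spacetime_def
proof
  fix c assume c: "c \<in> \<A>"
  show "smooth_on ({0<..} \<times> chart_image c) (\<lambda>(t, y). time_deriv \<psi> t (chart_inv c y))"
    by (rule smooth_on_cong[OF _ _ smooth_on_frechet[OF smooth_spacetimeD[OF \<psi> c], where v = "(1, 0)"]])
       (auto simp: time_deriv_chart(2)[OF \<psi> c] intro!: open_Times chart_open c)
qed

lemma smooth_spacetime_slice:
  assumes \<psi>: "smooth_on_spacetime \<A> \<psi>" and t: "t > 0"
  shows "C2M (\<psi> t)"
proof (rule smooth_function_C2M, unfold smooth_function_def, rule)
  fix c assume c: "c \<in> \<A>"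
  show "smooth_on (chart_image c) (in_chart c (\<psi> t))"
    using smooth_on_slice(1)[OF chart_open(2)[OF c] open_greaterThan _ smooth_spacetimeD[OF \<psi> c], of t] t
    by (simp add: in_chart_def)
qed

lemma smooth_spacetime_partial:
  assumes \<psi>: "smooth_on_spacetime \<A> \<psi>" and c: "c \<in> \<A>"
  shows "continuous_on ({0<..} \<times> chart_image c) (\<lambda>(t, y). partial i (in_chart c (\<psi> t)) y)"
proof (rule continuous_on_eq[OF smooth_on_continuous[OF smooth_on_frechet[OF smooth_spacetimeD[OF \<psi> c], of "(0, axis i 1)"]]])
  fix z :: "real \<times> (real ^ 'n)" assume "z \<in> {0<..} \<times> chart_image c"
  then show "frechet_derivative (\<lambda>(t, y). \<psi> t (chart_inv c y)) (at z) (0, axis i 1) =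
      (case z of (t, y) \<Rightarrow> partial i (in_chart c (\<psi> t)) y)"
    using spacetime_partial[OF chart_open(2)[OF c] smooth_spacetimeD[OF \<psi> c], of "fst z" "snd z" i]
    by (auto simp: in_chart_def[abs_def])
qed

lemma in_chart_time_deriv_partials:
  assumes \<psi>: "smooth_on_spacetime \<A> \<psi>" and c: "c \<in> \<A>" and t: "t > 0" "y \<in> chart_image c"
  shows "((\<lambda>s. partial i (in_chart c (\<psi> s)) y) has_real_derivative partial i (in_chart c (time_deriv \<psi> t)) y) (at t)"
    and "((\<lambda>s. partial i (partial j (in_chart c (\<psi> s))) y) has_real_derivative
      partial i (partial j (in_chart c (time_deriv \<psi> t))) y) (at t)"
proof -
  let ?P = "\<lambda>(t, y). \<psi> t (chart_inv c y)"
  let ?D = "\<lambda>y. frechet_derivative ?P (at (t, y)) (1, 0)"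
  note S = chart_open(2)[OF c] and P = smooth_spacetimeD[OF \<psi> c]
  have D: "smooth_on (chart_image c) ?D"
    using smooth_on_slice(1)[OF S open_greaterThan _ smooth_on_frechet[OF P]] t by simp
  have eq: "?D z = in_chart c (time_deriv \<psi> t) z" if "z \<in> chart_image c" for z
    using time_deriv_chart(2)[OF \<psi> c t(1) that] by (simp add: in_chart_def)
  have p1: "partial j ?D z = partial j (in_chart c (time_deriv \<psi> t)) z" if "z \<in> chart_image c" for j z
    using partial_cong_open[OF S that eq smooth_on_differentiable[OF D that]] .
  have p2: "partial i (partial j ?D) y = partial i (partial j (in_chart c (time_deriv \<psi> t))) y"
    using partial_cong_open[OF S t(2) p1 smooth_on_differentiable[OF smooth_on_partial[OF D] t(2)]] .
  show "((\<lambda>s. partial i (in_chart c (\<psi> s)) y) has_real_derivative partial i (in_chart c (time_deriv \<psi> t)) y) (at t)"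
    using spacetime_partial_has_time_derivative[OF S P t, of i] p1[OF t(2)] by (simp add: in_chart_def[abs_def])
  show "((\<lambda>s. partial i (partial j (in_chart c (\<psi> s))) y) has_real_derivative
      partial i (partial j (in_chart c (time_deriv \<psi> t))) y) (at t)"
    using spacetime_partial2_has_time_derivative[OF S P t, of i j] p2 by (simp add: in_chart_def[abs_def])
qed

text \<open>The coefficients of the Laplacian do not depend on time, so only coordinate derivatives
  have to be commuted. This identifies the right-hand side of the first hypothesis with the
  Laplacian of the test function \<open>h\<close>.\<close>

lemma time_deriv_laplacian:
  assumes \<psi>: "smooth_on_spacetime \<A> \<psi>" and t: "t > 0"
  shows "time_deriv (\<lambda>t. laplacian \<A> g (\<psi> t)) t x = laplacian \<A> g (time_deriv \<psi> t) x"
proof -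
  let ?c = "chart_at \<A> x"
  have y: "snd ?c x \<in> chart_image ?c" using chart_at by simp
  note d = in_chart_time_deriv_partials[OF \<psi> chart_at(1) t y]
  have "((\<lambda>s. laplacian \<A> g (\<psi> s) x) has_real_derivative laplacian \<A> g (time_deriv \<psi> t) x) (at t)"
    unfolding laplacian_def Let_def coord_laplacian_def covariant_hessian_def
    by (intro DERIV_sum DERIV_cmult DERIV_diff d)
  then show ?thesis unfolding time_deriv_def by (rule DERIV_imp_deriv)
qed

lemma grad_inner_commute: "grad_inner \<A> g u v x = grad_inner \<A> g v u x"
proof -
  have "matrix_inv (g (chart_at \<A> x) (snd (chart_at \<A> x) x)) $ i $ j =
      matrix_inv (g (chart_at \<A> x) (snd (chart_at \<A> x) x)) $ j $ i" for i j
    using chart_at by (intro symmetric_matrix_inv_entry metric_pos_def) auto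
  then show ?thesis
    unfolding grad_inner_def Let_def coord_inner_def
    by (subst sum.swap) (simp add: mult.commute mult.left_commute)
qed

lemma grad_norm_has_time_derivative:
  assumes \<psi>: "smooth_on_spacetime \<A> \<psi>" and t: "t > 0"
  shows "((\<lambda>s. grad_inner \<A> g (\<psi> s) (\<psi> s) x) has_real_derivative
    2 * grad_inner \<A> g (\<psi> t) (time_deriv \<psi> t) x) (at t)"
proof -
  let ?c = "chart_at \<A> x"
  have y: "snd ?c x \<in> chart_image ?c" using chart_at by simp
  note d = in_chart_time_deriv_partials(1)[OF \<psi> chart_at(1) t y]
  have "((\<lambda>s. grad_inner \<A> g (\<psi> s) (\<psi> s) x) has_real_derivative
      grad_inner \<A> g (time_deriv \<psi> t) (\<psi> t) x + grad_inner \<A> g (\<psi> t) (time_deriv \<psi> t) x) (at t)"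
    unfolding grad_inner_def Let_def coord_inner_def sum.distrib[symmetric]
    by (rule DERIV_cong[OF DERIV_sum[OF DERIV_sum[OF DERIV_mult[OF DERIV_cmult[OF d] d]]]])
       (simp add: algebra_simps)
  then show ?thesis by (simp add: grad_inner_commute[of "time_deriv \<psi> t"])
qed

lemma smooth_spacetime_continuous:
  assumes "smooth_on_spacetime \<A> \<psi>"
  shows "continuous_on ({0<..} \<times> UNIV) (\<lambda>(t, x). \<psi> t x)"
  by (rule continuous_on_spacetime[OF open_greaterThan smooth_on_continuous[OF smooth_spacetimeD[OF assms]]])

lemma grad_inner_spacetime_continuous:
  assumes \<psi>: "smooth_on_spacetime \<A> \<psi>" and \<phi>: "smooth_on_spacetime \<A> \<phi>"
  shows "continuous_on ({0<..} \<times> UNIV) (\<lambda>(t, x). grad_inner \<A> g (\<psi> t) (\<phi> t) x)"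
proof (rule continuous_on_spacetime[OF open_greaterThan])
  fix c assume c: "c \<in> \<A>"
  let ?W = "{0::real<..} \<times> chart_image c"
  have B: "continuous_on ?W (\<lambda>z. matrix_inv (g c (snd z)) $ i $ j)" for i j
    by (rule continuous_on_compose2[OF C1_on_continuous[OF metric_inv_C1[OF c]]]) (auto intro: continuous_intros)
  have "continuous_on ?W (\<lambda>z. \<Sum>i\<in>UNIV. \<Sum>j\<in>UNIV. matrix_inv (g c (snd z)) $ i $ j *
      (case z of (t, y) \<Rightarrow> partial i (in_chart c (\<psi> t)) y) * (case z of (t, y) \<Rightarrow> partial j (in_chart c (\<phi> t)) y))"
    by (intro continuous_on_sum continuous_on_mult B smooth_spacetime_partial \<psi> \<phi> c)
  then show "continuous_on ?W (\<lambda>(t, y). grad_inner \<A> g (\<psi> t) (\<phi> t) (chart_inv c y))"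
  proof (rule continuous_on_eq)
    fix z :: "real \<times> (real ^ 'n)" assume "z \<in> ?W"
    then have z: "fst z > 0" "snd z \<in> chart_image c" by auto
    show "(\<Sum>i\<in>UNIV. \<Sum>j\<in>UNIV. matrix_inv (g c (snd z)) $ i $ j *
      (case z of (t, y) \<Rightarrow> partial i (in_chart c (\<psi> t)) y) * (case z of (t, y) \<Rightarrow> partial j (in_chart c (\<phi> t)) y))
      = (case z of (t, y) \<Rightarrow> grad_inner \<A> g (\<psi> t) (\<phi> t) (chart_inv c y))"
      using grad_inner_in_chart[OF C2M_D(1)[OF smooth_spacetime_slice[OF \<psi> z(1)]]
          C2M_D(1)[OF smooth_spacetime_slice[OF \<phi> z(1)]] c chart_inv_in[OF c z(2)]] c z
      by (simp add: split_def coord_inner_def)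
  qed
qed

lemma integral_has_time_derivative:
  assumes F: "continuous_on ({0<..} \<times> UNIV) (\<lambda>(t, x). F t x)"
    and F': "continuous_on ({0<..} \<times> UNIV) (\<lambda>(t, x). F' t x)"
    and der: "\<And>t x. t > 0 \<Longrightarrow> ((\<lambda>s. F s x) has_real_derivative F' t x) (at t)" and t: "t > 0"
  shows "((\<lambda>t. \<integral>x. F t x \<partial>vol) has_real_derivative (\<integral>x. F' t x \<partial>vol)) (at t)"
proof -
  have slice: "continuous_on UNIV (H s)"
    if "continuous_on ({0<..} \<times> UNIV) (\<lambda>(t, x). H t x)" "s > 0" for H :: "real \<Rightarrow> 'a \<Rightarrow> real" and s
  proof -
    have "continuous_on UNIV (\<lambda>x. (\<lambda>(t, x). H t x) (s, x))"
      by (rule continuous_on_compose2[OF that(1)]) (use that(2) in \<open>auto intro!: continuous_intros\<close>)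
    then show ?thesis by simp
  qed
  \<comment> \<open>On this compact slab \<open>F'\<close> is bounded by a constant, which is
    integrable because M has finite volume.\<close>
  have "compact ({t/2..3*t/2} \<times> (UNIV :: 'a set))" by (intro compact_Times compact_M) simp
  then have "compact ((\<lambda>(t, x). F' t x) ` ({t/2..3*t/2} \<times> UNIV))"
    using t by (intro compact_continuous_image continuous_on_subset[OF F']) auto
  from compact_imp_bounded[OF this]
  obtain C where C: "\<forall>z\<in>(\<lambda>(t, x). F' t x) ` ({t/2..3*t/2} \<times> UNIV). norm z \<le> C"
    unfolding bounded_iff by blast
  show ?thesis
  proof (rule has_real_derivative_integral[where e = "t / 2" and b = "\<lambda>_. C"])
    fix s assume s: "\<bar>s - t\<bar> < t / 2"
    then have "s > 0" "s \<in> {t/2..3*t/2}" using t unfolding abs_less_iff atLeastAtMost_iff by argo+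
    then show "integrable vol (F s)" using slice[OF F] by (intro integrable_continuous)
    fix x
    show "((\<lambda>s. F s x) has_real_derivative F' s x) (at s)" using der \<open>s > 0\<close> .
    have "F' s x \<in> (\<lambda>(t, x). F' t x) ` ({t/2..3*t/2} \<times> UNIV)"
      using \<open>s \<in> {t/2..3*t/2}\<close> by (intro image_eqI[of _ _ "(s, x)"]) auto
    from bspec[OF C this] show "\<bar>F' s x\<bar> \<le> C" by simp
  next
    show "integrable vol (\<lambda>_. C)" by (intro integrable_continuous continuous_intros)
    show "F' t \<in> borel_measurable vol"
      using integrable_continuous[OF slice[OF F' t]] by simp
  qed (use t in simp)
qed

lemma grad_inner_nonneg: "grad_inner \<A> g u u x \<ge> 0"
proof -
  let ?c = "chart_at \<A> x"
  have "pos_def (matrix_inv (g ?c (snd ?c x)))"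
    using chart_at by (intro pos_def_matrix_inv metric_pos_def) auto
  then have "v \<bullet> (matrix_inv (g ?c (snd ?c x)) *v v) \<ge> 0" for v
    unfolding pos_def_def by (cases "v = 0") (auto simp: less_imp_le)
  then show ?thesis by (simp add: grad_inner_def Let_def coord_inner_vec)
qed

lemma grad_inner_quadratic:
  "grad_inner \<A> g u u x + 2 * s * grad_inner \<A> g u v x + s\<^sup>2 * grad_inner \<A> g v v x \<ge> 0"
proof -
  let ?c = "chart_at \<A> x"
  let ?B = "matrix_inv (g ?c (snd ?c x))"
  define p where "p = (\<chi> i. partial i (in_chart ?c u) (snd ?c x))"
  define q where "q = (\<chi> i. partial i (in_chart ?c v) (snd ?c x))"
  have "pos_def ?B" using chart_at by (intro pos_def_matrix_inv metric_pos_def) auto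
  then have "w \<bullet> (?B *v w) \<ge> 0" for w
    unfolding pos_def_def by (cases "w = 0") (auto simp: less_imp_le)
  then have "(p + s *\<^sub>R q) \<bullet> (?B *v (p + s *\<^sub>R q)) \<ge> 0" .
  moreover have "(p + s *\<^sub>R q) \<bullet> (?B *v (p + s *\<^sub>R q)) =
      grad_inner \<A> g u u x + s * (grad_inner \<A> g u v x + grad_inner \<A> g v u x) + s\<^sup>2 * grad_inner \<A> g v v x"
    unfolding grad_inner_def Let_def coord_inner_vec p_def[symmetric] q_def[symmetric]
    by (simp add: matrix_vector_right_distrib inner_add_left inner_add_right matrix_vector_mult_scaleR
        algebra_simps power2_eq_square)
  ultimately show ?thesis by (simp add: grad_inner_commute[of v u])
qed

text \<open>Integrate the pointwise nonnegativity of the form on \<open>u + s v\<close>, and only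
  then use the discriminant in \<open>s\<close>.\<close>

lemma grad_inner_Cauchy_Schwarz:
  assumes u: "C1M u" and v: "C1M v"
  shows "(\<integral>x. grad_inner \<A> g u v x \<partial>vol)\<^sup>2 \<le> (\<integral>x. grad_inner \<A> g u u x \<partial>vol) * (\<integral>x. grad_inner \<A> g v v x \<partial>vol)"
proof (rule quadratic_nonneg_discriminant)
  fix s
  note i = integrable_continuous[OF grad_inner_continuous]
  have "0 \<le> (\<integral>x. grad_inner \<A> g u u x + 2 * s * grad_inner \<A> g u v x + s\<^sup>2 * grad_inner \<A> g v v x \<partial>vol)"
    using grad_inner_quadratic by (intro integral_nonneg_AE) simp
  then show "0 \<le> (\<integral>x. grad_inner \<A> g u u x \<partial>vol) + 2 * s * (\<integral>x. grad_inner \<A> g u v x \<partial>vol)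
      + s\<^sup>2 * (\<integral>x. grad_inner \<A> g v v x \<partial>vol)"
    by (simp add: i u v)
qed

lemma integral_Cauchy_Schwarz:
  fixes u v :: "'a \<Rightarrow> real"
  assumes u: "continuous_on UNIV u" and v: "continuous_on UNIV v"
  shows "(\<integral>x. u x * v x \<partial>vol)\<^sup>2 \<le> (\<integral>x. (u x)\<^sup>2 \<partial>vol) * (\<integral>x. (v x)\<^sup>2 \<partial>vol)"
proof (rule quadratic_nonneg_discriminant)
  fix s
  have i: "integrable vol (\<lambda>x. u x * v x)" "integrable vol (\<lambda>x. (u x)\<^sup>2)" "integrable vol (\<lambda>x. (v x)\<^sup>2)"
    by (intro integrable_continuous continuous_intros u v)+
  have "0 \<le> (\<integral>x. (u x + s * v x)\<^sup>2 \<partial>vol)" by (intro integral_nonneg_AE) simp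
  also have "\<dots> = (\<integral>x. (u x)\<^sup>2 + 2 * s * (u x * v x) + s\<^sup>2 * (v x)\<^sup>2 \<partial>vol)"
    by (rule Bochner_Integration.integral_cong) (auto simp: power2_eq_square algebra_simps)
  finally show "0 \<le> (\<integral>x. (u x)\<^sup>2 \<partial>vol) + 2 * s * (\<integral>x. u x * v x \<partial>vol) + s\<^sup>2 * (\<integral>x. (v x)\<^sup>2 \<partial>vol)"
    by (simp add: i)
qed

end

section \<open>Energy of waves\<close>

locale wave = closed_riemannian \<A> g vol
  for \<A> :: "('a::t2_space, 'n::finite) chart set" and g vol +
  fixes a a' :: "real \<Rightarrow> real" and \<psi> :: "real \<Rightarrow> 'a \<Rightarrow> real"
  assumes a_pos: "\<And>t. t > 0 \<Longrightarrow> a t > 0"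
    and a_deriv: "\<And>t. t > 0 \<Longrightarrow> (a has_real_derivative a' t) (at t)"
    and smooth: "smooth_on_spacetime \<A> \<psi>"
    and equation: "\<And>t x. t > 0 \<Longrightarrow> time_deriv (time_deriv \<psi>) t x =
      laplacian \<A> g (\<psi> t) x / (a t)\<^sup>2 - 3 * a' t / a t * time_deriv \<psi> t x"
begin

definition kinetic :: "real \<Rightarrow> real" where
  "kinetic t = (\<integral>x. (time_deriv \<psi> t x)\<^sup>2 \<partial>vol)"

definition gradient :: "real \<Rightarrow> real" where
  "gradient t = (\<integral>x. grad_inner \<A> g (\<psi> t) (\<psi> t) x \<partial>vol)"

lemma kinetic_nonneg: "kinetic t \<ge> 0" and gradient_nonneg: "gradient t \<ge> 0"
  unfolding kinetic_def gradient_def using grad_inner_nonneg by (auto intro!: integral_nonneg_AE)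

lemmas smooth_t = smooth_time_deriv[OF smooth]
lemmas smooth_tt = smooth_time_deriv[OF smooth_t]

lemma C2M_wave:
  assumes "t > 0" shows "C2M (\<psi> t)" "C2M (time_deriv \<psi> t)"
  using smooth_spacetime_slice smooth smooth_t assms by blast+

lemma continuous_product:
  assumes "smooth_on_spacetime \<A> \<phi>" "smooth_on_spacetime \<A> \<theta>"
  shows "continuous_on ({0<..} \<times> UNIV) (\<lambda>(t, x). \<phi> t x * \<theta> t x)"
  using continuous_on_mult[OF smooth_spacetime_continuous[OF assms(1)] smooth_spacetime_continuous[OF assms(2)]]
  by (simp add: split_def)

text \<open>The weak form of the wave equation. Taking \<open>h\<close> to be the current time
  derivative gives the energy identity; a fixed \<open>h\<close> gives the derivative of
  \<open>f\<close>.\<close>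

lemma pairing_tt:
  assumes t: "t > 0" and h: "C1M h"
  shows "(\<integral>x. time_deriv (time_deriv \<psi>) t x * h x \<partial>vol) =
    - (\<integral>x. grad_inner \<A> g h (\<psi> t) x \<partial>vol) / (a t)\<^sup>2 - 3 * a' t / a t * (\<integral>x. time_deriv \<psi> t x * h x \<partial>vol)"
proof -
  have i: "integrable vol (\<lambda>x. h x * laplacian \<A> g (\<psi> t) x)" "integrable vol (\<lambda>x. time_deriv \<psi> t x * h x)"
    by (intro integrable_continuous continuous_on_mult C1M_continuous h laplacian_continuous
        C2M_wave(1)[OF t] C2M_D(1)[OF C2M_wave(2)[OF t]])+
  have "(\<integral>x. time_deriv (time_deriv \<psi>) t x * h x \<partial>vol) =
      (\<integral>x. (h x * laplacian \<A> g (\<psi> t) x) / (a t)\<^sup>2 - 3 * a' t / a t * (time_deriv \<psi> t x * h x) \<partial>vol)"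
    by (rule Bochner_Integration.integral_cong) (auto simp: equation[OF t] algebra_simps)
  also have "\<dots> = (\<integral>x. h x * laplacian \<A> g (\<psi> t) x \<partial>vol) / (a t)\<^sup>2
      - 3 * a' t / a t * (\<integral>x. time_deriv \<psi> t x * h x \<partial>vol)"
    by (subst Bochner_Integration.integral_diff)
       (use i in \<open>auto intro!: integrable_divide_zero integrable_mult_right\<close>)
  finally show ?thesis using green[OF h C2M_wave(1)[OF t]] by simp
qed

lemma kinetic_deriv:
  assumes t: "t > 0"
  shows "(kinetic has_real_derivative
    - 2 * (\<integral>x. grad_inner \<A> g (\<psi> t) (time_deriv \<psi> t) x \<partial>vol) / (a t)\<^sup>2 - 6 * a' t / a t * kinetic t) (at t)"
proof -
  have "((\<lambda>t. \<integral>x. (time_deriv \<psi> t x)\<^sup>2 \<partial>vol) has_real_derivative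
      (\<integral>x. 2 * (time_deriv (time_deriv \<psi>) t x * time_deriv \<psi> t x) \<partial>vol)) (at t)"
  proof (rule integral_has_time_derivative[OF _ _ _ t])
    show "continuous_on ({0<..} \<times> UNIV) (\<lambda>(t, x). (time_deriv \<psi> t x)\<^sup>2)"
      using continuous_product[OF smooth_t smooth_t] by (simp add: power2_eq_square)
    show "continuous_on ({0<..} \<times> UNIV) (\<lambda>(t, x). 2 * (time_deriv (time_deriv \<psi>) t x * time_deriv \<psi> t x))"
      using continuous_on_mult_left[OF continuous_product[OF smooth_tt smooth_t], of 2] by (simp add: split_def)
    show "((\<lambda>s. (time_deriv \<psi> s x)\<^sup>2) has_real_derivative 2 * (time_deriv (time_deriv \<psi>) s x * time_deriv \<psi> s x)) (at s)"
      if "s > 0" for s x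
      by (rule DERIV_cong[OF DERIV_power[OF has_time_deriv[OF smooth_t that]]]) simp
  qed
  moreover have "(\<integral>x. time_deriv (time_deriv \<psi>) t x * time_deriv \<psi> t x \<partial>vol) =
     - (\<integral>x. grad_inner \<A> g (\<psi> t) (time_deriv \<psi> t) x \<partial>vol) / (a t)\<^sup>2 - 3 * a' t / a t * kinetic t"
    using pairing_tt[OF t C2M_D(1)[OF C2M_wave(2)[OF t]]]
    by (simp add: kinetic_def power2_eq_square grad_inner_commute[of "time_deriv \<psi> t"])
  then have "(\<integral>x. 2 * (time_deriv (time_deriv \<psi>) t x * time_deriv \<psi> t x) \<partial>vol) =
     - 2 * (\<integral>x. grad_inner \<A> g (\<psi> t) (time_deriv \<psi> t) x \<partial>vol) / (a t)\<^sup>2 - 6 * a' t / a t * kinetic t"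
    using a_pos[OF t] by (simp add: field_simps)
  ultimately show ?thesis by (simp add: kinetic_def[abs_def])
qed

lemma gradient_deriv:
  assumes t: "t > 0"
  shows "(gradient has_real_derivative 2 * (\<integral>x. grad_inner \<A> g (\<psi> t) (time_deriv \<psi> t) x \<partial>vol)) (at t)"
proof -
  have "((\<lambda>t. \<integral>x. grad_inner \<A> g (\<psi> t) (\<psi> t) x \<partial>vol) has_real_derivative
      (\<integral>x. 2 * grad_inner \<A> g (\<psi> t) (time_deriv \<psi> t) x \<partial>vol)) (at t)"
  proof (rule integral_has_time_derivative[OF grad_inner_spacetime_continuous[OF smooth smooth] _ _ t])
    show "continuous_on ({0<..} \<times> UNIV) (\<lambda>(t, x). 2 * grad_inner \<A> g (\<psi> t) (time_deriv \<psi> t) x)"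
      using continuous_on_mult_left[OF grad_inner_spacetime_continuous[OF smooth smooth_t], of 2] by (simp add: split_def)
  qed (rule grad_norm_has_time_derivative[OF smooth])
  then show ?thesis by (simp add: gradient_def[abs_def])
qed

text \<open>The weight \<open>a ^ 6\<close> absorbs the damping term \<open>- 6 * a' / a\<close> of
  the kinetic part, and \<open>a ^ 4\<close> makes the mixed gradient terms of the two derivatives
  cancel.\<close>

definition energy :: "real \<Rightarrow> real" where
  "energy t = a t ^ 6 * kinetic t + a t ^ 4 * gradient t"

lemma energy_deriv:
  assumes t: "t > 0"
  shows "(energy has_real_derivative 4 * a t ^ 3 * a' t * gradient t) (at t)"
proof -
  have "a t \<noteq> 0" using a_pos[OF t] by simp
  then show ?thesis
    unfolding energy_def[abs_def]
    by (auto intro!: derivative_eq_intros kinetic_deriv gradient_deriv a_deriv t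
        simp: field_simps eval_nat_numeral)
qed

lemma gradient_bound:
  assumes "\<And>s. s > 0 \<Longrightarrow> a' s \<ge> 0" and t: "0 < t" "t \<le> t0"
  shows "a t ^ 4 * gradient t \<le> energy t0"
proof -
  have "energy t \<le> energy t0"
  proof (rule DERIV_nonneg_imp_nondecreasing[OF t(2)])
    fix s assume "t \<le> s" "s \<le> t0"
    then have "s > 0" using t by simp
    then have "0 \<le> 4 * a s ^ 3 * a' s * gradient s"
      using a_pos[of s] assms(1)[of s] gradient_nonneg by simp
    then show "\<exists>y. (energy has_real_derivative y) (at s) \<and> 0 \<le> y" using energy_deriv[OF \<open>s > 0\<close>] by blast
  qed
  moreover have "a t ^ 6 * kinetic t \<ge> 0" using kinetic_nonneg[of t] a_pos[OF t(1)] by simp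
  ultimately show ?thesis by (simp add: energy_def)
qed

text \<open>The factor \<open>a ^ 3\<close> is the integrating factor of the damping term. The first
  claim makes the pairing with \<open>\<psi>\<close> a primitive of \<open>f / a ^ 3\<close>,
  through which the leading coefficient enters.\<close>

lemma pairing_deriv:
  assumes t: "t > 0" and h: "C1M h"
  shows "((\<lambda>t. \<integral>x. \<psi> t x * h x \<partial>vol) has_real_derivative (\<integral>x. time_deriv \<psi> t x * h x \<partial>vol)) (at t)"
    and "((\<lambda>t. a t ^ 3 * (\<integral>x. time_deriv \<psi> t x * h x \<partial>vol)) has_real_derivative
      - a t * (\<integral>x. grad_inner \<A> g h (\<psi> t) x \<partial>vol)) (at t)"
proof -
  have ch: "continuous_on ({0<..} \<times> UNIV) (\<lambda>(t::real, x). \<phi> t x * h x)" if "smooth_on_spacetime \<A> \<phi>" for \<phi>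
  proof -
    have "continuous_on ({0<..} \<times> UNIV) (\<lambda>z::real \<times> 'a. h (snd z))"
      by (rule continuous_on_compose2[OF C1M_continuous[OF h]]) (auto intro: continuous_intros)
    from continuous_on_mult[OF smooth_spacetime_continuous[OF that] this] show ?thesis by (simp add: split_def)
  qed
  have d: "((\<lambda>t. \<integral>x. \<phi> t x * h x \<partial>vol) has_real_derivative (\<integral>x. time_deriv \<phi> t x * h x \<partial>vol)) (at t)"
    if \<phi>: "smooth_on_spacetime \<A> \<phi>" for \<phi>
    by (rule integral_has_time_derivative[OF ch[OF \<phi>] ch[OF smooth_time_deriv[OF \<phi>]] _ t])
       (rule DERIV_cmult_right[OF has_time_deriv[OF \<phi>]])
  show "((\<lambda>t. \<integral>x. \<psi> t x * h x \<partial>vol) has_real_derivative (\<integral>x. time_deriv \<psi> t x * h x \<partial>vol)) (at t)"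
    using d[OF smooth] .
  have "a t \<noteq> 0" using a_pos[OF t] by simp
  then show "((\<lambda>t. a t ^ 3 * (\<integral>x. time_deriv \<psi> t x * h x \<partial>vol)) has_real_derivative
      - a t * (\<integral>x. grad_inner \<A> g h (\<psi> t) x \<partial>vol)) (at t)"
    by (intro DERIV_cong[OF DERIV_mult[OF DERIV_power[OF a_deriv[OF t], of 3] d[OF smooth_t]]])
       (subst pairing_tt[OF t h], simp add: field_simps eval_nat_numeral)
qed

end

section \<open>The scale factor near the singularity\<close>

text \<open>The scale factor has infinite slope at \<open>0\<close>, so comparison there has to
  start from a one-sided limit.\<close>

lemma nonneg_of_deriv_nonneg:
  fixes u :: "real \<Rightarrow> real"
  assumes der: "\<And>s. 0 < s \<Longrightarrow> s \<le> t \<Longrightarrow> (u has_real_derivative u' s) (at s)"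
    and nonneg: "\<And>s. 0 < s \<Longrightarrow> s \<le> t \<Longrightarrow> u' s \<ge> 0"
    and lim: "(u \<longlongrightarrow> 0) (at_right 0)" and t: "t > 0"
  shows "u t \<ge> 0"
proof (rule tendsto_upperbound[OF lim])
  have "u s \<le> u t" if "0 < s" "s < t" for s
    by (rule DERIV_nonneg_imp_nondecreasing[of s t u]) (use that der nonneg in \<open>force+\<close>)
  then show "\<forall>\<^sub>F s in at_right 0. u s \<le> u t"
    using t unfolding eventually_at_right_field by blast
qed simp

text \<open>Here \<open>f\<close> plays the role of \<open>a\<^sup>3 \<langle>\<partial>\<^sub>t\<psi>, h\<rangle>\<close>, \<open>m\<close> of \<open>\<langle>\<psi>, h\<rangle>\<close> and \<open>b\<close> of \<open>a\<^sup>-\<^sup>3\<close>: if \<open>f\<close> stayed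
  above some \<open>\<delta> > 0\<close> near \<open>0\<close>, then \<open>m / J\<close> could not tend to \<open>0\<close>.\<close>

lemma bound_of_vanishing_leading_term:
  fixes f m J b \<phi> :: "real \<Rightarrow> real"
  assumes T: "T > 0" and \<kappa>: "\<kappa> > 0"
    and f: "\<And>t. 0 < t \<Longrightarrow> t \<le> T \<Longrightarrow> (f has_real_derivative \<phi> t) (at t)"
    and \<phi>: "\<And>t. 0 < t \<Longrightarrow> t \<le> T \<Longrightarrow> \<bar>\<phi> t\<bar> \<le> R * t powr (\<kappa> - 1)"
    and m: "\<And>t. 0 < t \<Longrightarrow> t \<le> T \<Longrightarrow> (m has_real_derivative b t * f t) (at t)"
    and b: "\<And>t. 0 < t \<Longrightarrow> b t \<ge> 0"
    and J: "\<And>t. 0 < t \<Longrightarrow> (J has_real_derivative - b t) (at t)"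
    and J_inf: "filterlim J at_top (at_right 0)"
    and lim: "((\<lambda>t. m t / J t) \<longlongrightarrow> 0) (at_right 0)"
  shows "f T \<le> R / \<kappa> * T powr \<kappa>"
proof (rule ccontr)
  define \<delta> where "\<delta> = f T - R / \<kappa> * T powr \<kappa>"
  assume "\<not> ?thesis"
  then have "\<delta> > 0" by (simp add: \<delta>_def)
  have "\<bar>\<phi> T\<bar> \<le> R * T powr (\<kappa> - 1)" using \<phi> T by simp
  then have "0 \<le> R * T powr (\<kappa> - 1)" by linarith
  then have R: "R \<ge> 0" using T by (simp add: zero_le_mult_iff)
  \<comment> \<open>The function \<open>f t - R / \<kappa> * t powr \<kappa>\<close> is
    nonincreasing, because its derivative is \<open>\<phi>\<close> minus the bound on
    \<open>\<phi>\<close>.\<close>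
  have f_ge: "f t \<ge> \<delta>" if t: "0 < t" "t \<le> T" for t
  proof -
    have "f T - R / \<kappa> * T powr \<kappa> \<le> f t - R / \<kappa> * t powr \<kappa>"
    proof (rule DERIV_nonpos_imp_nonincreasing[OF t(2)])
      fix s assume s: "t \<le> s" "s \<le> T"
      then have "s > 0" using t by simp
      then have "((\<lambda>t. f t - R / \<kappa> * t powr \<kappa>) has_real_derivative \<phi> s - R * s powr (\<kappa> - 1)) (at s)"
        using \<kappa> s by (auto intro!: derivative_eq_intros f)
      moreover have "\<phi> s - R * s powr (\<kappa> - 1) \<le> 0" using \<phi>[OF \<open>s > 0\<close> s(2)] by linarith
      ultimately show "\<exists>y. ((\<lambda>t. f t - R / \<kappa> * t powr \<kappa>) has_real_derivative y) (at s) \<and> y \<le> 0" by blast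
    qed
    moreover have "R / \<kappa> * t powr \<kappa> \<ge> 0" using R \<kappa> by simp
    ultimately show ?thesis by (simp add: \<delta>_def)
  qed
  \<comment> \<open>The derivative of \<open>m + \<delta> * J\<close> is
    \<open>b * (f - \<delta>)\<close>, nonnegative by \<open>f_ge\<close>.\<close>
  have mono: "m t + \<delta> * J t \<le> m T + \<delta> * J T" if t: "0 < t" "t \<le> T" for t
  proof (rule DERIV_nonneg_imp_nondecreasing[OF t(2)])
    fix s assume s: "t \<le> s" "s \<le> T"
    then have "s > 0" using t by simp
    have "((\<lambda>t. m t + \<delta> * J t) has_real_derivative b s * (f s - \<delta>)) (at s)"
      using \<open>s > 0\<close> s by (auto intro!: derivative_eq_intros m J simp: algebra_simps)
    moreover have "b s * (f s - \<delta>) \<ge> 0" using b[OF \<open>s > 0\<close>] f_ge[OF \<open>s > 0\<close> s(2)] by simp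
    ultimately show "\<exists>y. ((\<lambda>t. m t + \<delta> * J t) has_real_derivative y) (at s) \<and> 0 \<le> y" by blast
  qed
  define D where "D = m T + \<delta> * J T"
  \<comment> \<open>Since \<open>J\<close> is unbounded, dividing by it removes the constant
    \<open>D\<close>, and the limit of \<open>m / J\<close> is at most
    \<open>- \<delta>\<close>.\<close>
  have "((\<lambda>t. D / J t - \<delta>) \<longlongrightarrow> 0 - \<delta>) (at_right 0)"
    by (intro tendsto_intros tendsto_divide_0[OF tendsto_const] filterlim_at_top_imp_at_infinity J_inf)
  moreover have "\<forall>\<^sub>F t in at_right 0. m t / J t \<le> D / J t - \<delta>"
  proof -
    have "\<forall>\<^sub>F t in at_right 0. J t > 0" using J_inf by (simp add: filterlim_at_top_dense)
    moreover have "\<forall>\<^sub>F t in at_right 0. 0 < t \<and> t < T"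
      using T unfolding eventually_at_right_field by blast
    ultimately show ?thesis
    proof eventually_elim
      case (elim t)
      then have "m t \<le> D - \<delta> * J t" using mono[of t] by (simp add: D_def)
      then have "m t / J t \<le> (D - \<delta> * J t) / J t" using elim by (intro divide_right_mono) auto
      then show ?case using elim by (simp add: diff_divide_distrib)
    qed
  qed
  ultimately have "0 \<le> 0 - \<delta>"
    by (intro tendsto_le[OF _ _ lim]) auto
  then show False using \<open>\<delta> > 0\<close> by simp
qed

locale scale_factor =
  fixes \<gamma> B :: real and a :: "real \<Rightarrow> real"
  assumes \<gamma>: "2/3 < \<gamma>" "\<gamma> < 2" and B: "B > 0" and scale: "scale_factor_type_m1 \<gamma> B a"
begin

definition a' :: "real \<Rightarrow> real" where
  "a' t = sqrt (8 * pi * B / 3 * a t powr (2 - 3 * \<gamma>) + 1)"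

text \<open>Near \<open>0\<close> the equation reads \<open>a'\<close> comparable to
  \<open>a powr (1 - p)\<close>, so \<open>a powr p\<close> has derivative between two positive
  constants and \<open>a\<close> behaves like \<open>t powr (1 / p)\<close>.\<close>

definition p :: real where "p = 3 * \<gamma> / 2"

lemma p_gt_1: "p > 1" using \<gamma> by (simp add: p_def)

lemma scale_pos: "t > 0 \<Longrightarrow> a t > 0"
  and scale_deriv: "t > 0 \<Longrightarrow> (a has_real_derivative a' t) (at t)"
  using scale by (auto simp: scale_factor_type_m1_def a'_def)

lemma scale_nonzero: "t > 0 \<Longrightarrow> a t \<noteq> 0"
  using scale_pos by force

lemma scale_tendsto_0: "(a \<longlongrightarrow> 0) (at_right 0)"
proof -
  have "\<forall>t\<in>{0..}. (a \<longlongrightarrow> a t) (at t within {0..})"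
    using scale by (simp add: scale_factor_type_m1_def continuous_on_def)
  from bspec[OF this, of 0] have "(a \<longlongrightarrow> a 0) (at 0 within {0..})" by simp
  moreover have "at_right (0::real) \<le> at 0 within {0..}" by (intro at_le) auto
  ultimately show ?thesis
    using scale tendsto_mono by (auto simp: scale_factor_type_m1_def)
qed

lemma a'_ge_1: "a' t \<ge> 1"
  using B unfolding a'_def by simp

text \<open>Linear growth makes \<open>1 / a ^ 3\<close> integrable at infinity, so that
  \<open>J\<close> is finite.\<close>

lemma scale_ge: assumes "t > 0" shows "a t \<ge> t"
proof -
  have "a t - t \<ge> 0"
  proof (rule nonneg_of_deriv_nonneg[where u = "\<lambda>s. a s - s" and u' = "\<lambda>s. a' s - 1"])
    show "((\<lambda>s. a s - s) \<longlongrightarrow> 0) (at_right 0)"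
      by (auto intro!: tendsto_eq_intros scale_tendsto_0)
  qed (use assms a'_ge_1 in \<open>auto intro!: derivative_eq_intros scale_deriv\<close>)
  then show ?thesis by simp
qed

lemma scale_powr_deriv:
  "t > 0 \<Longrightarrow> ((\<lambda>s. a s powr p) has_real_derivative p * a t powr (p - 1) * a' t) (at t)"
  using DERIV_fun_powr[OF scale_deriv scale_pos, of t p] by simp

lemma scale_powr_tendsto_0: "((\<lambda>s. a s powr p) \<longlongrightarrow> 0) (at_right 0)"
proof -
  have "\<forall>\<^sub>F s in at_right 0. a s \<ge> 0"
    using scale_pos by (auto simp: eventually_at_right_field less_imp_le intro!: exI[of _ 1])
  then have "((\<lambda>s. a s powr p) \<longlongrightarrow> 0 powr p) (at_right 0)"
    using p_gt_1 by (intro tendsto_powr' scale_tendsto_0 tendsto_const) auto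
  then show ?thesis by simp
qed

lemma sqrt_scale_powr:
  assumes "t > 0" "K \<ge> 0"
  shows "a t powr (p - 1) * sqrt (K * a t powr (2 - 3 * \<gamma>)) = sqrt K"
proof -
  have "sqrt (a t powr (2 - 3 * \<gamma>)) = a t powr ((2 - 3 * \<gamma>) / 2)"
    by (simp add: powr_half_sqrt[symmetric] powr_powr)
  moreover have "a t powr (p - 1) * a t powr ((2 - 3 * \<gamma>) / 2) = 1"
    using scale_pos[OF assms(1)] by (simp add: powr_add[symmetric] p_def field_simps)
  ultimately show ?thesis by (simp add: real_sqrt_mult)
qed

lemma scale_lower: "\<exists>k>0. \<forall>t>0. k * t \<le> a t powr p"
proof (intro exI conjI allI impI)
  \<comment> \<open>The value of \<open>p * a powr (p - 1) * a'\<close> after dropping the summand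
    \<open>1\<close> under the root.\<close>
  define k where "k = p * sqrt (8 * pi * B / 3)"
  show "k > 0" using p_gt_1 B by (simp add: k_def)
  fix t :: real assume t: "t > 0"
  have "a t powr p - k * t \<ge> 0"
  proof (rule nonneg_of_deriv_nonneg[where u = "\<lambda>s. a s powr p - k * s" and u' = "\<lambda>s. p * a s powr (p - 1) * a' s - k"])
    show "((\<lambda>s. a s powr p - k * s) \<longlongrightarrow> 0) (at_right 0)"
      using tendsto_diff[OF scale_powr_tendsto_0 tendsto_mult[OF tendsto_const tendsto_ident_at]] by auto
    show "((\<lambda>s. a s powr p - k * s) has_real_derivative p * a s powr (p - 1) * a' s - k) (at s)" if "s > 0" for s
      by (rule DERIV_diff[OF scale_powr_deriv[OF that] DERIV_cmult_Id])
    show "p * a s powr (p - 1) * a' s - k \<ge> 0" if "s > 0" for s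
    proof -
      have "sqrt (8 * pi * B / 3) = a s powr (p - 1) * sqrt (8 * pi * B / 3 * a s powr (2 - 3 * \<gamma>))"
        using sqrt_scale_powr[OF that, of "8 * pi * B / 3"] B by simp
      also have "\<dots> \<le> a s powr (p - 1) * a' s"
        unfolding a'_def by (intro mult_left_mono real_sqrt_le_mono) auto
      finally have "p * sqrt (8 * pi * B / 3) \<le> p * (a s powr (p - 1) * a' s)"
        using p_gt_1 by (intro mult_left_mono) auto
      then show ?thesis by (simp add: k_def mult.assoc)
    qed
  qed (rule t)
  then show "k * t \<le> a t powr p" by simp
qed

text \<open>The exponent equals \<open>- (1 / p)\<close>, which exceeds \<open>-1\<close> since
  \<open>p > 1\<close>; hence \<open>1 / a\<close> is integrable at \<open>0\<close>.\<close>

lemma inverse_scale_bound: "\<exists>C>0. \<forall>t>0. 1 / a t \<le> C * t powr ((1 - 2 / (3 * \<gamma>)) - 1)"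
proof -
  obtain k where k: "k > 0" "\<And>t. t > 0 \<Longrightarrow> k * t \<le> a t powr p" using scale_lower by blast
  have "1 / a t \<le> k powr (- (1 / p)) * t powr ((1 - 2 / (3 * \<gamma>)) - 1)" if t: "t > 0" for t
  proof -
    have "(k * t) powr (1 / p) \<le> (a t powr p) powr (1 / p)"
      using k t p_gt_1 by (intro powr_mono2) auto
    also have "\<dots> = a t" using p_gt_1 scale_pos[OF t] by (simp add: powr_powr)
    finally have "(k * t) powr (1 / p) \<le> a t" .
    moreover have "(k * t) powr (1 / p) > 0" using k t by simp
    ultimately have "1 / a t \<le> 1 / (k * t) powr (1 / p)"
      using scale_pos[OF t] by (intro divide_left_mono mult_pos_pos) auto
    also have "\<dots> = k powr (- (1 / p)) * t powr (- (1 / p))"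
      using k t by (simp add: powr_mult powr_minus divide_inverse)
    also have "- (1 / p) = (1 - 2 / (3 * \<gamma>)) - 1" using \<gamma> by (simp add: p_def)
    finally show ?thesis by (simp add: p_def)
  qed
  moreover have "k powr (- (1 / p)) > 0" using k by simp
  ultimately show ?thesis by blast
qed

text \<open>The upper bound for \<open>a powr p\<close> by a multiple of \<open>t\<close>, raised to
  the power \<open>3 / p\<close>. It makes \<open>J\<close> diverge at least
  logarithmically.\<close>

lemma inverse_scale_cube_lower: "\<exists>c>0. \<exists>T>0. \<forall>t. 0 < t \<and> t \<le> T \<longrightarrow> c / t \<le> 1 / a t ^ 3"
proof -
  have "\<forall>\<^sub>F s in at_right 0. a s < 1" using order_tendstoD(2)[OF scale_tendsto_0, of 1] by simp
  then obtain T0 where T0: "T0 > 0" "\<And>s. 0 < s \<Longrightarrow> s < T0 \<Longrightarrow> a s < 1"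
    unfolding eventually_at_right_field by auto
  \<comment> \<open>Halving \<open>T0\<close> makes \<open>a < 1\<close> hold up to and including
    \<open>T\<close>; \<open>T \<le> 1\<close> is for comparing powers of \<open>t\<close>.\<close>
  define T where "T = min (T0 / 2) 1"
  have T: "T > 0" "T \<le> 1" "\<And>s. 0 < s \<Longrightarrow> s \<le> T \<Longrightarrow> a s < 1" using T0 by (auto simp: T_def)
  \<comment> \<open>Where \<open>a < 1\<close>, the summand \<open>1\<close> under the root is at
    most \<open>a powr (2 - 3 * \<gamma>)\<close>, whence the extra \<open>1\<close> in the
    coefficient.\<close>
  define k where "k = p * sqrt (8 * pi * B / 3 + 1)"
  have "k > 0" using p_gt_1 B by (simp add: k_def add_pos_pos)
  have up: "a t powr p \<le> k * t" if t: "0 < t" "t \<le> T" for t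
  proof -
    have "k * t - a t powr p \<ge> 0"
    proof (rule nonneg_of_deriv_nonneg[where u = "\<lambda>s. k * s - a s powr p" and u' = "\<lambda>s. k - p * a s powr (p - 1) * a' s"])
      show "((\<lambda>s. k * s - a s powr p) \<longlongrightarrow> 0) (at_right 0)"
        using tendsto_diff[OF tendsto_mult[OF tendsto_const tendsto_ident_at] scale_powr_tendsto_0] by auto
      show "((\<lambda>s. k * s - a s powr p) has_real_derivative k - p * a s powr (p - 1) * a' s) (at s)" if "s > 0" for s
        by (rule DERIV_diff[OF DERIV_cmult_Id scale_powr_deriv[OF that]])
      show "k - p * a s powr (p - 1) * a' s \<ge> 0" if s: "s > 0" "s \<le> t" for s
      proof -
        have "a s < 1" "a s > 0" using T(3)[of s] s t scale_pos by auto
        then have "1 powr (2 - 3 * \<gamma>) \<le> a s powr (2 - 3 * \<gamma>)"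
          using \<gamma> by (intro powr_mono2') auto
        then have "a' s \<le> sqrt ((8 * pi * B / 3 + 1) * a s powr (2 - 3 * \<gamma>))"
          unfolding a'_def by (intro real_sqrt_le_mono) (simp add: algebra_simps)
        then have "a s powr (p - 1) * a' s \<le> a s powr (p - 1) * sqrt ((8 * pi * B / 3 + 1) * a s powr (2 - 3 * \<gamma>))"
          by (intro mult_left_mono) auto
        also have "\<dots> = sqrt (8 * pi * B / 3 + 1)"
          using B by (intro sqrt_scale_powr s) (simp add: add_nonneg_nonneg)
        finally have "p * (a s powr (p - 1) * a' s) \<le> p * sqrt (8 * pi * B / 3 + 1)"
          using p_gt_1 by (intro mult_left_mono) auto
        then show ?thesis by (simp add: k_def mult.assoc)
      qed
    qed (rule t)
    then show ?thesis by simp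
  qed
  have "k powr (- (3 / p)) / t \<le> 1 / a t ^ 3" if t: "0 < t" "t \<le> T" for t
  proof -
    have ap: "a t > 0" using scale_pos t by simp
    have "a t ^ 3 = a t powr 3" using ap by (simp add: powr_numeral)
    also have "\<dots> = (a t powr p) powr (3 / p)" using p_gt_1 by (simp add: powr_powr)
    also have "\<dots> \<le> (k * t) powr (3 / p)" using up[OF t] p_gt_1 by (intro powr_mono2) auto
    also have "\<dots> = k powr (3 / p) * t powr (3 / p)" using \<open>k > 0\<close> t by (simp add: powr_mult)
    \<comment> \<open>Here \<open>3 / p = 2 / \<gamma>\<close> exceeds \<open>1\<close> because
      \<open>\<gamma> < 2\<close>, and \<open>t \<le> 1\<close>.\<close>
    also have "t powr (3 / p) \<le> t powr 1"
      using t T \<gamma> by (intro powr_mono') (auto simp: p_def field_simps)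
    finally have "a t ^ 3 \<le> k powr (3 / p) * t" using t \<open>k > 0\<close> by simp
    then have "1 / (k powr (3 / p) * t) \<le> 1 / a t ^ 3"
      using ap t \<open>k > 0\<close> by (intro divide_left_mono mult_pos_pos) auto
    then show ?thesis by (simp add: powr_minus divide_inverse)
  qed
  moreover have "k powr (- (3 / p)) > 0" using \<open>k > 0\<close> by simp
  ultimately show ?thesis using T(1) by blast
qed

section \<open>The tail integral that normalises the leading coefficient\<close>

definition J :: "real \<Rightarrow> real" where
  "J t = integral {t..} (\<lambda>s. 1 / a s ^ 3)"

lemma scale_continuous: "continuous_on {0<..} a"
  by (intro continuous_at_imp_continuous_on ballI DERIV_isCont[OF scale_deriv]) simp

lemma inverse_scale_cube_integrable:
  assumes t: "t > 0"
  shows "(\<lambda>s. 1 / a s ^ 3) integrable_on {t..}"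
proof (rule measurable_bounded_by_integrable_imp_integrable)
  have "continuous_on {t..} (\<lambda>s. 1 / a s ^ 3)"
    using t by (intro continuous_intros continuous_on_subset[OF scale_continuous]) (auto simp: scale_nonzero)
  then show "(\<lambda>s. 1 / a s ^ 3) \<in> borel_measurable (lebesgue_on {t..})"
    by (rule continuous_imp_measurable_on_sets_lebesgue) auto
  show "(\<lambda>s. s powr (-3)) integrable_on {t..}"
    using has_integral_powr_to_inf[of "-3" t] t by (auto intro: has_integral_integrable)
  show "norm (1 / a s ^ 3) \<le> s powr (-3)" if "s \<in> {t..}" for s
  proof -
    have s: "s > 0" using that t by auto
    have "1 / a s ^ 3 \<le> 1 / s ^ 3"
      using scale_ge[OF s] s scale_pos[OF s] by (intro divide_left_mono power_mono) auto
    then show ?thesis using s scale_pos[OF s]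
      by (simp add: powr_minus powr_numeral divide_inverse)
  qed
qed auto

text \<open>Splitting at a base point \<open>r < t\<close> reduces the improper integral to one over
  a compact interval with variable upper end.\<close>

lemma J_deriv:
  assumes t: "t > 0"
  shows "(J has_real_derivative - (1 / a t ^ 3)) (at t)"
proof -
  let ?b = "\<lambda>s. 1 / a s ^ 3"
  define r where "r = t / 2"
  have r: "r > 0" "r < t" using t by (auto simp: r_def)
  have cont: "continuous_on {r..2 * t} ?b"
    using r by (intro continuous_intros continuous_on_subset[OF scale_continuous]) (auto simp: scale_nonzero)
  have eq: "J s = J r - integral {r..s} ?b" if s: "s \<in> {r<..<2 * t}" for s
  proof -
    have "s > 0" using s r by auto
    have "integral ({r..s} \<union> {s..}) ?b = integral {r..s} ?b + integral {s..} ?b"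
    proof (rule integral_Un)
      show "?b integrable_on {r..s}"
        using s by (intro integrable_continuous_real continuous_on_subset[OF cont]) auto
      show "?b integrable_on {s..}" using inverse_scale_cube_integrable \<open>s > 0\<close> .
      have "{r..s} \<inter> {s..} = {s}" using s by auto
      then show "negligible ({r..s} \<inter> {s..})" by simp
    qed
    moreover have "{r..s} \<union> {s..} = {r..}" using s by auto
    ultimately show ?thesis by (simp add: J_def)
  qed
  have "((\<lambda>s. integral {r..s} ?b) has_real_derivative ?b t) (at t within {r..2 * t})"
    using r t by (intro integral_has_real_derivative cont) auto
  then have "((\<lambda>s. integral {r..s} ?b) has_real_derivative ?b t) (at t)"
    using r t at_within_Icc_at[of r t "2 * t"] by simp
  then have "((\<lambda>s. J r - integral {r..s} ?b) has_real_derivative - ?b t) (at t)"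
    by (auto intro!: derivative_eq_intros)
  then show ?thesis
    by (rule has_field_derivative_transform_within_open[of _ _ _ "{r<..<2 * t}"]) (use r t eq in auto)
qed

text \<open>By the lower bound \<open>c / t\<close> for the integrand, \<open>J t + c * ln t\<close>
  is nonincreasing near \<open>0\<close>.\<close>

lemma J_at_top: "filterlim J at_top (at_right 0)"
proof -
  obtain c T where cT: "c > 0" "T > 0" "\<And>t. 0 < t \<Longrightarrow> t \<le> T \<Longrightarrow> c / t \<le> 1 / a t ^ 3"
    using inverse_scale_cube_lower by blast
  have bound: "(J T + c * ln T) + c * - ln t \<le> J t" if t: "0 < t" "t \<le> T" for t
  proof -
    have "J T + c * ln T \<le> J t + c * ln t"
    proof (rule DERIV_nonpos_imp_nonincreasing[OF t(2)])
      fix s assume s: "t \<le> s" "s \<le> T"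
      then have "s > 0" using t by simp
      have "((\<lambda>t. J t + c * ln t) has_real_derivative - (1 / a s ^ 3) + c / s) (at s)"
        using \<open>s > 0\<close> by (auto intro!: derivative_eq_intros J_deriv)
      moreover have "- (1 / a s ^ 3) + c / s \<le> 0" using cT(3)[OF \<open>s > 0\<close> s(2)] by simp
      ultimately show "\<exists>y. ((\<lambda>t. J t + c * ln t) has_real_derivative y) (at s) \<and> y \<le> 0" by blast
    qed
    then show ?thesis by simp
  qed
  have "filterlim (\<lambda>t. (J T + c * ln T) + c * - ln t) at_top (at_right 0)"
    using cT(1) ln_at_0 by (intro filterlim_tendsto_add_at_top[OF tendsto_const]
        filterlim_tendsto_pos_mult_at_top[OF tendsto_const]) (auto simp: filterlim_uminus_at_top)
  then show ?thesis
    by (rule filterlim_at_top_mono)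
       (use bound cT(2) in \<open>auto simp: eventually_at_right_field intro!: exI[of _ T]\<close>)
qed

end

section \<open>Nonvanishing of the leading coefficient\<close>

text \<open>The letters \<open>K\<close>, \<open>Y\<close>, \<open>H\<close>, \<open>L\<close> stand
  for the squared norms of \<open>h\<close>, of the gradient of \<open>\<psi>\<close> at
  \<open>t0\<close>, of the gradient of \<open>h\<close> and of its Laplacian;
  \<open>\<alpha>\<close> is \<open>a t0\<close> and \<open>s\<close> is
  \<open>t0 powr \<kappa>\<close>. Squaring \<open>main\<close> gives a bound of \<open>K\<close> by
  \<open>H\<close>, and squaring once more lets \<open>H\<close> be traded for
  \<open>K * L\<close>.\<close>

lemma energy_contradiction:
  fixes K Y L H C s \<alpha> :: real
  assumes K: "K > 0" and L: "L \<ge> 0" and \<alpha>: "\<alpha> > 0" and s: "0 \<le> s" "s \<le> 1" and H: "H \<ge> 0" "H\<^sup>2 \<le> K * L"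
    and Y: "Y \<le> \<alpha>\<^sup>2 * K" and C: "C \<ge> 0"
    and main: "\<alpha> ^ 3 * K \<le> sqrt (H * (\<alpha> ^ 6 * K + \<alpha> ^ 4 * Y)) * (C * s)"
  shows "K \<le> 4 * C ^ 4 * s\<^sup>2 * L"
proof -
  have E: "\<alpha> ^ 6 * K + \<alpha> ^ 4 * Y \<le> 2 * \<alpha> ^ 6 * K"
  proof -
    have "\<alpha> ^ 4 * Y \<le> \<alpha> ^ 4 * (\<alpha>\<^sup>2 * K)" using Y \<alpha> by (intro mult_left_mono) auto
    also have "\<dots> = \<alpha> ^ 6 * K" by (simp add: eval_nat_numeral)
    finally show ?thesis by linarith
  qed
  have "\<alpha> ^ 3 * K \<le> sqrt (H * (2 * \<alpha> ^ 6 * K)) * (C * s)"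
    using main by (rule order_trans) (intro mult_right_mono real_sqrt_le_mono mult_left_mono E H mult_nonneg_nonneg C s)
  then have "(\<alpha> ^ 3 * K)\<^sup>2 \<le> (sqrt (H * (2 * \<alpha> ^ 6 * K)) * (C * s))\<^sup>2"
    using \<alpha> K by (intro power_mono) auto
  also have "\<dots> = H * (2 * \<alpha> ^ 6 * K) * (C * s)\<^sup>2"
    using H \<alpha> K by (simp add: power_mult_distrib)
  finally have "(\<alpha> ^ 6 * K) * K \<le> (\<alpha> ^ 6 * K) * (2 * C\<^sup>2 * s\<^sup>2 * H)"
    by (simp add: power_mult_distrib power2_eq_square[of K] algebra_simps flip: power_mult)
  then have "K \<le> 2 * C\<^sup>2 * s\<^sup>2 * H" using \<alpha> K by (simp add: mult_le_cancel_left_pos)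
  then have "K\<^sup>2 \<le> (2 * C\<^sup>2 * s\<^sup>2 * H)\<^sup>2" using K by (intro power_mono) auto
  also have "\<dots> = 4 * C ^ 4 * s ^ 4 * H\<^sup>2" by (simp add: power_mult_distrib flip: power_mult)
  also have "\<dots> \<le> 4 * C ^ 4 * s ^ 4 * (K * L)" using C s by (intro mult_left_mono H) auto
  \<comment> \<open>As \<open>s \<le> 1\<close>, the fourth power is relaxed to the second, which
    matches the exponent \<open>2 * \<kappa>\<close> of the hypotheses.\<close>
  also have "\<dots> \<le> 4 * C ^ 4 * s\<^sup>2 * (K * L)"
    using C s K L by (intro mult_right_mono mult_left_mono power_decreasing) auto
  finally have "K * K \<le> K * (4 * C ^ 4 * s\<^sup>2 * L)" by (simp add: power2_eq_square algebra_simps)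
  then show ?thesis using K by (simp add: mult_le_cancel_left_pos)
qed

theorem theorem5p7:
  fixes \<A> :: "('a::t2_space, 3) chart set"
    and g :: "('a, 3) metric"
    and vol :: "'a measure"
    and a :: "real \<Rightarrow> real"
    and \<gamma> B :: real
  assumes "closed_riemannian_manifold \<A> g"
    and "is_riemannian_volume \<A> g vol"
    and "2/3 < \<gamma>" and "\<gamma> < 2"
    and "B > 0"
    and "scale_factor_type_m1 \<gamma> B a"
  shows "\<exists>G>0. \<forall>\<^sub>F t0 in at_right (0::real).
    \<forall>\<psi> A. smooth_wave \<A> g a \<psi> \<and> leading_coefficient \<A> a \<psi> A \<and>
      (\<exists>x. time_deriv \<psi> t0 x \<noteq> 0) \<and>
      (\<exists>\<epsilon>. 0 < \<epsilon> \<and> \<epsilon> < 1 \<and>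
        \<epsilon> * (1 - G * t0 powr (2 - 4 / (3 * \<gamma>))) * (\<integral>x. \<bar>time_deriv \<psi> t0 x\<bar>\<^sup>2 \<partial>vol)
          > G * t0 powr (2 - 4 / (3 * \<gamma>))
              * (\<integral>x. \<bar>time_deriv (\<lambda>t. laplacian \<A> g (\<psi> t)) t0 x\<bar>\<^sup>2 \<partial>vol) \<and>
        (1 - \<epsilon>) * (1 - G * t0 powr (2 - 4 / (3 * \<gamma>))) * (a t0)\<^sup>2
              * (\<integral>x. \<bar>time_deriv \<psi> t0 x\<bar>\<^sup>2 \<partial>vol)
          > (1 + G * t0 powr (2 - 4 / (3 * \<gamma>))) * (\<integral>x. grad_norm_sq \<A> g (\<psi> t0) x \<partial>vol)
            + G * t0 powr (2 - 4 / (3 * \<gamma>))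
              * (\<integral>x. grad_norm_sq \<A> g (laplacian \<A> g (\<psi> t0)) x \<partial>vol))
      \<longrightarrow> L2_norm vol A > 0"
proof -
  interpret closed_riemannian \<A> g vol using assms(1,2) by unfold_locales
  interpret scale_factor \<gamma> B a using assms(3-6) by unfold_locales
  define \<kappa> where "\<kappa> = 1 - 2 / (3 * \<gamma>)"
  have \<kappa>: "\<kappa> > 0" using \<gamma> by (simp add: \<kappa>_def field_simps)
  obtain C1 where C1: "C1 > 0" "\<And>t. t > 0 \<Longrightarrow> 1 / a t \<le> C1 * t powr (\<kappa> - 1)"
    using inverse_scale_bound unfolding \<kappa>_def by blast
  \<comment> \<open>The constant obtained by integrating \<open>C1 * t powr (\<kappa> - 1)\<close>
    from \<open>0\<close>.\<close>
  define C where "C = C1 / \<kappa>"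
  have C: "C > 0" using C1 \<kappa> by (simp add: C_def)
  \<comment> \<open>\<open>4 * C ^ 4\<close> is the constant produced by
    \<open>energy_contradiction\<close>; \<open>G\<close> only has to be at least as large.\<close>
  define G where "G = 4 * C ^ 4 + 1"
  have G: "G > 0" using C by (simp add: G_def add_pos_pos)
  have pow: "t powr (2 - 4 / (3 * \<gamma>)) = (t powr \<kappa>)\<^sup>2" for t
  proof -
    have "(t powr \<kappa>)\<^sup>2 = t powr (\<kappa> + \<kappa>)" by (simp only: power2_eq_square powr_add)
    also have "\<kappa> + \<kappa> = 2 - 4 / (3 * \<gamma>)" by (simp add: \<kappa>_def)
    finally show ?thesis by simp
  qed
  have "L2_norm vol A > 0"
    if t0: "0 < t0" "t0 < 1" and wave: "smooth_wave \<A> g a \<psi>" and lead: "leading_coefficient \<A> a \<psi> A"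
      and \<epsilon>: "0 < \<epsilon>" "\<epsilon> < 1"
      and h1: "\<epsilon> * (1 - G * (t0 powr \<kappa>)\<^sup>2) * (\<integral>x. \<bar>time_deriv \<psi> t0 x\<bar>\<^sup>2 \<partial>vol)
          > G * (t0 powr \<kappa>)\<^sup>2 * (\<integral>x. \<bar>time_deriv (\<lambda>t. laplacian \<A> g (\<psi> t)) t0 x\<bar>\<^sup>2 \<partial>vol)"
      and h2: "(1 - \<epsilon>) * (1 - G * (t0 powr \<kappa>)\<^sup>2) * (a t0)\<^sup>2 * (\<integral>x. \<bar>time_deriv \<psi> t0 x\<bar>\<^sup>2 \<partial>vol)
          > (1 + G * (t0 powr \<kappa>)\<^sup>2) * (\<integral>x. grad_norm_sq \<A> g (\<psi> t0) x \<partial>vol)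
            + G * (t0 powr \<kappa>)\<^sup>2 * (\<integral>x. grad_norm_sq \<A> g (laplacian \<A> g (\<psi> t0)) x \<partial>vol)"
    for t0 \<psi> A \<epsilon>
  proof (rule ccontr)
    assume "\<not> L2_norm vol A > 0"
    interpret wave \<A> g vol a a' \<psi>
    proof
      show "smooth_on_spacetime \<A> \<psi>" using wave by (simp add: smooth_wave_def)
      fix t x assume t: "(t::real) > 0"
      have "- time_deriv (time_deriv \<psi>) t x + (1 / (a t)\<^sup>2) * laplacian \<A> g (\<psi> t) x
        - 3 * (a' t / a t) * time_deriv \<psi> t x = 0"
        using wave t DERIV_imp_deriv[OF scale_deriv[OF t]] unfolding smooth_wave_def by metis
      then show "time_deriv (time_deriv \<psi>) t x =
        laplacian \<A> g (\<psi> t) x / (a t)\<^sup>2 - 3 * a' t / a t * time_deriv \<psi> t x" by simp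
    qed (use scale_pos scale_deriv in auto)
    have A: "continuous_on UNIV A"
      using lead unfolding leading_coefficient_def by (intro C1M_continuous C2M_D(1) smooth_function_C2M) simp
    have "(\<integral>x. (A x)\<^sup>2 \<partial>vol) \<ge> 0" by (intro integral_nonneg_AE) simp
    moreover have "\<not> (\<integral>x. (A x)\<^sup>2 \<partial>vol) > 0" using \<open>\<not> L2_norm vol A > 0\<close> by (simp add: L2_norm_def)
    ultimately have "(\<integral>x. (A x)\<^sup>2 \<partial>vol) = 0" by linarith
    moreover have "continuous_on UNIV (\<lambda>x. (A x)\<^sup>2)" by (intro continuous_on_power A)
    ultimately have A0: "A x = 0" for x
      using continuous_integral_0_eq_0[of "\<lambda>x. (A x)\<^sup>2" x] by simp
    define h where "h = time_deriv \<psi> t0"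
    have h: "C2M h" using C2M_wave(2)[OF t0(1)] by (simp add: h_def)
    note ch = C1M_continuous[OF C2M_D(1)[OF h]]
    define H where "H = (\<integral>x. grad_inner \<A> g h h x \<partial>vol)"
    define L where "L = (\<integral>x. (laplacian \<A> g h x)\<^sup>2 \<partial>vol)"
    have L: "(\<integral>x. \<bar>time_deriv (\<lambda>t. laplacian \<A> g (\<psi> t)) t0 x\<bar>\<^sup>2 \<partial>vol) = L"
      by (simp add: L_def h_def time_deriv_laplacian[OF smooth t0(1)])
    have K: "(\<integral>x. \<bar>time_deriv \<psi> t0 x\<bar>\<^sup>2 \<partial>vol) = kinetic t0" by (simp add: kinetic_def)
    have Y: "(\<integral>x. grad_norm_sq \<A> g (\<psi> t0) x \<partial>vol) = gradient t0" by (simp add: gradient_def grad_norm_sq_eq)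
    have nonneg: "H \<ge> 0" "L \<ge> 0" "(\<integral>x. grad_norm_sq \<A> g (laplacian \<A> g (\<psi> t0)) x \<partial>vol) \<ge> 0"
      unfolding H_def L_def grad_norm_sq_eq using grad_inner_nonneg by (auto intro!: integral_nonneg_AE)
    have lim: "((\<lambda>t. (\<integral>x. \<psi> t x * h x \<partial>vol) / J t) \<longlongrightarrow> 0) (at_right 0)"
    proof (rule tendstoI)
      fix e :: real assume "e > 0"
      \<comment> \<open>The summand \<open>1\<close> keeps \<open>N\<close> positive and makes the
        final estimate strict.\<close>
      define N where "N = (\<integral>x. \<bar>h x\<bar> \<partial>vol) + 1"
      have "(\<integral>x. \<bar>h x\<bar> \<partial>vol) \<ge> 0" by (intro integral_nonneg_AE) simp
      then have N: "N > 0" "(\<integral>x. \<bar>h x\<bar> \<partial>vol) < N" unfolding N_def by linarith+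
      have "\<forall>\<^sub>F t in at_right 0. \<forall>x\<in>UNIV. dist (\<psi> t x / J t) (A x) < e / N"
        using lead \<open>e > 0\<close> N unfolding leading_coefficient_def J_def by (intro uniform_limitD) auto
      moreover have "\<forall>\<^sub>F t in at_right 0. (0::real) < t" by (simp add: eventually_at_right_less)
      ultimately show "\<forall>\<^sub>F t in at_right 0. dist ((\<integral>x. \<psi> t x * h x \<partial>vol) / J t) 0 < e"
      proof eventually_elim
        case (elim t)
        have c: "continuous_on UNIV (\<psi> t)" using C1M_continuous C2M_D(1) C2M_wave(1) elim(2) by blast
        have "\<bar>\<integral>x. \<psi> t x / J t * h x \<partial>vol\<bar> \<le> (\<integral>x. \<bar>\<psi> t x / J t * h x\<bar> \<partial>vol)"
          by (rule integral_abs_bound)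
        also have "\<dots> \<le> (\<integral>x. e / N * \<bar>h x\<bar> \<partial>vol)"
        proof (rule integral_mono)
          show "integrable vol (\<lambda>x. \<bar>\<psi> t x / J t * h x\<bar>)"
            unfolding divide_inverse by (intro integrable_continuous continuous_intros c ch)
          show "integrable vol (\<lambda>x. e / N * \<bar>h x\<bar>)"
            by (intro integrable_continuous continuous_intros ch)
          show "\<bar>\<psi> t x / J t * h x\<bar> \<le> e / N * \<bar>h x\<bar>" for x
            using elim(1) A0 unfolding abs_mult by (intro mult_right_mono) (auto simp: less_imp_le)
        qed
        also have "\<dots> = e * ((\<integral>x. \<bar>h x\<bar> \<partial>vol) / N)" by simp
        also have "\<dots> < e * 1" using N \<open>e > 0\<close> by (intro mult_strict_left_mono) auto
        finally show ?case by simp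
      qed
    qed
    have a0: "a t0 > 0" using scale_pos t0 by simp
    \<comment> \<open>By Cauchy-Schwarz and \<open>gradient_bound\<close>, \<open>R\<close> bounds
      \<open>a ^ 2\<close> times the pairing of the gradients of \<open>h\<close> and
      \<open>\<psi>\<close> at all times up to \<open>t0\<close>; the factor \<open>C1\<close> comes
      from replacing \<open>1 / a\<close> by a power of \<open>t\<close>.\<close>
    define R where "R = sqrt (H * energy t0)"
    have "a t0 ^ 3 * (\<integral>x. time_deriv \<psi> t0 x * h x \<partial>vol) \<le> (R * C1) / \<kappa> * t0 powr \<kappa>"
    proof (rule bound_of_vanishing_leading_term[OF t0(1) \<kappa>, where b = "\<lambda>t. 1 / a t ^ 3" and J = J
          and f = "\<lambda>t. a t ^ 3 * (\<integral>x. time_deriv \<psi> t x * h x \<partial>vol)"])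
      fix t :: real assume t: "0 < t" "t \<le> t0"
      have at: "a t > 0" using scale_pos t by simp
      show "((\<lambda>t. a t ^ 3 * (\<integral>x. time_deriv \<psi> t x * h x \<partial>vol)) has_real_derivative
          - a t * (\<integral>x. grad_inner \<A> g h (\<psi> t) x \<partial>vol)) (at t)"
        using pairing_deriv(2)[OF t(1) C2M_D(1)[OF h]] .
      show "((\<lambda>t. \<integral>x. \<psi> t x * h x \<partial>vol) has_real_derivative
          1 / a t ^ 3 * (a t ^ 3 * (\<integral>x. time_deriv \<psi> t x * h x \<partial>vol))) (at t)"
        using pairing_deriv(1)[OF t(1) C2M_D(1)[OF h]] at by simp
      have "(\<integral>x. grad_inner \<A> g h (\<psi> t) x \<partial>vol)\<^sup>2 \<le> H * gradient t"
        unfolding H_def gradient_def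
        by (intro grad_inner_Cauchy_Schwarz C2M_D(1)[OF h] C2M_D(1)[OF C2M_wave(1)[OF t(1)]])
      then have "a t ^ 4 * (\<integral>x. grad_inner \<A> g h (\<psi> t) x \<partial>vol)\<^sup>2 \<le> a t ^ 4 * (H * gradient t)"
        by (intro mult_left_mono) auto
      also have "\<dots> = H * (a t ^ 4 * gradient t)" by simp
      also have "\<dots> \<le> H * energy t0"
        using a'_ge_1 by (intro mult_left_mono gradient_bound t nonneg) (meson order_trans zero_le_one)
      finally have "((a t)\<^sup>2 * \<bar>\<integral>x. grad_inner \<A> g h (\<psi> t) x \<partial>vol\<bar>)\<^sup>2 \<le> H * energy t0"
        by (simp add: power_mult_distrib flip: power_mult)
      then have "(a t)\<^sup>2 * \<bar>\<integral>x. grad_inner \<A> g h (\<psi> t) x \<partial>vol\<bar> \<le> R"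
        unfolding R_def by (rule real_le_rsqrt)
      then have "a t * \<bar>\<integral>x. grad_inner \<A> g h (\<psi> t) x \<partial>vol\<bar> \<le> R * (1 / a t)"
        using at by (simp add: field_simps power2_eq_square)
      also have "\<dots> \<le> R * (C1 * t powr (\<kappa> - 1))"
      proof (intro mult_left_mono C1 t)
        show "R \<ge> 0" unfolding R_def energy_def
          using nonneg kinetic_nonneg gradient_nonneg a0 by simp
      qed
      finally show "\<bar>- a t * (\<integral>x. grad_inner \<A> g h (\<psi> t) x \<partial>vol)\<bar> \<le> R * C1 * t powr (\<kappa> - 1)"
        using at by (simp add: abs_mult mult.assoc)
    next
      fix t :: real assume t: "0 < t"
      show "1 / a t ^ 3 \<ge> 0" using scale_pos[OF t] by simp
      show "(J has_real_derivative - (1 / a t ^ 3)) (at t)" using J_deriv[OF t] .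
    qed (use J_at_top lim in auto)
    \<comment> \<open>At time \<open>t0\<close> the pairing of the time derivative with
      \<open>h\<close> is the kinetic energy itself.\<close>
    then have main: "a t0 ^ 3 * kinetic t0 \<le> sqrt (H * (a t0 ^ 6 * kinetic t0 + a t0 ^ 4 * gradient t0)) * (C * t0 powr \<kappa>)"
      by (simp add: h_def kinetic_def R_def energy_def C_def power2_eq_square)
    define \<sigma> where "\<sigma> = (t0 powr \<kappa>)\<^sup>2"
    have \<sigma>: "\<sigma> > 0" using t0 by (simp add: \<sigma>_def)
    have h1': "G * \<sigma> * L < \<epsilon> * (1 - G * \<sigma>) * kinetic t0" using h1 unfolding K L \<sigma>_def .
    have GL: "0 \<le> G * \<sigma> * L" using G \<sigma> nonneg by simp
    then have "0 < \<epsilon> * (1 - G * \<sigma>) * kinetic t0" using h1' by linarith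
    \<comment> \<open>The left side of the first hypothesis is nonnegative, so its strictness forces
      both remaining factors on the right to be positive.\<close>
    then have pos: "1 - G * \<sigma> > 0" "kinetic t0 > 0"
      using \<epsilon> kinetic_nonneg[of t0] by (auto simp: zero_less_mult_iff)
    have "\<epsilon> * (1 - G * \<sigma>) \<le> 1" using \<epsilon> pos G \<sigma> mult_le_one[of \<epsilon> "1 - G * \<sigma>"] by simp
    then have "\<epsilon> * (1 - G * \<sigma>) * kinetic t0 \<le> kinetic t0" using pos by simp
    then have KL: "G * \<sigma> * L < kinetic t0" using h1' by linarith
    \<comment> \<open>The second hypothesis enters only through this consequence, which bounds the
      energy at \<open>t0\<close> by twice its kinetic part.\<close>
    have "gradient t0 \<le> (1 + G * \<sigma>) * gradient t0"
      using gradient_nonneg[of t0] G \<sigma> by (simp add: algebra_simps)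
    also have "\<dots> \<le> (1 + G * \<sigma>) * gradient t0 + G * \<sigma> * (\<integral>x. grad_norm_sq \<A> g (laplacian \<A> g (\<psi> t0)) x \<partial>vol)"
      using nonneg(3) G \<sigma> by simp
    also have "\<dots> \<le> (1 - \<epsilon>) * (1 - G * \<sigma>) * (a t0)\<^sup>2 * kinetic t0"
      using h2 unfolding K Y \<sigma>_def by simp
    also have "\<dots> = ((1 - \<epsilon>) * (1 - G * \<sigma>)) * ((a t0)\<^sup>2 * kinetic t0)" by simp
    also have "\<dots> \<le> 1 * ((a t0)\<^sup>2 * kinetic t0)"
    proof (rule mult_right_mono)
      show "(1 - \<epsilon>) * (1 - G * \<sigma>) \<le> 1" using \<epsilon> pos G \<sigma> mult_le_one[of "1 - \<epsilon>" "1 - G * \<sigma>"] by simp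
    qed (use pos in simp)
    finally have grad: "gradient t0 \<le> (a t0)\<^sup>2 * kinetic t0" by simp
    \<comment> \<open>Green's identity with both arguments equal to \<open>h\<close>; Cauchy-Schwarz
      then gives the interpolation between \<open>h\<close> and its Laplacian.\<close>
    have "H = - (\<integral>x. h x * laplacian \<A> g h x \<partial>vol)" using green[OF C2M_D(1)[OF h] h] by (simp add: H_def)
    then have "H\<^sup>2 \<le> kinetic t0 * L"
      using integral_Cauchy_Schwarz[OF ch laplacian_continuous[OF h]] by (simp add: kinetic_def L_def h_def)
    moreover have "t0 powr \<kappa> \<le> 1" using t0 \<kappa> by (simp add: powr_le1)
    ultimately have "kinetic t0 \<le> 4 * C ^ 4 * (t0 powr \<kappa>)\<^sup>2 * L"
      using energy_contradiction[OF pos(2) nonneg(2) a0 _ _ nonneg(1) _ grad _ main] C by simp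
    also have "\<dots> = (G - 1) * \<sigma> * L" by (simp add: G_def \<sigma>_def)
    also have "\<dots> \<le> G * \<sigma> * L" using \<sigma> nonneg by (intro mult_right_mono) auto
    finally show False using KL by simp
  qed
  note main = this
  show ?thesis
    unfolding pow
  proof (intro exI[of _ G] conjI G)
    \<comment> \<open>The smallness of \<open>t0\<close> is used as \<open>t0 < 1\<close>, which
      gives \<open>t0 powr \<kappa> \<le> 1\<close>.\<close>
    have "\<forall>\<^sub>F t0 in at_right (0::real). 0 < t0 \<and> t0 < 1"
      unfolding eventually_at_right_field by (intro exI[of _ 1]) auto
    then show "\<forall>\<^sub>F t0 in at_right (0::real).
    \<forall>\<psi> A. smooth_wave \<A> g a \<psi> \<and> leading_coefficient \<A> a \<psi> A \<and>
      (\<exists>x. time_deriv \<psi> t0 x \<noteq> 0) \<and>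
      (\<exists>\<epsilon>. 0 < \<epsilon> \<and> \<epsilon> < 1 \<and>
        \<epsilon> * (1 - G * (t0 powr \<kappa>)\<^sup>2) * (\<integral>x. \<bar>time_deriv \<psi> t0 x\<bar>\<^sup>2 \<partial>vol)
          > G * (t0 powr \<kappa>)\<^sup>2
              * (\<integral>x. \<bar>time_deriv (\<lambda>t. laplacian \<A> g (\<psi> t)) t0 x\<bar>\<^sup>2 \<partial>vol) \<and>
        (1 - \<epsilon>) * (1 - G * (t0 powr \<kappa>)\<^sup>2) * (a t0)\<^sup>2
              * (\<integral>x. \<bar>time_deriv \<psi> t0 x\<bar>\<^sup>2 \<partial>vol)
          > (1 + G * (t0 powr \<kappa>)\<^sup>2) * (\<integral>x. grad_norm_sq \<A> g (\<psi> t0) x \<partial>vol)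
            + G * (t0 powr \<kappa>)\<^sup>2
              * (\<integral>x. grad_norm_sq \<A> g (laplacian \<A> g (\<psi> t0)) x \<partial>vol))
      \<longrightarrow> L2_norm vol A > 0"
      by eventually_elim (use main in blast)
  qed
qed

end
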